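(* Let $(a_1,\dots,a_5,b_1,\dots,b_5)\in\mathbb R^{10}$ satisfy $3a_5+a_3-a_1a_2>0$ and $3b_5+b_3-b_1b_2>0$, and put $$\mathcal D_1(x,y)=a_1x+a_2y+a_3x^2+a_4xy+a_5y^2,\qquad \mathcal D_2(x,y)=b_1x+b_2y+b_3x^2+b_4xy+b_5y^2,$$ $$\boldsymbol f_i(x,y)=\begin{pmatrix}-y\\ x+\mathcal D_i(x,y)\,y\end{pmatrix},\quad i\in\{1,2\}.$$ Let $K\in\mathbb R$. The switched system $(\dot x,\dot y)^\top=\boldsymbol f_\sigma(x,y)$ with the linear switching signal $$\sigma=\begin{cases}1,&\text{if } y-Kx>0,\\ 2,&\text{if } y-Kx<0,\end{cases}$$ is asymptotically stable if and only if the slope $K$ satisfies $$(b_1-a_1)K^3+(3a_2-3b_2)K^2+2a_2-2b_2<0.$$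
   Context: The switched system is the planar piecewise-smooth system equal to $(\dot x,\dot y)^\top=\boldsymbol f_1(x,y)$ in the half plane $y-Kx>0$ and to $(\dot x,\dot y)^\top=\boldsymbol f_2(x,y)$ in the half plane $y-Kx<0$, with orbits understood in Filippov's sense. The switched system is called asymptotically stable if its equilibrium at the origin $O=(0,0)$ is (locally) asymptotically stable in the sense of Lyapunov. *)

theory Defs
  imports "HOL-Analysis.Analysis"
begin

definition abs_continuous_on :: "real set \<Rightarrow> (real \<Rightarrow> 'a::real_normed_vector) \<Rightarrow> bool" where
  "abs_continuous_on S z \<longleftrightarrow>
     (\<forall>e>0. \<exists>d>0. \<forall>\<D> T. \<D> division_of T \<and> T \<subseteq> S \<and> (\<Sum>I\<in>\<D>. Sup I - Inf I) < d \<longrightarrow>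
        (\<Sum>I\<in>\<D>. norm (z (Sup I) - z (Inf I))) < e)"

definition locally_abs_continuous_on :: "real set \<Rightarrow> (real \<Rightarrow> 'a::real_normed_vector) \<Rightarrow> bool" where
  "locally_abs_continuous_on J z \<longleftrightarrow> (\<forall>a b. {a..b} \<subseteq> J \<longrightarrow> abs_continuous_on {a..b} z)"

text \<open>Filippov's convex regularization of a vector field: the limiting values near \<open>p\<close>, with null sets
  disregarded, convexified and closed.\<close>

definition filippov_map :: "('a::euclidean_space \<Rightarrow> 'a) \<Rightarrow> 'a \<Rightarrow> 'a set" where
  "filippov_map f p =
     (\<Inter>d\<in>{0<..}. \<Inter>N\<in>{N. negligible N}. closure (convex hull (f ` (ball p d - N))))"

text \<open>Forward solutions, starting at time \<open>0\<close>, of the autonomous differential inclusion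
  \<open>z' \<in> F z\<close> on a time interval \<open>J\<close>. The trivial interval \<open>J = {0}\<close> is allowed.\<close>

definition inclusion_solution ::
    "('a::euclidean_space \<Rightarrow> 'a set) \<Rightarrow> real set \<Rightarrow> (real \<Rightarrow> 'a) \<Rightarrow> bool" where
  "inclusion_solution F J z \<longleftrightarrow>
     is_interval J \<and> 0 \<in> J \<and> J \<subseteq> {0..} \<and> locally_abs_continuous_on J z \<and>
     (AE t in lebesgue. t \<in> J \<longrightarrow>
        (\<exists>v. (z has_vector_derivative v) (at t within J) \<and> v \<in> F (z t)))"

text \<open>As usual for differential inclusions, stability includes that every solution starting close to
  the equilibrium can be continued to all of \<open>{0..}\<close>. Since \<open>J = {0}\<close> is allowed, this also says that
  every initial point close to the equilibrium has a solution on \<open>{0..}\<close>.\<close>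

definition inclusion_stable :: "('a::euclidean_space \<Rightarrow> 'a set) \<Rightarrow> 'a \<Rightarrow> bool" where
  "inclusion_stable F p \<longleftrightarrow>
     (\<forall>e>0. \<exists>d>0. \<forall>J z. inclusion_solution F J z \<and> dist (z 0) p < d \<longrightarrow>
        (\<forall>t\<in>J. dist (z t) p < e) \<and>
        (\<exists>w. inclusion_solution F {0..} w \<and> (\<forall>t\<in>J. w t = z t)))"

definition inclusion_attractive :: "('a::euclidean_space \<Rightarrow> 'a set) \<Rightarrow> 'a \<Rightarrow> bool" where
  "inclusion_attractive F p \<longleftrightarrow>
     (\<exists>d>0. \<forall>z. inclusion_solution F {0..} z \<and> dist (z 0) p < d \<longrightarrow> (z \<longlongrightarrow> p) at_top)"

definition filippov_asymptotically_stable :: "('a::euclidean_space \<Rightarrow> 'a) \<Rightarrow> 'a \<Rightarrow> bool" where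
  "filippov_asymptotically_stable f p \<longleftrightarrow>
     0 \<in> filippov_map f p \<and>
     inclusion_stable (filippov_map f) p \<and> inclusion_attractive (filippov_map f) p"

definition quad_damping :: "real \<Rightarrow> real \<Rightarrow> real \<Rightarrow> real \<Rightarrow> real \<Rightarrow> real \<Rightarrow> real \<Rightarrow> real" where
  "quad_damping c1 c2 c3 c4 c5 x y = c1 * x + c2 * y + c3 * x\<^sup>2 + c4 * x * y + c5 * y\<^sup>2"

definition damped_field :: "(real \<Rightarrow> real \<Rightarrow> real) \<Rightarrow> real \<times> real \<Rightarrow> real \<times> real" where
  "damped_field D = (\<lambda>(x, y). (- y, x + D x y * y))"

text \<open>The value on the switching line \<open>y = K * x\<close>, which the switched system leaves unspecified, is
  arbitrary: the line is negligible, so \<open>filippov_map\<close> does not depend on it.\<close>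

definition switched_field ::
    "real \<Rightarrow> (real \<times> real \<Rightarrow> real \<times> real) \<Rightarrow> (real \<times> real \<Rightarrow> real \<times> real) \<Rightarrow> real \<times> real \<Rightarrow> real \<times> real" where
  "switched_field K f\<^sub>1 f\<^sub>2 = (\<lambda>(x, y). if y - K * x > 0 then f\<^sub>1 (x, y)
     else if y - K * x < 0 then f\<^sub>2 (x, y) else undefined)"

end

theory Submission
  imports Defs
begin

text \<open>
  The proof uses a Lyapunov function that is smooth on each of the two half planes. Put \<open>E = (x\<^sup>2 + y\<^sup>2) / 2\<close>,
  so that \<open>E' = y\<^sup>2 * D\<close> along the orbits. A cubic form \<open>Q\<close> on each half plane cancels the cubic part of \<open>E'\<close>,
  and on the switching line the two functions \<open>E + Q\<close> differ by \<open>S * x\<^sup>3 / 3\<close>, where \<open>S\<close> is the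
  expression of the theorem. If \<open>S \<noteq> 0\<close>, a further homogeneous cubic term restores continuity at the cost of a
  derivative of the sign of \<open>S\<close> and of size \<open>r\<^sup>3\<close>. If \<open>S = 0\<close>, a quartic form averages the terms of fourth
  order to \<open>\<eta> / 8 * r\<^sup>4\<close> with \<open>\<eta> = 3 * a\<^sub>5 + a\<^sub>3 - a\<^sub>1 * a\<^sub>2 > 0\<close> (respectively with the \<open>b\<^sub>i\<close>), so the origin is
  unstable.

  Near the origin solutions cross the switching line transversally, hence at countably many times only, and off
  those times the chain rule applies to the Lyapunov function. Stability also requires that solutions exist; these
  are constructed in polar coordinates, where the field is discontinuous only in the independent variable.
\<close>

subsection \<open>Absolutely continuous functions\<close>

text \<open>The number \<open>S\<close> is the leading coefficient of the return map. In each half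
  plane \<open>E + Q\<close> is constant up to terms of fourth order, and \<open>Q\<close> is odd.
  So the arc through \<open>y > K * x\<close>, from the ray \<open>x > 0\<close> to the opposite
  ray, changes \<open>E\<close> by twice the first cubic form at the starting point; the arc back
  subtracts twice the second form. A full turn therefore changes \<open>E\<close> by
  \<open>2 * S / 3 * x ^ 3\<close> to leading order. The return map itself is avoided. A Filippov
  solution is only absolutely continuous, and nothing says beforehand that it is unique, follows the
  two arcs or stays away from the origin, whereas monotonicity of one function treats all solutions
  at once. The price is a function that need not be differentiable on the switching line. Sliding
  along the line would make this fatal; it is excluded because \<open>x * (y - K * x)'\<close>
  equals \<open>x\<^sup>2 * (1 + K\<^sup>2 + K * D)\<close> on the line, which is positive near the
  origin, off the origin itself, for both fields.\<close>

lemma lipschitz_imp_abs_continuous_on: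
  fixes z :: "real \<Rightarrow> 'a::real_normed_vector"
  assumes "L-lipschitz_on S z"
  shows "abs_continuous_on S z"
  unfolding abs_continuous_on_def
proof (intro allI impI)
  fix e :: real assume e: "e > 0"
  have L: "L \<ge> 0" using assms by (rule lipschitz_on_nonneg)
  have "(\<Sum>I\<in>\<D>. norm (z (Sup I) - z (Inf I))) < e"
    if D: "\<D> division_of T" and T: "T \<subseteq> S" and s: "(\<Sum>I\<in>\<D>. Sup I - Inf I) < e / (L + 1)" for \<D> T
  proof -
    have bd: "norm (z (Sup I) - z (Inf I)) \<le> (L + 1) * (Sup I - Inf I)" if I: "I \<in> \<D>" for I
    proof -
      obtain u v where uv: "I = {u..v}" "u \<le> v"
        using division_ofD(3,4)[OF D I] by (metis box_real(2) atLeastatMost_empty_iff2 not_le)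
      have "u \<in> S" "v \<in> S" using division_ofD(2)[OF D I] T uv by auto
      then have "norm (z v - z u) \<le> L * (v - u)"
        using lipschitz_on_normD[OF assms, of v u] uv by (simp add: real_norm_def)
      also have "\<dots> \<le> (L + 1) * (v - u)" using uv by (intro mult_right_mono) auto
      finally show ?thesis using uv by simp
    qed
    have "(\<Sum>I\<in>\<D>. norm (z (Sup I) - z (Inf I))) \<le> (L + 1) * (\<Sum>I\<in>\<D>. Sup I - Inf I)"
      unfolding sum_distrib_left by (rule sum_mono) (rule bd)
    also have "\<dots> < e" using s L by (simp add: field_simps)
    finally show ?thesis .
  qed
  then show "\<exists>d>0. \<forall>\<D> T. \<D> division_of T \<and> T \<subseteq> S \<and> (\<Sum>I\<in>\<D>. Sup I - Inf I) < d \<longrightarrow>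
        (\<Sum>I\<in>\<D>. norm (z (Sup I) - z (Inf I))) < e"
    using e L by (intro exI[of _ "e / (L + 1)"]) auto
qed

lemma abs_continuous_onE:
  assumes "abs_continuous_on S z" and "e > 0"
  obtains d where "d > 0"
    and "\<And>\<D> T. \<D> division_of T \<Longrightarrow> T \<subseteq> S \<Longrightarrow> (\<Sum>I\<in>\<D>. Sup I - Inf I) < d \<Longrightarrow>
        (\<Sum>I\<in>\<D>. norm (z (Sup I) - z (Inf I))) < e"
proof -
  obtain d where "d > 0 \<and> (\<forall>\<D> T. \<D> division_of T \<and> T \<subseteq> S \<and> (\<Sum>I\<in>\<D>. Sup I - Inf I) < d \<longrightarrow>
        (\<Sum>I\<in>\<D>. norm (z (Sup I) - z (Inf I))) < e)"
    using assms(1)[unfolded abs_continuous_on_def, rule_format, OF assms(2)] ..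
  then show ?thesis by (intro that[of d]) (blast+)
qed

text \<open>The Lipschitz condition is imposed only on the values taken by \<open>z\<close>, since a
  Lyapunov function is controlled only near the equilibrium.\<close>

lemma abs_continuous_on_lipschitz_compose:
  fixes z :: "real \<Rightarrow> 'a::real_normed_vector" and g :: "'a \<Rightarrow> 'b::real_normed_vector"
  assumes z: "abs_continuous_on S z" and g: "L-lipschitz_on (z ` S) g"
  shows "abs_continuous_on S (\<lambda>t. g (z t))"
  unfolding abs_continuous_on_def
proof (intro allI impI)
  fix e :: real assume e: "e > 0"
  have L: "L \<ge> 0" using g by (rule lipschitz_on_nonneg)
  have "e / (L + 1) > 0" using e L by simp
  then obtain d where d: "d > 0"
    and dz: "\<And>\<D> T. \<D> division_of T \<Longrightarrow> T \<subseteq> S \<Longrightarrow> (\<Sum>I\<in>\<D>. Sup I - Inf I) < d \<Longrightarrow>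
        (\<Sum>I\<in>\<D>. norm (z (Sup I) - z (Inf I))) < e / (L + 1)"
    by (rule abs_continuous_onE[OF z]) blast
  have "(\<Sum>I\<in>\<D>. norm (g (z (Sup I)) - g (z (Inf I)))) < e"
    if D: "\<D> division_of T" and T: "T \<subseteq> S" and s: "(\<Sum>I\<in>\<D>. Sup I - Inf I) < d" for \<D> T
  proof -
    have bd: "norm (g (z (Sup I)) - g (z (Inf I))) \<le> (L + 1) * norm (z (Sup I) - z (Inf I))" if I: "I \<in> \<D>" for I
    proof -
      obtain u v where uv: "I = {u..v}" "u \<le> v"
        using division_ofD(3,4)[OF D I] by (metis box_real(2) atLeastatMost_empty_iff2 not_le)
      have "u \<in> S" "v \<in> S" using division_ofD(2)[OF D I] T uv by auto
      then have "norm (g (z v) - g (z u)) \<le> L * norm (z v - z u)"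
        using lipschitz_on_normD[OF g, of "z v" "z u"] by auto
      also have "\<dots> \<le> (L + 1) * norm (z v - z u)" by (intro mult_right_mono) auto
      finally show ?thesis using uv by simp
    qed
    have "(\<Sum>I\<in>\<D>. norm (g (z (Sup I)) - g (z (Inf I)))) \<le> (L + 1) * (\<Sum>I\<in>\<D>. norm (z (Sup I) - z (Inf I)))"
      unfolding sum_distrib_left by (rule sum_mono) (rule bd)
    also have "\<dots> < e" using dz[OF D T s] L by (simp add: field_simps)
    finally show ?thesis .
  qed
  then show "\<exists>d>0. \<forall>\<D> T. \<D> division_of T \<and> T \<subseteq> S \<and> (\<Sum>I\<in>\<D>. Sup I - Inf I) < d \<longrightarrow>
        (\<Sum>I\<in>\<D>. norm (g (z (Sup I)) - g (z (Inf I)))) < e"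
    using d by (intro exI[of _ d] conjI) blast+
qed

lemma abs_continuous_on_imp_continuous_on:
  fixes z :: "real \<Rightarrow> 'a::real_normed_vector"
  assumes "abs_continuous_on {a..b} z"
  shows "continuous_on {a..b} z"
  unfolding continuous_on_iff
proof (intro ballI allI impI)
  fix x e :: real assume x: "x \<in> {a..b}" and e: "e > 0"
  obtain d where d: "d > 0"
    and dz: "\<And>\<D> T. \<D> division_of T \<Longrightarrow> T \<subseteq> {a..b} \<Longrightarrow> (\<Sum>I\<in>\<D>. Sup I - Inf I) < d \<Longrightarrow>
        (\<Sum>I\<in>\<D>. norm (z (Sup I) - z (Inf I))) < e"
    by (rule abs_continuous_onE[OF assms e]) blast
  have *: "norm (z v - z u) < e" if "u \<in> {a..b}" "v \<in> {a..b}" "u \<le> v" "v - u < d" for u v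
  proof -
    have "{{u..v}} division_of {u..v}" using division_of_self[of u v] that by auto
    then have "(\<Sum>I\<in>{{u..v}}. norm (z (Sup I) - z (Inf I))) < e"
      by (rule dz) (use that in auto)
    then show ?thesis using that by simp
  qed
  have "dist (z y) (z x) < e" if "y \<in> {a..b}" "dist y x < d" for y
    using *[of x y] *[of y x] that x by (cases "x \<le> y") (auto simp: dist_norm norm_minus_commute)
  then show "\<exists>d>0. \<forall>y\<in>{a..b}. dist y x < d \<longrightarrow> dist (z y) (z x) < e"
    using d by blast
qed

text \<open>The straddle estimate of Henstock-Kurzweil theory: because \<open>t\<close> lies between
  \<open>x\<close> and \<open>y\<close>, the errors on the two sides add up to at most
  \<open>e * (y - x)\<close>, so the derivative at a tag controls the increment over a whole tagged
  interval.\<close>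

lemma derivative_lower_bound_straddle:
  fixes f :: "real \<Rightarrow> real"
  assumes "(f has_vector_derivative v) (at t within S)" and "c \<le> v" and "e > 0"
  shows "\<exists>d>0. \<forall>x\<in>S. \<forall>y\<in>S. x \<le> t \<and> t \<le> y \<and> x \<in> ball t d \<and> y \<in> ball t d \<longrightarrow>
           (c - e) * (y - x) \<le> f y - f x"
proof -
  have "\<exists>d>0. \<forall>y\<in>S. norm (y - t) < d \<longrightarrow> norm (f y - f t - (y - t) * v) \<le> e * norm (y - t)"
    using assms(1,3) unfolding has_vector_derivative_def has_derivative_within_alt real_scaleR_def by blast
  then obtain d where d: "d > 0"
    and dd: "\<And>y. y \<in> S \<Longrightarrow> norm (y - t) < d \<Longrightarrow> norm (f y - f t - (y - t) * v) \<le> e * norm (y - t)"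
    by blast
  have "(c - e) * (y - x) \<le> f y - f x"
    if "x \<in> S" "y \<in> S" "x \<le> t" "t \<le> y" "x \<in> ball t d" "y \<in> ball t d" for x y
  proof -
    have 1: "\<bar>f y - f t - (y - t) * v\<bar> \<le> e * (y - t)" using dd[of y] that by (simp add: dist_real_def)
    have 2: "\<bar>f x - f t - (x - t) * v\<bar> \<le> e * (t - x)" using dd[of x] that by (simp add: dist_real_def)
    have "(c - e) * (y - x) \<le> (v - e) * (y - x)" using assms(2) that by (intro mult_right_mono) auto
    also have "\<dots> \<le> f y - f x" using 1 2 by (simp add: algebra_simps abs_le_iff)
    finally show ?thesis .
  qed
  then show ?thesis using d by blast
qed

text \<open>A gauge argument replaces integration of the derivative, so neither measurability nor an
  upper bound of the derivative enters. Tags outside the exceptional null set are handled by the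
  straddle estimate. Intervals with tags inside it lie in an open set of tiny measure, and absolute
  continuity makes their total increment small.\<close>

lemma abs_continuous_growth:
  fixes f :: "real \<Rightarrow> real"
  assumes ab: "a \<le> b" and ac: "abs_continuous_on {a..b} f"
    and ae: "AE t in lebesgue. t \<in> {a..b} \<longrightarrow> (\<exists>v\<ge>c. (f has_vector_derivative v) (at t within {a..b}))"
  shows "c * (b - a) \<le> f b - f a"
proof -
  define E where "E = {t\<in>{a..b}. \<not> (\<exists>v\<ge>c. (f has_vector_derivative v) (at t within {a..b}))}"
  have "E \<in> null_sets lebesgue"
  proof -
    have "AE t in lebesgue. t \<notin> E" using ae by eventually_elim (auto simp: E_def)
    then obtain N where "N \<in> null_sets lebesgue" "{t \<in> space lebesgue. \<not> t \<notin> E} \<subseteq> N"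
      unfolding eventually_ae_filter by blast
    then show ?thesis using null_sets_completion_subset[of E N lborel] by simp
  qed
  then have E: "E \<in> sets lebesgue" by (rule null_setsD2)
  \<comment> \<open>The loss has three sources: \<open>e\<close> per unit length at the good tags,
    \<open>e\<close> for the increments over the bad intervals, and \<open>e\<close> for the growth
    \<open>c * l\<close> missing on their total length \<open>l\<close>.\<close>
  have "c * (b - a) - e * (b - a + 2) \<le> f b - f a" if e: "e > 0" for e
  proof -
    obtain d where d: "d > 0"
      and dz: "\<And>\<D> T. \<D> division_of T \<Longrightarrow> T \<subseteq> {a..b} \<Longrightarrow> (\<Sum>I\<in>\<D>. Sup I - Inf I) < d \<Longrightarrow>
          (\<Sum>I\<in>\<D>. norm (f (Sup I) - f (Inf I))) < e"
      by (rule abs_continuous_onE[OF ac e]) blast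
    \<comment> \<open>The first entry serves absolute continuity, the second keeps \<open>c\<close>
      times the length of the bad intervals below \<open>e\<close>.\<close>
    define d' where "d' = min d (e / (\<bar>c\<bar> + 1))"
    have d': "d' > 0" "d' \<le> d" "\<bar>c\<bar> * d' \<le> e"
    proof -
      show "d' > 0" "d' \<le> d" using d e by (auto simp: d'_def)
      have "\<bar>c\<bar> * d' \<le> (\<bar>c\<bar> + 1) * (e / (\<bar>c\<bar> + 1))"
        using e \<open>d' > 0\<close> by (intro mult_mono) (auto simp: d'_def)
      then show "\<bar>c\<bar> * d' \<le> e" by simp
    qed
    obtain G where G: "open G" "E \<subseteq> G" "G - E \<in> lmeasurable" "emeasure lebesgue (G - E) < ennreal d'"
      using sets_lebesgue_outer_open[OF E(1) d'(1)] by blast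
    have Gm: "G \<in> lmeasurable" "measure lebesgue G < d'"
    proof -
      have em: "emeasure lebesgue G = emeasure lebesgue (G - E)"
      proof -
        have "emeasure lebesgue G = emeasure lebesgue ((G - E) \<union> E)" using G(2) by (simp add: Un_absorb2)
        also have "\<dots> = emeasure lebesgue (G - E)"
          using \<open>E \<in> null_sets lebesgue\<close> G(3) by (intro emeasure_Un_null_set) auto
        finally show ?thesis .
      qed
      show Gl: "G \<in> lmeasurable"
        using em G by (intro fmeasurableI) (auto intro: order_less_trans)
      show "measure lebesgue G < d'"
        using em G(4) emeasure_eq_measure2[OF Gl] by (metis ennreal_less_iff measure_nonneg)
    qed
    have "\<exists>r>0. (t \<in> E \<longrightarrow> ball t r \<subseteq> G) \<and>
        (t \<in> {a..b} - E \<longrightarrow> (\<forall>x\<in>{a..b}. \<forall>y\<in>{a..b}. x \<le> t \<and> t \<le> y \<and> x \<in> ball t r \<and> y \<in> ball t r \<longrightarrow>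
           (c - e) * (y - x) \<le> f y - f x))" for t
    proof (cases "t \<in> E")
      case True
      then show ?thesis using G(1,2) by (meson DiffE open_contains_ball subsetD)
    next
      case False
      show ?thesis
      proof (cases "t \<in> {a..b}")
        case True
        then obtain v where "v \<ge> c" "(f has_vector_derivative v) (at t within {a..b})"
          using False unfolding E_def by blast
        from derivative_lower_bound_straddle[OF this(2,1) e] False show ?thesis by blast
      next
        case False
        then show ?thesis using \<open>t \<notin> E\<close> by (intro exI[of _ 1]) auto
      qed
    qed
    then obtain r where r: "\<And>t. r t > 0" "\<And>t. t \<in> E \<Longrightarrow> ball t (r t) \<subseteq> G"
        "\<And>t x y. t \<in> {a..b} - E \<Longrightarrow> x \<in> {a..b} \<Longrightarrow> y \<in> {a..b} \<Longrightarrow> x \<le> t \<Longrightarrow> t \<le> y \<Longrightarrow>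
           x \<in> ball t (r t) \<Longrightarrow> y \<in> ball t (r t) \<Longrightarrow> (c - e) * (y - x) \<le> f y - f x"
      by metis
    obtain p where p: "p tagged_division_of {a..b}" "(\<lambda>t. ball t (r t)) fine p"
      using fine_division_exists_real[OF gauge_ball_dependent, of r] r(1) by blast
    have fin: "finite p" using p(1) by blast
    define q where "q = {xk\<in>p. fst xk \<in> E}"
    have qp: "q \<subseteq> p" by (auto simp: q_def)
    have iv: "\<exists>u v. k = {u..v} \<and> u \<le> v \<and> t \<in> {u..v} \<and> {u..v} \<subseteq> {a..b} \<and> {u..v} \<subseteq> ball t (r t)"
      if "(t, k) \<in> p" for t k
    proof -
      have "t \<in> k" "k \<subseteq> {a..b}" "\<exists>u v. k = cbox u v" using tagged_division_ofD(2-4)[OF p(1) that] by auto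
      moreover have "k \<subseteq> ball t (r t)" using p(2) that unfolding fine_def by auto
      ultimately show ?thesis by auto
    qed
    have "p tagged_partial_division_of {a..b}" using p(1) by (simp add: tagged_division_of_def)
    then have "q tagged_partial_division_of {a..b}" using qp by (rule tagged_partial_division_subset)
    then have q: "q tagged_division_of \<Union>(snd ` q)" by (rule tagged_partial_division_of_Union_self)
    note Dq = division_of_tagged_division[OF q]
    have toD: "(\<Sum>I\<in>snd ` q. h (Sup I) (Inf I)) = (\<Sum>(t,k)\<in>q. h (Sup k) (Inf k))"
      if h: "\<And>u. h u u = 0" for h :: "real \<Rightarrow> real \<Rightarrow> real"
    proof -
      \<comment> \<open>The summation lemma demands the value zero on every interval with empty
        interior, including the empty one, where \<open>Sup\<close> and \<open>Inf\<close> are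
        unspecified.\<close>
      let ?d = "\<lambda>I. if I = {} then 0 else h (Sup I) (Inf I)"
      have ne: "I \<noteq> {}" if "(t, I) \<in> q" for t I using iv[of t I] qp that by auto
      have "(\<Sum>(t,k)\<in>q. ?d k) = (\<Sum>I\<in>snd ` q. ?d I)"
      proof (rule sum.over_tagged_division_lemma[OF q])
        fix u v :: real assume "box u v = {}"
        then show "?d (cbox u v) = 0" using h by (cases "u = v") auto
      qed
      moreover have "(\<Sum>(t,k)\<in>q. ?d k) = (\<Sum>(t,k)\<in>q. h (Sup k) (Inf k))"
        by (rule sum.cong) (use ne in auto)
      moreover have "(\<Sum>I\<in>snd ` q. ?d I) = (\<Sum>I\<in>snd ` q. h (Sup I) (Inf I))"
        by (rule sum.cong) (use ne in auto)
      ultimately show ?thesis by simp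
    qed
    have lenq: "(\<Sum>(t,k)\<in>q. Sup k - Inf k) < d'"
    proof -
      have "(\<Sum>(t,k)\<in>q. Sup k - Inf k) = (\<Sum>I\<in>snd ` q. Sup I - Inf I)"
        by (rule toD[symmetric]) simp
      also have "\<dots> = (\<Sum>I\<in>snd ` q. measure lebesgue I)"
      proof (rule sum.cong[OF refl])
        fix I assume "I \<in> snd ` q"
        then obtain t where "(t, I) \<in> p" using qp by auto
        from iv[OF this] show "Sup I - Inf I = measure lebesgue I" by auto
      qed
      also have "\<dots> = measure lebesgue (\<Union>(snd ` q))" using content_division[OF Dq] by simp
      also have "\<dots> \<le> measure lebesgue G"
      proof (rule measure_mono_fmeasurable)
        show "\<Union>(snd ` q) \<subseteq> G"
        proof (clarsimp simp: q_def)
          fix x t k assume "x \<in> k" "(t, k) \<in> p" "t \<in> E"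
          then show "x \<in> G" using iv[of t k] r(2)[of t] by auto
        qed
        show "\<Union>(snd ` q) \<in> sets lebesgue" using lmeasurable_division[OF Dq] by auto
      qed (rule Gm(1))
      finally show ?thesis using Gm(2) by simp
    qed
    have bad: "(\<Sum>(t,k)\<in>q. f (Sup k) - f (Inf k)) \<ge> - e"
    proof -
      have "(\<Sum>I\<in>snd ` q. norm (f (Sup I) - f (Inf I))) < e"
      proof (rule dz[OF Dq])
        show "\<Union>(snd ` q) \<subseteq> {a..b}" using iv qp by fastforce
        have "(\<Sum>I\<in>snd ` q. Sup I - Inf I) = (\<Sum>(t,k)\<in>q. Sup k - Inf k)" by (rule toD) simp
        then show "(\<Sum>I\<in>snd ` q. Sup I - Inf I) < d" using lenq d'(2) by linarith
      qed
      moreover have "(\<Sum>I\<in>snd ` q. norm (f (Sup I) - f (Inf I))) \<ge> - (\<Sum>I\<in>snd ` q. f (Sup I) - f (Inf I))"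
        unfolding sum_negf[symmetric] by (rule sum_mono) auto
      moreover have "(\<Sum>I\<in>snd ` q. f (Sup I) - f (Inf I)) = (\<Sum>(t,k)\<in>q. f (Sup k) - f (Inf k))"
        by (rule toD) simp
      ultimately show ?thesis by linarith
    qed
    have good: "(c - e) * (\<Sum>(t,k)\<in>p - q. Sup k - Inf k) \<le> (\<Sum>(t,k)\<in>p - q. f (Sup k) - f (Inf k))"
      unfolding sum_distrib_left
    proof (rule sum_mono, clarify)
      fix t k assume tk: "(t, k) \<in> p" "(t, k) \<notin> q"
      obtain u v where uv: "k = {u..v}" "u \<le> v" "t \<in> {u..v}" "{u..v} \<subseteq> {a..b}" "{u..v} \<subseteq> ball t (r t)"
        using iv[OF tk(1)] by blast
      have "t \<in> {a..b} - E" using tk uv by (auto simp: q_def)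
      then have "(c - e) * (v - u) \<le> f v - f u"
        by (rule r(3)) (use uv in \<open>auto simp: subset_iff\<close>)
      then show "(c - e) * (Sup k - Inf k) \<le> f (Sup k) - f (Inf k)" using uv by simp
    qed
    have split: "(\<Sum>x\<in>p. g x) = (\<Sum>x\<in>p - q. g x) + (\<Sum>x\<in>q. g x)" for g :: "_ \<Rightarrow> real"
      using sum.subset_diff[OF qp fin] by blast
    define l where "l = (\<Sum>(t,k)\<in>q. Sup k - Inf k)"
    have l: "0 \<le> l" "l < d'"
    proof -
      show "l < d'" using lenq by (simp add: l_def)
      show "0 \<le> l" unfolding l_def
      proof (rule sum_nonneg, clarify)
        fix t k assume "(t, k) \<in> q"
        then have "(t, k) \<in> p" using qp by blast
        from iv[OF this] show "0 \<le> Sup k - Inf k" by auto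
      qed
    qed
    have "(\<Sum>(t,k)\<in>p. Sup k - Inf k) = b - a"
      using additive_tagged_division_1[OF ab p(1), of "\<lambda>x. x"] .
    then have lp: "(\<Sum>(t,k)\<in>p - q. Sup k - Inf k) = b - a - l"
      using split[of "\<lambda>(t,k). Sup k - Inf k"] by (simp add: l_def)
    have "f b - f a = (\<Sum>(t,k)\<in>p. f (Sup k) - f (Inf k))"
      using additive_tagged_division_1[OF ab p(1), of f] by simp
    also have "\<dots> \<ge> (c - e) * (b - a - l) - e"
      using split[of "\<lambda>(t,k). f (Sup k) - f (Inf k)"] bad good lp by simp
    finally have fin1: "(c - e) * (b - a - l) - e \<le> f b - f a" .
    have "c * l \<le> \<bar>c\<bar> * d'" using l by (intro mult_mono) auto
    then have "c * l \<le> e" using d' by linarith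
    moreover have "0 \<le> e * l" using e l by simp
    ultimately have "c * (b - a) - e * (b - a + 2) \<le> (c - e) * (b - a - l) - e"
      by (simp add: algebra_simps)
    then show ?thesis using fin1 by linarith
  qed
  note key = this
  show ?thesis
  proof (rule field_le_epsilon)
    fix e :: real assume "e > 0"
    then show "c * (b - a) \<le> f b - f a + e"
      using key[of "e / (b - a + 2)"] ab by simp
  qed
qed

subsection \<open>Filippov solutions\<close>

lemma filippov_map_subset:
  assumes "d > 0" and "negligible N" and "closed C" and "convex C"
    and "\<And>q. q \<in> ball p d \<Longrightarrow> q \<notin> N \<Longrightarrow> f q \<in> C"
  shows "filippov_map f p \<subseteq> C"
proof
  fix v assume "v \<in> filippov_map f p"
  then have "v \<in> closure (convex hull (f ` (ball p d - N)))"
    using assms(1,2) unfolding filippov_map_def by blast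
  also have "\<dots> \<subseteq> C"
    using assms(3-5) by (intro closure_minimal hull_minimal) auto
  finally show "v \<in> C" .
qed

text \<open>The limit is taken off a null set so that the origin is covered too: there the field
  tends to zero, although its values on the switching line are unspecified. A ball is not
  negligible, so removing a further null set leaves points close to \<open>p\<close>, whence the
  limit belongs to the regularization.\<close>

lemma filippov_map_eq:
  assumes f: "(f \<longlongrightarrow> l) (at p within - N)" and N: "negligible N"
  shows "filippov_map f p = {l}"
proof
  show "filippov_map f p \<subseteq> {l}"
  proof
    fix v assume v: "v \<in> filippov_map f p"
    have "dist l v \<le> e" if e: "e > 0" for e
    proof -
      from f e obtain d where d: "d > 0"
        and dd: "\<And>q. q \<notin> N \<Longrightarrow> q \<noteq> p \<Longrightarrow> dist q p < d \<Longrightarrow> dist (f q) l < e"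
        unfolding Lim_within by (auto simp: dist_commute)
      \<comment> \<open>The limit says nothing about \<open>f p\<close>, so the point
        \<open>p\<close> joins the discarded null set.\<close>
      have "filippov_map f p \<subseteq> cball l e"
      proof (rule filippov_map_subset[OF d, of "insert p N"])
        show "f q \<in> cball l e" if "q \<in> ball p d" "q \<notin> insert p N" for q
          using dd[of q] that by (auto simp: dist_commute less_imp_le)
      qed (use N in \<open>auto intro: negligible_insert[THEN iffD2]\<close>)
      then show ?thesis using v by auto
    qed
    then have "dist l v \<le> 0" by (rule field_le_epsilon) simp
    then show "v \<in> {l}" by simp
  qed
  show "{l} \<subseteq> filippov_map f p"
    unfolding filippov_map_def
  proof (clarsimp)
    fix d :: real and N' :: "'a set" assume d: "d > 0" and N': "negligible N'"
    have "\<exists>y\<in>convex hull (f ` (ball p d - N')). dist y l < e" if e: "e > 0" for e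
    proof -
      from f e obtain r where r: "r > 0"
        and rr: "\<And>q. q \<notin> N \<Longrightarrow> q \<noteq> p \<Longrightarrow> dist q p < r \<Longrightarrow> dist (f q) l < e"
        unfolding Lim_within by (auto simp: dist_commute)
      have "negligible (insert p (N \<union> N'))" using N N' by simp
      moreover have "\<not> negligible (ball p (min d r))"
        using d r by (intro open_not_negligible) auto
      ultimately have "\<not> ball p (min d r) \<subseteq> insert p (N \<union> N')"
        using negligible_subset by blast
      then obtain q where q: "q \<in> ball p (min d r)" "q \<notin> insert p (N \<union> N')" by blast
      then have "dist (f q) l < e" using rr[of q] by (auto simp: dist_commute)
      moreover have "f q \<in> convex hull (f ` (ball p d - N'))" using q by (intro hull_inc) auto
      ultimately show ?thesis by blast
    qed
    then show "l \<in> closure (convex hull (f ` (ball p d - N')))" by (simp add: closure_approachable)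
  qed
qed

text \<open>Isolated points inject into a countable basis: a basic open set that meets
  \<open>A\<close> in a single point determines that point.\<close>

lemma countable_isolated_subset:
  fixes A :: "'a::second_countable_topology set"
  assumes "\<And>t. t \<in> A \<Longrightarrow> \<exists>U. open U \<and> A \<inter> U = {t}"
  shows "countable A"
proof -
  obtain B :: "'a set set" where B: "countable B" "topological_basis B"
    using ex_countable_basis by blast
  have "\<exists>b\<in>B. A \<inter> b = {t}" if "t \<in> A" for t
  proof -
    from assms[OF that] obtain U where U: "open U" "A \<inter> U = {t}" by blast
    then obtain b where "b \<in> B" "t \<in> b" "b \<subseteq> U"
      using topological_basisE[OF B(2) U(1), of t] by blast
    then show ?thesis using U(2) that by blast
  qed
  then obtain b where b: "\<And>t. t \<in> A \<Longrightarrow> b t \<in> B \<and> A \<inter> b t = {t}" by metis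
  then have "inj_on b A" by (intro inj_onI) (metis singleton_inject)
  moreover have "countable (b ` A)" using b B(1) by (meson countable_subset image_subsetI)
  ultimately show ?thesis by (rule countable_image_inj_on[rotated])
qed

text \<open>A nonzero derivative \<open>v\<close> isolates a zero: close to \<open>t\<close> the
  linear part \<open>\<bar>v\<bar> * \<bar>y - t\<bar>\<close> exceeds the error, which is at most
  half of it. Applied to the distance from the switching line, this makes the crossing times
  countable and hence negligible.\<close>

lemma countable_transversal_zeros:
  fixes g :: "real \<Rightarrow> real"
  shows "countable {t\<in>S. g t = 0 \<and> (\<exists>v. v \<noteq> 0 \<and> (g has_vector_derivative v) (at t within S))}"
    (is "countable ?A")
proof (rule countable_isolated_subset)
  fix t assume "t \<in> ?A"
  then obtain v where t: "t \<in> S" "g t = 0" and v: "v \<noteq> 0" "(g has_vector_derivative v) (at t within S)"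
    by blast
  have "\<exists>d>0. \<forall>y\<in>S. norm (y - t) < d \<longrightarrow> norm (g y - g t - (y - t) * v) \<le> \<bar>v\<bar> / 2 * norm (y - t)"
    using v(2) half_gt_zero[of "\<bar>v\<bar>"] v(1)
    unfolding has_vector_derivative_def has_derivative_within_alt real_scaleR_def zero_less_abs_iff by blast
  then obtain d where d: "d > 0"
    and dd: "\<And>y. y \<in> S \<Longrightarrow> norm (y - t) < d \<Longrightarrow> norm (g y - g t - (y - t) * v) \<le> \<bar>v\<bar> / 2 * norm (y - t)"
    by blast
  have "y = t" if "y \<in> S" "y \<in> ball t d" "g y = 0" for y
  proof (rule ccontr)
    assume "y \<noteq> t"
    have "\<bar>y - t\<bar> * \<bar>v\<bar> \<le> \<bar>v\<bar> / 2 * \<bar>y - t\<bar>"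
      using dd[of y] that t by (simp add: dist_real_def abs_minus_commute abs_mult)
    then show False using v(1) \<open>y \<noteq> t\<close> by (simp add: field_simps)
  qed
  then have "?A \<inter> ball t d = {t}" using \<open>t \<in> ?A\<close> d by auto
  then show "\<exists>U. open U \<and> ?A \<inter> U = {t}" by blast
qed

section \<open>Chain rule and Lipschitz bounds along solutions\<close>

lemma inclusion_solution_continuous_on:
  assumes z: "inclusion_solution F J z" and "{a..b} \<subseteq> J"
  shows "continuous_on {a..b} z"
  using assms unfolding inclusion_solution_def locally_abs_continuous_on_def
  by (blast intro: abs_continuous_on_imp_continuous_on)

lemma inclusion_solution_interval:
  assumes "inclusion_solution F J z" and "a \<in> J" "b \<in> J"
  shows "{a..b} \<subseteq> J"
  using assms unfolding inclusion_solution_def is_interval_1 by (meson atLeastAtMost_iff subsetI)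

text \<open>The countable set \<open>E\<close> absorbs the times at which \<open>g\<close> has no
  derivative at \<open>z t\<close>. The derivative condition offers the velocity \<open>v\<close> of
  the solution itself, so that a proof that such times lie in \<open>E\<close> may use it.\<close>

lemma inclusion_solution_growth:
  fixes g :: "'a::euclidean_space \<Rightarrow> real"
  assumes z: "inclusion_solution F J z" and ab: "a \<le> b" "{a..b} \<subseteq> J"
    and g: "L-lipschitz_on (z ` {a..b}) g"
    and E: "countable E"
    and deriv: "\<And>t v. t \<in> {a..b} \<Longrightarrow> t \<notin> E \<Longrightarrow> (z has_vector_derivative v) (at t within {a..b}) \<Longrightarrow> v \<in> F (z t) \<Longrightarrow>
          \<exists>g'. (g has_derivative g') (at (z t)) \<and> c \<le> g' v"
  shows "c * (b - a) \<le> g (z b) - g (z a)"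
proof (rule abs_continuous_growth[OF ab(1)])
  show "abs_continuous_on {a..b} (\<lambda>t. g (z t))"
    using z ab(2) unfolding inclusion_solution_def locally_abs_continuous_on_def
    by (intro abs_continuous_on_lipschitz_compose[OF _ g]) blast
  have "E \<in> null_sets lebesgue"
    using countable_imp_null_set_lborel[OF E] by (rule null_sets_completionI)
  then have "AE t in lebesgue. t \<notin> E" by (rule AE_not_in)
  moreover have "AE t in lebesgue. t \<in> J \<longrightarrow> (\<exists>v. (z has_vector_derivative v) (at t within J) \<and> v \<in> F (z t))"
    using z unfolding inclusion_solution_def by blast
  ultimately show "AE t in lebesgue. t \<in> {a..b} \<longrightarrow>
      (\<exists>v\<ge>c. ((\<lambda>t. g (z t)) has_vector_derivative v) (at t within {a..b}))"
  proof eventually_elim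
    case (elim t)
    show ?case
    proof
      assume t: "t \<in> {a..b}"
      then obtain v where v: "(z has_vector_derivative v) (at t within J)" "v \<in> F (z t)"
        using elim ab(2) by blast
      have v': "(z has_vector_derivative v) (at t within {a..b})"
        using v(1) ab(2) by (rule has_vector_derivative_within_subset)
      obtain g' where g': "(g has_derivative g') (at (z t))" "c \<le> g' v"
        using deriv[OF t elim(1) v' v(2)] by blast
      have "((g \<circ> z) has_vector_derivative g' v) (at t within {a..b})"
        by (rule vector_derivative_diff_chain_within[OF v' has_derivative_at_withinI[OF g'(1)]])
      then show "\<exists>v\<ge>c. ((\<lambda>t. g (z t)) has_vector_derivative v) (at t within {a..b})"
        using g'(2) by (auto simp: o_def)
    qed
  qed
qed

text \<open>The mean value inequality for vector-valued functions: the increment is tested against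
  its own direction \<open>u\<close>, which reduces it to the scalar growth estimate for the linear
  functional \<open>\<lambda>w. w \<bullet> u\<close>.\<close>

lemma inclusion_solution_lipschitz:
  assumes z: "inclusion_solution F J z" and B: "B \<ge> 0"
    and F: "\<And>t. t \<in> J \<Longrightarrow> F (z t) \<subseteq> cball 0 B"
  shows "B-lipschitz_on J z"
proof (rule lipschitz_on_leI[OF _ B])
  fix a b assume ab: "a \<in> J" "b \<in> J" "a \<le> b"
  have sub: "{a..b} \<subseteq> J" using inclusion_solution_interval[OF z ab(1,2)] .
  define u where "u = z a - z b"
  have bl: "bounded_linear (\<lambda>w. w \<bullet> u)" by (rule bounded_linear_inner_left)
  obtain L where L: "L-lipschitz_on (z ` {a..b}) (\<lambda>w. w \<bullet> u)"
    using bounded_linear.lipschitz_boundE[OF bl] by metis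
  have "(- (B * norm u)) * (b - a) \<le> z b \<bullet> u - z a \<bullet> u"
  proof (rule inclusion_solution_growth[OF z ab(3) sub L countable_empty])
    fix t v assume t: "t \<in> {a..b}" and v: "v \<in> F (z t)"
    have "t \<in> J" using t sub by blast
    then have "norm v \<le> B" using F[of t] v by auto
    have "\<bar>v \<bullet> u\<bar> \<le> norm v * norm u" by (rule Cauchy_Schwarz_ineq2)
    also have "\<dots> \<le> B * norm u" using \<open>norm v \<le> B\<close> by (intro mult_right_mono) auto
    finally have "- (B * norm u) \<le> v \<bullet> u" by linarith
    then show "\<exists>g'. ((\<lambda>w. w \<bullet> u) has_derivative g') (at (z t)) \<and> - (B * norm u) \<le> g' v"
      using bounded_linear_imp_has_derivative[OF bl] by blast
  qed
  then have "norm u * norm u \<le> B * (b - a) * norm u"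
    unfolding power2_eq_square[symmetric] power2_norm_eq_inner u_def
    by (simp add: algebra_simps inner_diff_left inner_commute)
  then have "norm u \<le> B * (b - a)" using ab B by (cases "u = 0") auto
  then show "dist (z a) (z b) \<le> B * dist a b" using ab by (simp add: u_def dist_norm)
qed

section \<open>Concatenation of solutions\<close>

lemma has_vector_derivative_within_interior_cong:
  fixes t :: real
  assumes "(z has_vector_derivative v) (at t within S)" and "t \<in> U" "open U" "U \<subseteq> S" "U \<subseteq> T"
    and "\<And>s. s \<in> U \<Longrightarrow> w s = z s"
  shows "(w has_vector_derivative v) (at t within T)"
proof -
  have U: "at t within U = at t" using assms(2,3) by (rule at_within_open)
  have "(z has_vector_derivative v) (at t within U)"
    using assms(1,4) by (rule has_vector_derivative_within_subset)
  then have "(w has_vector_derivative v) (at t within U)"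
    using has_vector_derivative_transform[of t U w z v] assms(2,6) by blast
  then show ?thesis unfolding U by (rule has_vector_derivative_at_within)
qed

lemma inclusion_solution_lipschitzI:
  assumes "is_interval J" "0 \<in> J" "J \<subseteq> {0..}" and "\<And>a b. {a..b} \<subseteq> J \<Longrightarrow> \<exists>L. L-lipschitz_on {a..b} z"
    and "AE t in lebesgue. t \<in> J \<longrightarrow> (\<exists>v. (z has_vector_derivative v) (at t within J) \<and> v \<in> F (z t))"
  shows "inclusion_solution F J z"
  using assms unfolding inclusion_solution_def locally_abs_continuous_on_def
  by (blast intro: lipschitz_imp_abs_continuous_on)

text \<open>The interval \<open>J\<close> may be open at its right end \<open>T\<close>, so the
  second solution starts at the value of an extension \<open>g\<close> of \<open>z\<close> to the
  closure. Lipschitz bounds on both pieces give one for the concatenation and hence absolute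
  continuity.\<close>

lemma inclusion_solution_append:
  assumes z: "inclusion_solution F J z" and y: "inclusion_solution F {0..} y"
    and zL: "L-lipschitz_on J z" and yM: "M-lipschitz_on {0..} y"
    and T: "T \<ge> 0" "closure J = {0..T}"
    and lim: "g T = y 0" "L-lipschitz_on {0..T} g" "\<And>t. t \<in> J \<Longrightarrow> g t = z t"
  defines "w \<equiv> \<lambda>t. if t \<le> T then g t else y (t - T)"
  shows "inclusion_solution F {0..} w"
proof (rule inclusion_solution_lipschitzI)
  show "\<exists>C. C-lipschitz_on {a..b} w" if "{a..b} \<subseteq> {0..}" for a b
  proof -
    have "M-lipschitz_on {T..b} (\<lambda>t. y (t - T))"
    proof (rule lipschitz_onI)
      fix s t assume "s \<in> {T..b}" "t \<in> {T..b}"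
      then show "dist (y (s - T)) (y (t - T)) \<le> M * dist s t"
        using lipschitz_onD[OF yM, of "s - T" "t - T"] by (simp add: dist_real_def)
    qed (rule lipschitz_on_nonneg[OF yM])
    then have "(max L M)-lipschitz_on {0..b} w"
      unfolding w_def using lim(1,2) by (intro lipschitz_on_concat_max) simp_all
    moreover have "{a..b} \<subseteq> {0..b}" using that by (cases "a \<le> b") auto
    ultimately show ?thesis by (blast intro: lipschitz_on_subset)
  qed
  have interior: "{0<..<T} \<subseteq> J"
  proof
    fix t assume t: "t \<in> {0<..<T}"
    have "convex J" using z by (simp add: inclusion_solution_def is_interval_convex_1)
    then have "interior (closure J) \<subseteq> J"
      using convex_interior_closure[of J] interior_subset by simp
    then show "t \<in> J" using t T by (auto simp: interior_atLeastAtMost_real)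
  qed
  have "AE t in lebesgue. t \<in> J \<longrightarrow> (\<exists>v. (z has_vector_derivative v) (at t within J) \<and> v \<in> F (z t))"
    using z unfolding inclusion_solution_def by blast
  moreover have "AE t in lebesgue. t - T \<in> {0..} \<longrightarrow>
      (\<exists>v. (y has_vector_derivative v) (at (t - T) within {0..}) \<and> v \<in> F (y (t - T)))"
  proof -
    let ?E = "{t. \<not> (t \<in> {0..} \<longrightarrow> (\<exists>v. (y has_vector_derivative v) (at t within {0..}) \<and> v \<in> F (y t)))}"
    have "AE t in lebesgue. t \<in> {0..} \<longrightarrow> (\<exists>v. (y has_vector_derivative v) (at t within {0..}) \<and> v \<in> F (y t))"
      using y unfolding inclusion_solution_def by blast
    then obtain N where N: "N \<in> null_sets lebesgue" "?E \<subseteq> N"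
      unfolding eventually_ae_filter by auto
    have "negligible ((+) T ` N)" using N(1) by (simp add: negligible_iff_null_sets[symmetric] negligible_translation)
    then have "AE t in lebesgue. t \<notin> (+) T ` N" by (simp add: negligible_iff_null_sets AE_not_in)
    then show ?thesis
    proof eventually_elim
      case (elim t)
      then have "t - T \<notin> N" by (metis add.commute diff_add_cancel image_eqI)
      then have "t - T \<notin> ?E" using N(2) by blast
      then show ?case by blast
    qed
  qed
  \<comment> \<open>At \<open>T\<close> the velocities of the two pieces may differ, and at
    \<open>0\<close> there is no open neighbourhood in the time domain. Both times are
    negligible.\<close>
  moreover have "AE t in lebesgue. t \<notin> {0, T}"
    by (rule AE_not_in) (simp add: negligible_iff_null_sets[symmetric])
  ultimately show "AE t in lebesgue. t \<in> {0..} \<longrightarrow>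
      (\<exists>v. (w has_vector_derivative v) (at t within {0..}) \<and> v \<in> F (w t))"
  proof eventually_elim
    case (elim t)
    show ?case
    proof
      assume t: "t \<in> {0..}"
      show "\<exists>v. (w has_vector_derivative v) (at t within {0..}) \<and> v \<in> F (w t)"
      proof (cases "t < T")
        case True
        then have tU: "t \<in> {0<..<T}" using t elim(3) by auto
        then have tJ: "t \<in> J" using interior by blast
        then obtain v where v: "(z has_vector_derivative v) (at t within J)" "v \<in> F (z t)"
          using elim(1) by blast
        have "(w has_vector_derivative v) (at t within {0..})"
          by (rule has_vector_derivative_within_interior_cong[OF v(1) tU _ interior])
             (use lim(3) interior in \<open>auto simp: w_def\<close>)
        moreover have "w t = z t" using True lim(3)[OF tJ] by (simp add: w_def)
        ultimately show ?thesis using v(2) by metis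
      next
        case False
        then have tT: "t > T" using elim(3) by auto
        then obtain v where v: "(y has_vector_derivative v) (at (t - T) within {0..})" "v \<in> F (y (t - T))"
          using elim(2) by force
        have "(y has_vector_derivative v) (at (t - T) within {0<..})"
          using v(1) by (rule has_vector_derivative_within_subset) auto
        moreover have "at (t - T) within {0<..} = at (t - T)"
          using tT by (intro at_within_open) auto
        ultimately have "(y has_vector_derivative v) (at (t - T))" by metis
        moreover have "((\<lambda>t. t - T) has_vector_derivative 1) (at t)"
          by (auto intro!: derivative_eq_intros)
        ultimately have "((\<lambda>t. y (t - T)) has_vector_derivative v) (at t)"
          using vector_diff_chain_at[of "\<lambda>t. t - T" 1 t y v] by (simp add: o_def)
        then have "(w has_vector_derivative v) (at t within {0..})"
          by (rule has_vector_derivative_within_interior_cong[of _ _ _ UNIV "{T<..}"])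
             (use tT T in \<open>auto simp: w_def\<close>)
        then show ?thesis using v(2) tT by (auto simp: w_def)
      qed
    qed
  qed
qed (auto simp: is_interval_1)

subsection \<open>The switched oscillator\<close>

lemma abs_fst_le_norm: "\<bar>fst p\<bar> \<le> norm p" and abs_snd_le_norm: "\<bar>snd p\<bar> \<le> norm p" for p :: "real \<times> real"
  using norm_fst_le[of "fst p" "snd p"] norm_snd_le[of "snd p" "fst p"] by simp_all

locale switched_oscillator =
  fixes K :: real and D\<^sub>1 D\<^sub>2 :: "real \<Rightarrow> real \<Rightarrow> real" and L :: real
  assumes D_zero: "D\<^sub>1 0 0 = 0" "D\<^sub>2 0 0 = 0"
    and D_lipschitz: "L-lipschitz_on (cball 0 1) (\<lambda>(x, y). D\<^sub>1 x y)" "L-lipschitz_on (cball 0 1) (\<lambda>(x, y). D\<^sub>2 x y)"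
begin

abbreviation field :: "real \<times> real \<Rightarrow> real \<times> real" where
  "field \<equiv> switched_field K (damped_field D\<^sub>1) (damped_field D\<^sub>2)"

definition side :: "real \<times> real \<Rightarrow> real" where
  "side p = snd p - K * fst p"

text \<open>The choice of \<open>D\<^sub>2\<close> on the line itself is arbitrary:
  \<open>damping\<close> is related to \<open>field\<close> only off the line.\<close>

definition damping :: "real \<times> real \<Rightarrow> real" where
  "damping p = (if side p > 0 then D\<^sub>1 (fst p) (snd p) else D\<^sub>2 (fst p) (snd p))"

text \<open>Inside this radius the angular velocity is positive and the switching line is crossed
  transversally.\<close>

definition rad :: real where
  "rad = 1 / (2 * (1 + \<bar>K\<bar>) * (L + 1))"

lemma L_nonneg: "0 \<le> L"
  using D_lipschitz(1) by (rule lipschitz_on_nonneg)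

lemma rad_pos: "0 < rad"
  using L_nonneg by (simp add: rad_def)

lemma rad_le_half: "rad \<le> 1 / 2"
proof -
  have "1 * 1 \<le> (1 + \<bar>K\<bar>) * (L + 1)" using L_nonneg by (intro mult_mono) auto
  then show ?thesis by (simp add: rad_def field_simps)
qed

lemma D_bound:
  assumes "norm p \<le> 1"
  shows "\<bar>D\<^sub>1 (fst p) (snd p)\<bar> \<le> L * norm p" "\<bar>D\<^sub>2 (fst p) (snd p)\<bar> \<le> L * norm p"
  using lipschitz_on_normD[OF D_lipschitz(1), of p 0] lipschitz_on_normD[OF D_lipschitz(2), of p 0] assms
  by (auto simp: D_zero case_prod_beta)

text \<open>The inequality for which \<open>rad\<close> is chosen. The summand \<open>1\<close> of
  the factor yields \<open>\<bar>D\<bar> \<le> 1 / 2\<close>, which keeps the angular velocity at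
  least \<open>1 / 2\<close>; the summand \<open>\<bar>K\<bar>\<close> yields
  \<open>\<bar>K * D\<bar> \<le> 1 / 2\<close>, which gives transversality.\<close>

lemma L_rad: "(1 + \<bar>K\<bar>) * (L * norm p) \<le> 1 / 2" if "norm p \<le> rad"
proof -
  have "(1 + \<bar>K\<bar>) * (L * norm p) \<le> (1 + \<bar>K\<bar>) * ((L + 1) * rad)"
    using that L_nonneg rad_pos by (intro mult_left_mono mult_mono) auto
  also have "\<dots> = 1 / 2"
  proof -
    have "1 + \<bar>K\<bar> \<noteq> 0" "L + 1 \<noteq> 0" using L_nonneg by auto
    then show ?thesis by (simp add: rad_def)
  qed
  finally show ?thesis .
qed

lemma D_bound_rad:
  assumes "norm p \<le> rad"
  shows "(1 + \<bar>K\<bar>) * \<bar>D\<^sub>1 (fst p) (snd p)\<bar> \<le> 1 / 2" "(1 + \<bar>K\<bar>) * \<bar>D\<^sub>2 (fst p) (snd p)\<bar> \<le> 1 / 2"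
proof -
  have n1: "norm p \<le> 1" using assms rad_le_half by simp
  have "(1 + \<bar>K\<bar>) * \<bar>D\<^sub>1 (fst p) (snd p)\<bar> \<le> (1 + \<bar>K\<bar>) * (L * norm p)"
    using D_bound(1)[OF n1] by (intro mult_left_mono) auto
  then show "(1 + \<bar>K\<bar>) * \<bar>D\<^sub>1 (fst p) (snd p)\<bar> \<le> 1 / 2" using L_rad[OF assms] by linarith
  have "(1 + \<bar>K\<bar>) * \<bar>D\<^sub>2 (fst p) (snd p)\<bar> \<le> (1 + \<bar>K\<bar>) * (L * norm p)"
    using D_bound(2)[OF n1] by (intro mult_left_mono) auto
  then show "(1 + \<bar>K\<bar>) * \<bar>D\<^sub>2 (fst p) (snd p)\<bar> \<le> 1 / 2" using L_rad[OF assms] by linarith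
qed

lemma D_continuous_on:
  "continuous_on (ball 0 1) (\<lambda>p. D\<^sub>1 (fst p) (snd p))" "continuous_on (ball 0 1) (\<lambda>p. D\<^sub>2 (fst p) (snd p))"
  using D_lipschitz[THEN lipschitz_on_continuous_on, THEN continuous_on_subset, OF ball_subset_cball]
  by (simp_all add: case_prod_beta)

lemma D_tendsto:
  assumes "norm p < 1"
  shows "((\<lambda>q. D\<^sub>1 (fst q) (snd q)) \<longlongrightarrow> D\<^sub>1 (fst p) (snd p)) (at p)"
    "((\<lambda>q. D\<^sub>2 (fst q) (snd q)) \<longlongrightarrow> D\<^sub>2 (fst p) (snd p)) (at p)"
  using D_continuous_on assms by (auto simp: continuous_on_eq_continuous_at isCont_def)

lemma field_off_line:
  assumes "side p \<noteq> 0"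
  shows "field p = (- snd p, fst p + damping p * snd p)"
  using assms by (auto simp: switched_field_def damped_field_def damping_def side_def case_prod_beta)

lemma side_tendsto: "(side \<longlongrightarrow> side p) (at p within S)"
  unfolding side_def by (intro tendsto_intros)

lemma damping_tendsto:
  assumes "norm p < 1" "side p \<noteq> 0"
  shows "(damping \<longlongrightarrow> damping p) (at p)"
proof (cases "side p > 0")
  case True
  have "\<forall>\<^sub>F q in at p. side q > 0" using order_tendstoD(1)[OF side_tendsto True] .
  then have ev: "\<forall>\<^sub>F q in at p. D\<^sub>1 (fst q) (snd q) = damping q"
    by eventually_elim (simp add: damping_def)
  have "((\<lambda>q. D\<^sub>1 (fst q) (snd q)) \<longlongrightarrow> damping p) (at p)"
    using D_tendsto(1)[OF assms(1)] True by (simp add: damping_def)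
  then show ?thesis using ev by (rule Lim_transform_eventually)
next
  case False
  then have neg: "side p < 0" using assms(2) by simp
  have "\<forall>\<^sub>F q in at p. side q < 0" using order_tendstoD(2)[OF side_tendsto neg] .
  then have ev: "\<forall>\<^sub>F q in at p. D\<^sub>2 (fst q) (snd q) = damping q"
    by eventually_elim (simp add: damping_def)
  have "((\<lambda>q. D\<^sub>2 (fst q) (snd q)) \<longlongrightarrow> damping p) (at p)"
    using D_tendsto(2)[OF assms(1)] neg by (simp add: damping_def)
  then show ?thesis using ev by (rule Lim_transform_eventually)
qed

lemma filippov_off_line:
  assumes "norm p < 1" "side p \<noteq> 0"
  shows "filippov_map field p = {field p}"
proof (rule filippov_map_eq)
  have "\<forall>\<^sub>F q in at p. side q \<noteq> 0"
    using tendsto_imp_eventually_ne[OF side_tendsto assms(2)] .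
  then have ev: "\<forall>\<^sub>F q in at p. (- snd q, fst q + damping q * snd q) = field q"
    by eventually_elim (rule field_off_line[symmetric])
  have "((\<lambda>q. (- snd q, fst q + damping q * snd q)) \<longlongrightarrow> field p) (at p)"
    unfolding field_off_line[OF assms(2)] by (intro tendsto_intros damping_tendsto assms)
  then have "(field \<longlongrightarrow> field p) (at p)"
    using ev by (rule Lim_transform_eventually)
  then show "(field \<longlongrightarrow> field p) (at p within - {})" by simp
qed simp

lemma line_negligible: "negligible {p. side p = 0}"
proof -
  have "{p. side p = 0} = {p. (- K, 1) \<bullet> p = 0}" by (auto simp: side_def inner_prod_def)
  then show ?thesis using negligible_hyperplane[of "(- K, 1) :: real \<times> real" 0] by (simp add: zero_prod_def)
qed

lemma damping_bound:
  assumes "norm p \<le> 1"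
  shows "\<bar>damping p\<bar> \<le> L * norm p"
  using D_bound[OF assms] by (simp add: damping_def)

lemma field_bound:
  assumes "norm p \<le> 1" "side p \<noteq> 0"
  shows "norm (field p) \<le> (2 + L) * norm p"
proof -
  note f = abs_fst_le_norm[of p] abs_snd_le_norm[of p]
  have "L * norm p \<le> L * 1" using assms(1) L_nonneg by (rule mult_left_mono)
  then have "\<bar>damping p\<bar> \<le> L" using damping_bound[OF assms(1)] by linarith
  then have "\<bar>damping p * snd p\<bar> \<le> L * norm p"
    unfolding abs_mult using f L_nonneg by (intro mult_mono) auto
  moreover have "norm (field p) \<le> \<bar>- snd p\<bar> + \<bar>fst p + damping p * snd p\<bar>"
    unfolding field_off_line[OF assms(2)] using norm_Pair_le[of "- snd p" "fst p + damping p * snd p"] by simp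
  ultimately show ?thesis using f by (simp add: algebra_simps)
qed

lemma filippov_bound:
  assumes "norm p < 1"
  shows "filippov_map field p \<subseteq> cball 0 (2 + L)"
proof (rule filippov_map_subset[OF _ line_negligible, of "1 - norm p"])
  fix q assume q: "q \<in> ball p (1 - norm p)" "q \<notin> {p. side p = 0}"
  then have "norm q \<le> 1" using norm_triangle_ineq2[of q p] by (simp add: dist_norm norm_minus_commute)
  then have "norm (field q) \<le> (2 + L) * norm q" "(2 + L) * norm q \<le> (2 + L) * 1"
    using field_bound[of q] q L_nonneg by (auto intro!: mult_left_mono)
  then show "field q \<in> cball 0 (2 + L)" by simp
qed (use assms in auto)

text \<open>The origin lies on the switching line, but both fields are of size at most
  \<open>(2 + L) * norm p\<close>, so they have the common limit zero there.\<close>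

lemma filippov_zero: "filippov_map field 0 = {0}"
proof (rule filippov_map_eq[OF _ line_negligible])
  have "\<forall>\<^sub>F q in at 0 within - {p. side p = 0}. q \<in> ball 0 1"
    by (rule eventually_mono[OF eventually_at_ball[of 1]]) auto
  then have "\<forall>\<^sub>F q in at 0 within - {p. side p = 0}. norm (field q) \<le> (2 + L) * norm q"
    unfolding eventually_at_filter by eventually_elim (auto intro: field_bound)
  moreover have "((\<lambda>q. (2 + L) * norm q) \<longlongrightarrow> 0) (at 0 within - {p. side p = 0})"
    by (rule tendsto_eq_intros refl | simp)+
  ultimately show "(field \<longlongrightarrow> 0) (at 0 within - {p. side p = 0})"
    by (rule Lim_null_comparison)
qed

text \<open>At \<open>p\<close> both fields satisfy \<open>x * side (f p) = x\<^sup>2 * (1 +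
  K\<^sup>2 + K * D) \<ge> x\<^sup>2 / 2\<close>, so both cross the line in the direction of the
  rotation. By continuity the bound \<open>x\<^sup>2 / 4\<close> persists near \<open>p\<close>.
  With \<open>x\<close> fixed it describes a closed half space of velocities, so it survives
  convexification and closure.\<close>

lemma filippov_transversal:
  assumes p: "norm p < rad" "side p = 0" "p \<noteq> 0" and v: "v \<in> filippov_map field p"
  shows "side v \<noteq> 0"
proof -
  define x where "x = fst p"
  have sp: "snd p = K * x" using p(2) by (simp add: side_def x_def)
  have x: "x \<noteq> 0" using p(3) sp by (cases p) (auto simp: x_def zero_prod_def)
  have n1: "norm p < 1" using p(1) rad_le_half by simp
  \<comment> \<open>This is \<open>x * side\<close> of the field with damping \<open>D\<close> at
    \<open>q\<close>; the factor \<open>x\<close> belongs to \<open>p\<close> and does not move with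
    \<open>q\<close>.\<close>
  define h where "h = (\<lambda>D q. x * (fst q + (K + D (fst q) (snd q)) * snd q))"
  have hp: "x\<^sup>2 / 4 < h D p" if D: "(1 + \<bar>K\<bar>) * \<bar>D (fst p) (snd p)\<bar> \<le> 1 / 2" for D :: "real \<Rightarrow> real \<Rightarrow> real"
  proof -
    let ?D = "D (fst p) (snd p)"
    have "\<bar>K * ?D\<bar> \<le> (1 + \<bar>K\<bar>) * \<bar>?D\<bar>" unfolding abs_mult by (intro mult_right_mono) auto
    then have "- (1 / 2) \<le> K * ?D" using D by linarith
    then have "1 / 2 \<le> 1 + K\<^sup>2 + K * ?D" using zero_le_power2[of K] by linarith
    then have "x\<^sup>2 * (1 / 2) \<le> x\<^sup>2 * (1 + K\<^sup>2 + K * ?D)" by (intro mult_left_mono) auto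
    also have "\<dots> = h D p" unfolding h_def sp by (simp add: x_def[symmetric] power2_eq_square algebra_simps)
    finally show ?thesis using x zero_less_power2[of x] by linarith
  qed
  have ht: "(h D \<longlongrightarrow> h D p) (at p)" if "((\<lambda>q. D (fst q) (snd q)) \<longlongrightarrow> D (fst p) (snd p)) (at p)"
    for D :: "real \<Rightarrow> real \<Rightarrow> real"
    unfolding h_def using that by (intro tendsto_intros)
  have "\<forall>\<^sub>F q in at p. x\<^sup>2 / 4 < h D\<^sub>1 q"
    using order_tendstoD(1)[OF ht[OF D_tendsto(1)[OF n1]] hp[of D\<^sub>1]] D_bound_rad(1)[of p] p(1) by simp
  moreover have "\<forall>\<^sub>F q in at p. x\<^sup>2 / 4 < h D\<^sub>2 q"
    using order_tendstoD(1)[OF ht[OF D_tendsto(2)[OF n1]] hp[of D\<^sub>2]] D_bound_rad(2)[of p] p(1) by simp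
  ultimately have "\<forall>\<^sub>F q in at p. x\<^sup>2 / 4 < h D\<^sub>1 q \<and> x\<^sup>2 / 4 < h D\<^sub>2 q" by (rule eventually_conj)
  then obtain d where d: "d > 0"
    and dd: "\<And>q. q \<noteq> p \<Longrightarrow> dist q p < d \<Longrightarrow> x\<^sup>2 / 4 < h D\<^sub>1 q \<and> x\<^sup>2 / 4 < h D\<^sub>2 q"
    unfolding eventually_at by auto
  have C: "{v. x\<^sup>2 / 4 \<le> x * side v} = {v. (- (x * K), x) \<bullet> v \<ge> x\<^sup>2 / 4}"
    by (auto simp: side_def inner_prod_def algebra_simps)
  have "filippov_map field p \<subseteq> {v. x\<^sup>2 / 4 \<le> x * side v}"
  proof (rule filippov_map_subset[OF d line_negligible])
    show "closed {v. x\<^sup>2 / 4 \<le> x * side v}" "convex {v. x\<^sup>2 / 4 \<le> x * side v}"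
      unfolding C by (rule closed_halfspace_ge, rule convex_halfspace_ge)
    fix q assume q: "q \<in> ball p d" "q \<notin> {p. side p = 0}"
    then have "q \<noteq> p" using p(2) by auto
    then have "x\<^sup>2 / 4 < h D\<^sub>1 q \<and> x\<^sup>2 / 4 < h D\<^sub>2 q" using dd q(1) by (simp add: dist_commute)
    moreover have "x * side (field q) = (if side q > 0 then h D\<^sub>1 q else h D\<^sub>2 q)"
      using q(2) field_off_line[of q] by (simp add: h_def side_def[of "(_, _)"] damping_def algebra_simps)
    ultimately show "field q \<in> {v. x\<^sup>2 / 4 \<le> x * side v}" by simp
  qed
  then have "x\<^sup>2 / 4 \<le> x * side v" using v by blast
  then show ?thesis using x by auto
qed

end

subsection \<open>Existence of solutions\<close>

lemma lipschitz_on_indefinite_integral: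
  fixes f :: "real \<Rightarrow> real"
  assumes f: "\<And>t. f integrable_on {0..t}" and B: "\<And>s. s \<ge> 0 \<Longrightarrow> \<bar>f s\<bar> \<le> B"
  shows "B-lipschitz_on {0..} (\<lambda>t. integral {0..t} f)"
proof (rule lipschitz_on_leI)
  show B0: "B \<ge> 0" using B[of 0] by simp
  fix a b :: real assume ab: "a \<in> {0..}" "b \<in> {0..}" "a \<le> b"
  have i: "f integrable_on {a..b}" using f[of b] by (rule integrable_on_subinterval) (use ab in auto)
  have "integral {0..a} f + integral {a..b} f = integral {0..b} f"
    using ab f[of b] by (intro Henstock_Kurzweil_Integration.integral_combine) auto
  moreover have "norm (integral {a..b} f) \<le> B * measure lborel {a..b}"
    using B0 integrable_integral[OF i] B ab by (intro has_integral_bound_real) auto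
  ultimately show "dist (integral {0..a} f) (integral {0..b} f) \<le> B * dist a b"
    using ab by (simp add: dist_real_def)
qed

text \<open>Picard iteration under Caratheodory conditions: \<open>G\<close> is Lipschitz in the
  unknown but merely integrable in time along continuous functions. The weight
  \<open>exp (l * t)\<close> turns the integral operator into a contraction on the whole half line
  at once. The fixed point is sought for the bounded function \<open>h\<close>, from which the
  unknown is recovered as \<open>u\<^sub>0 + exp (l * t) * h t\<close>.\<close>

lemma volterra_solution:
  fixes G :: "real \<Rightarrow> real \<Rightarrow> real"
  assumes bound: "\<And>s u. s \<ge> 0 \<Longrightarrow> \<bar>G s u\<bar> \<le> B"
    and lip: "\<And>s u v. s \<ge> 0 \<Longrightarrow> \<bar>G s u - G s v\<bar> \<le> C * \<bar>u - v\<bar>"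
    and int: "\<And>u t. continuous_on UNIV u \<Longrightarrow> (\<lambda>s. G s (u s)) integrable_on {0..t}"
  obtains u where "continuous_on UNIV u" "\<And>t. t \<ge> 0 \<Longrightarrow> u t = u\<^sub>0 + integral {0..t} (\<lambda>s. G s (u s))"
proof -
  have C0: "C \<ge> 0" using lip[of 0 1 0] by simp
  have B0: "B \<ge> 0" using bound[of 0 0] by simp
  \<comment> \<open>The contraction constant will be \<open>C / l\<close>, so any
    \<open>l > C\<close> would do.\<close>
  define l where "l = C + 1"
  have l: "l > 0" using C0 by (simp add: l_def)
  \<comment> \<open>Functions of type \<open>bcontfun\<close> live on all of the reals; cutting time
    off at zero extends the problem to negative times.\<close>
  define m :: "real \<Rightarrow> real" where "m = (\<lambda>t. max t 0)"
  have m: "m t \<ge> 0" for t by (simp add: m_def)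
  define E :: "(real \<Rightarrow>\<^sub>C real) \<Rightarrow> real \<Rightarrow> real" where "E = (\<lambda>h s. u\<^sub>0 + exp (l * m s) * h s)"
  have cont_m: "continuous_on UNIV m" unfolding m_def by (intro continuous_intros)
  have cont_E: "continuous_on UNIV (E h)" for h
    unfolding E_def by (intro continuous_intros continuous_on_compose2[OF _ cont_m]) auto
  define P where "P = (\<lambda>h t. exp (- (l * m t)) * integral {0..m t} (\<lambda>s. G s (E h s)))"
  have lipI: "B-lipschitz_on {0..} (\<lambda>t. integral {0..t} (\<lambda>s. G s (E h s)))" for h
    using int[OF cont_E] bound by (rule lipschitz_on_indefinite_integral)
  have P: "P h \<in> bcontfun" for h
  proof (rule bcontfun_normI)
    have "continuous_on UNIV (\<lambda>t. integral {0..m t} (\<lambda>s. G s (E h s)))"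
      by (rule continuous_on_compose2[OF lipschitz_on_continuous_on[OF lipI] cont_m]) (use m in auto)
    then show "continuous_on UNIV (P h)"
      unfolding P_def by (intro continuous_intros cont_m)
    fix t
    have "\<bar>integral {0..m t} (\<lambda>s. G s (E h s))\<bar> \<le> B * m t"
      using lipschitz_onD[OF lipI[of h], of "m t" 0] m[of t] by (simp add: dist_real_def)
    also have "\<dots> \<le> B * (exp (l * m t) / l)"
    proof (rule mult_left_mono[OF _ B0])
      have "l * m t \<le> exp (l * m t)" using exp_ge_add_one_self[of "l * m t"] by linarith
      then show "m t \<le> exp (l * m t) / l" using l by (simp add: field_simps)
    qed
    finally have "\<bar>integral {0..m t} (\<lambda>s. G s (E h s))\<bar> \<le> B / l * exp (l * m t)" by simp
    then have "exp (- (l * m t)) * \<bar>integral {0..m t} (\<lambda>s. G s (E h s))\<bar> \<le> exp (- (l * m t)) * (B / l * exp (l * m t))"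
      by (rule mult_left_mono) simp
    also have "\<dots> = B / l" by (simp add: exp_minus)
    finally show "norm (P h t) \<le> B / l" by (simp add: P_def abs_mult)
  qed
  have Pd: "dist (P h t) (P k t) \<le> C / l * dist h k" for h k t
  proof -
    let ?f = "\<lambda>s. G s (E h s) - G s (E k s)"
    have "((\<lambda>s. C * dist h k * exp (l * s)) has_integral
        (C * dist h k / l * exp (l * m t) - C * dist h k / l * exp (l * 0))) {0..m t}"
      by (rule fundamental_theorem_of_calculus[OF m])
         (use l in \<open>auto intro!: derivative_eq_intros simp: has_real_derivative_iff_has_vector_derivative[symmetric]\<close>)
    note g = this
    have "norm (integral {0..m t} ?f) \<le> integral {0..m t} (\<lambda>s. C * dist h k * exp (l * s))"
    proof (rule integral_norm_bound_integral)
      show "?f integrable_on {0..m t}" using int[OF cont_E[of h]] int[OF cont_E[of k]] by (rule integrable_diff)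
      show "(\<lambda>s. C * dist h k * exp (l * s)) integrable_on {0..m t}" using g by (rule has_integral_integrable)
      fix s assume s: "s \<in> {0..m t}"
      have "E h s - E k s = exp (l * s) * (h s - k s)"
        using s by (simp add: E_def m_def algebra_simps)
      then have "\<bar>E h s - E k s\<bar> \<le> exp (l * s) * dist h k"
        using dist_bounded[of h s k] by (simp add: abs_mult dist_real_def)
      then have "C * \<bar>E h s - E k s\<bar> \<le> C * (exp (l * s) * dist h k)" using C0 by (rule mult_left_mono)
      moreover have "\<bar>?f s\<bar> \<le> C * \<bar>E h s - E k s\<bar>" using lip s by simp
      ultimately show "norm (?f s) \<le> C * dist h k * exp (l * s)" by (simp add: mult_ac)
    qed
    also have "\<dots> = C * dist h k / l * exp (l * m t) - C * dist h k / l" using integral_unique[OF g] by simp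
    also have "\<dots> \<le> C * dist h k / l * exp (l * m t)" using C0 l by simp
    finally have "\<bar>integral {0..m t} ?f\<bar> \<le> C * dist h k / l * exp (l * m t)" by simp
    then have "exp (- (l * m t)) * \<bar>integral {0..m t} ?f\<bar> \<le> exp (- (l * m t)) * (C * dist h k / l * exp (l * m t))"
      by (rule mult_left_mono) simp
    also have "\<dots> = C / l * dist h k" by (simp add: exp_minus)
    also have "exp (- (l * m t)) * \<bar>integral {0..m t} ?f\<bar> = dist (P h t) (P k t)"
      using integral_diff[OF int[OF cont_E[of h]] int[OF cont_E[of k]], of "m t"]
      by (simp add: P_def dist_real_def abs_mult flip: right_diff_distrib)
    finally show ?thesis .
  qed
  have "\<exists>!h. Bcontfun (P h) = h"
  proof (rule banach_fix_type[of "C / l"])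
    show "0 \<le> C / l" "C / l < 1" using C0 l by (simp_all add: l_def)
    show "\<forall>h k. dist (Bcontfun (P h)) (Bcontfun (P k)) \<le> C / l * dist h k"
      using Pd by (auto intro!: dist_bound simp: Bcontfun_inverse[OF P])
  qed
  then obtain h where h: "Bcontfun (P h) = h" by blast
  have hP: "h t = P h t" for t using Bcontfun_inverse[OF P[of h]] h by metis
  have "E h t = u\<^sub>0 + integral {0..t} (\<lambda>s. G s (E h s))" if "t \<ge> 0" for t
    using that unfolding E_def hP[of t] by (simp add: P_def m_def exp_minus E_def)
  then show ?thesis using that cont_E by blast
qed

lemma lipschitz_on_mult_bounded:
  fixes f g :: "'a::metric_space \<Rightarrow> real"
  assumes f: "A-lipschitz_on S f" "\<And>x. x \<in> S \<Longrightarrow> \<bar>f x\<bar> \<le> F"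
    and g: "B-lipschitz_on S g" "\<And>x. x \<in> S \<Longrightarrow> \<bar>g x\<bar> \<le> G" and "0 \<le> F" "0 \<le> G"
  shows "(A * G + F * B)-lipschitz_on S (\<lambda>x. f x * g x)"
proof (rule lipschitz_onI)
  have A: "0 \<le> A" and B: "0 \<le> B" using f(1) g(1) by (auto dest: lipschitz_on_nonneg)
  then show "0 \<le> A * G + F * B" using assms by simp
  fix x y assume xy: "x \<in> S" "y \<in> S"
  have "f x * g x - f y * g y = (f x - f y) * g x + f y * (g x - g y)" by (simp add: algebra_simps)
  then have "dist (f x * g x) (f y * g y) \<le> dist (f x) (f y) * \<bar>g x\<bar> + \<bar>f y\<bar> * dist (g x) (g y)"
    unfolding dist_real_def abs_mult[symmetric] by (metis abs_triangle_ineq)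
  also have "\<dots> \<le> (A * dist x y) * G + F * (B * dist x y)"
    using lipschitz_onD[OF f(1) xy] lipschitz_onD[OF g(1) xy] f(2)[OF xy(2)] g(2)[OF xy(1)] assms A B
    by (intro add_mono mult_mono) auto
  finally show "dist (f x * g x) (f y * g y) \<le> (A * G + F * B) * dist x y" by (simp add: algebra_simps)
qed

lemma lipschitz_on_real_derivative:
  fixes f :: "real \<Rightarrow> real"
  assumes "convex S" and "\<And>x. x \<in> S \<Longrightarrow> (f has_real_derivative f' x) (at x within S)"
    and "\<And>x. x \<in> S \<Longrightarrow> \<bar>f' x\<bar> \<le> B" and "0 \<le> B"
  shows "B-lipschitz_on S f"
  using field_differentiable_bound[OF assms(1,2), of B] assms(3,4)
  by (intro lipschitz_onI) (auto simp: dist_norm)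

lemma integrable_on_bounded_borel:
  fixes f :: "real \<Rightarrow> real"
  assumes "f \<in> borel_measurable borel" and "\<And>s. s \<in> {a..b} \<Longrightarrow> \<bar>f s\<bar> \<le> B"
  shows "f integrable_on {a..b}"
proof (rule measurable_bounded_by_integrable_imp_integrable)
  show "f \<in> borel_measurable (lebesgue_on {a..b})"
    using assms(1) by (intro measurable_restrict_space1 measurable_completion) simp
  show "(\<lambda>_. B) integrable_on {a..b}" by (rule integrable_const_ivl)
qed (use assms(2) in auto)

context switched_oscillator
begin

text \<open>In polar coordinates the orbits solve \<open>d (ln r) / d\<theta> = G(\<theta>, ln r)\<close>, in which the discontinuity
  affects the independent variable only: \<open>G\<close> is Lipschitz in \<open>ln r\<close>. Truncating the radius at
  \<open>rad\<close> makes the solution global; time is recovered as \<open>T = \<integral> d\<theta> / \<theta>'\<close>.\<close>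

lemma polar_curve:
  assumes "p \<noteq> 0" "norm p < rad"
  obtains w S where "w 0 = p" "countable S" "\<And>T. \<exists>M. M-lipschitz_on {0..T} w"
    "\<And>t. t \<ge> 0 \<Longrightarrow> t \<notin> S \<Longrightarrow> norm (w t) < rad \<Longrightarrow>
       side (w t) \<noteq> 0 \<and> (w has_vector_derivative field (w t)) (at t)"
proof -
  have np: "norm p > 0" using assms(1) by simp
  have "(fst p / norm p)\<^sup>2 + (snd p / norm p)\<^sup>2 = 1"
  proof -
    have *: "(fst p)\<^sup>2 + (snd p)\<^sup>2 = (norm p)\<^sup>2" by (cases p) (simp add: norm_Pair)
    show ?thesis unfolding power_divide add_divide_distrib[symmetric] * using np by simp
  qed
  then obtain \<theta> where "fst p / norm p = cos \<theta>" "snd p / norm p = sin \<theta>"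
    using sincos_total_2pi by metis
  then have p: "p = (norm p * cos \<theta>, norm p * sin \<theta>)"
    using np by (cases p) (auto simp: field_simps)
  define cs where "cs = (\<lambda>s. cos (\<theta> + s))"
  define sn where "sn = (\<lambda>s. sin (\<theta> + s))"
  define R where "R = (\<lambda>u. exp (min u (ln rad)))"
  define q where "q = (\<lambda>s u. (R u * cs s, R u * sn s))"
  define D where "D = (\<lambda>s u. damping (q s u))"
  \<comment> \<open>In polar coordinates the field reads \<open>r' = r * sin\<^sup>2 * D\<close> and
    \<open>\<theta>' = 1 + cos * sin * D\<close>. Thus \<open>den\<close> is the angular velocity
    and \<open>G\<close> is the derivative of \<open>ln r\<close> with respect to the angle.\<close>
  define den where "den = (\<lambda>s u. 1 + cs s * sn s * D s u)"
  define G where "G = (\<lambda>s u. (sn s)\<^sup>2 * D s u / den s u)"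
  have R: "0 < R u" "R u \<le> rad" for u
    using rad_pos by (simp_all add: R_def min_def) (metis exp_le_cancel_iff exp_ln less_eq_real_def linear)
  have cs_sn: "\<bar>cs s\<bar> \<le> 1" "\<bar>sn s\<bar> \<le> 1" "(cs s)\<^sup>2 + (sn s)\<^sup>2 = 1" "\<bar>cs s * sn s\<bar> \<le> 1" for s
    unfolding cs_def sn_def abs_mult by (auto intro: mult_le_one)
  have norm_q: "norm (q s u) = R u" for s u
    using R(1)[of u] cs_sn(3)[of s]
    by (simp add: q_def norm_Pair power_mult_distrib real_norm_def flip: distrib_left)
  have qr: "norm (q s u) \<le> rad" for s u using norm_q R(2) by simp
  have D: "\<bar>D s u\<bar> \<le> 1 / 2" for s u
  proof -
    have "\<bar>D s u\<bar> \<le> (1 + \<bar>K\<bar>) * \<bar>D s u\<bar>" by (simp add: algebra_simps)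
    also have "\<dots> \<le> 1 / 2" using D_bound_rad[OF qr] by (simp add: D_def damping_def)
    finally show ?thesis .
  qed
  have csD: "\<bar>cs s * sn s * D s u\<bar> \<le> 1 / 2" for s u
    using mult_mono[OF cs_sn(4)[of s] D[of s u]] by (simp add: abs_mult)
  have den: "1 / 2 \<le> den s u" "den s u \<le> 2" for s u
    using csD[of s u] unfolding den_def abs_le_iff by linarith+
  have sn2: "(sn s)\<^sup>2 \<le> 1" for s using cs_sn(3)[of s] zero_le_power2[of "cs s"] by linarith
  have G_bound: "\<bar>G s u\<bar> \<le> 1" for s u
  proof -
    have "(sn s)\<^sup>2 * \<bar>D s u\<bar> \<le> 1 * (1 / 2)" using sn2 D by (intro mult_mono) auto
    then have "(sn s)\<^sup>2 * \<bar>D s u\<bar> \<le> den s u" using den(1)[of s u] by linarith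
    then show ?thesis using den(1)[of s u] by (simp add: G_def abs_mult field_simps)
  qed
  have R_lip: "\<bar>R u - R v\<bar> \<le> \<bar>u - v\<bar>" for u v
  proof -
    have "1-lipschitz_on {..ln rad} (exp :: real \<Rightarrow> real)"
    proof (rule lipschitz_on_real_derivative)
      fix x assume "x \<in> {..ln rad}"
      then have "exp x \<le> rad" using rad_pos by (metis atMost_iff exp_le_cancel_iff exp_ln)
      then have "exp x \<le> 1" using rad_le_half by linarith
      then show "\<bar>exp x\<bar> \<le> 1" by simp
    qed (auto intro!: derivative_eq_intros)
    then have "\<bar>R u - R v\<bar> \<le> \<bar>min u (ln rad) - min v (ln rad)\<bar>"
      using lipschitz_onD[of 1 "{..ln rad}" exp "min u (ln rad)" "min v (ln rad)"] by (simp add: R_def dist_real_def)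
    also have "\<dots> \<le> \<bar>u - v\<bar>" by (auto simp: min_def)
    finally show ?thesis .
  qed
  have side_q: "side (q s u) = R u * (sn s - K * cs s)" for s u
    by (simp add: side_def q_def algebra_simps)
  have D_lip: "\<bar>D s u - D s v\<bar> \<le> L * \<bar>u - v\<bar>" for s u v
  proof -
    have cb: "q s u \<in> cball 0 1" "q s v \<in> cball 0 1"
      using qr[of s u] qr[of s v] rad_le_half by (auto simp: dist_norm)
    \<comment> \<open>The line passes through the origin, so at a fixed angle both radii lie on the
      same side of it and the same smooth damping applies. This is what makes \<open>G\<close>
      Lipschitz in its second argument.\<close>
    have "side (q s u) > 0 \<longleftrightarrow> side (q s v) > 0"
      using R(1)[of u] R(1)[of v] by (simp add: side_q zero_less_mult_iff)
    then have "\<bar>D s u - D s v\<bar> \<le> L * dist (q s u) (q s v)"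
      using lipschitz_onD[OF D_lipschitz(1) cb] lipschitz_onD[OF D_lipschitz(2) cb]
      by (simp add: D_def damping_def dist_real_def case_prod_beta)
    also have "dist (q s u) (q s v) = norm ((R u - R v) *\<^sub>R (cs s, sn s))"
      by (simp add: dist_norm q_def algebra_simps)
    also have "\<dots> = \<bar>R u - R v\<bar> * norm (cs s, sn s)" by (rule norm_scaleR)
    also have "norm (cs s, sn s) = 1" using cs_sn(3)[of s] by (simp add: norm_Pair)
    finally show ?thesis using mult_left_mono[OF R_lip[of u v] L_nonneg] by simp
  qed
  have G_lip: "\<bar>G s u - G s v\<bar> \<le> 4 * L * \<bar>u - v\<bar>" for s u v
  proof -
    have pos: "den s u > 0" "den s v > 0" using den(1)[of s u] den(1)[of s v] by linarith+
    \<comment> \<open>Over the common denominator the terms containing \<open>D s u * D s v\<close>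
      cancel.\<close>
    have "G s u - G s v = (sn s)\<^sup>2 * (D s u - D s v) / (den s u * den s v)"
      using pos by (simp add: G_def den_def field_simps)
    then have "\<bar>G s u - G s v\<bar> = (sn s)\<^sup>2 * \<bar>D s u - D s v\<bar> / (den s u * den s v)"
      using pos by (simp add: abs_mult)
    also have "\<dots> \<le> 1 * (L * \<bar>u - v\<bar>) / (1 / 2 * (1 / 2))"
    proof (rule frac_le)
      show "(sn s)\<^sup>2 * \<bar>D s u - D s v\<bar> \<le> 1 * (L * \<bar>u - v\<bar>)" using sn2 D_lip by (intro mult_mono) auto
      show "1 / 2 * (1 / 2) \<le> den s u * den s v" using den(1) pos by (intro mult_mono) auto
    qed (use L_nonneg in auto)
    finally show ?thesis by simp
  qed
  have cont_trig: "continuous_on UNIV cs" "continuous_on UNIV sn"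
    unfolding cs_def sn_def by (intro continuous_intros)+
  have cont_q: "continuous_on UNIV (\<lambda>s. q s (u s))" if u: "continuous_on UNIV u" for u
    unfolding q_def R_def by (intro continuous_intros u cont_trig)
  have D_borel: "(\<lambda>s. D s (u s)) \<in> borel_measurable borel" if u: "continuous_on UNIV u" for u
  proof -
    have "norm (q s (u s)) < 1" for s using qr[of s "u s"] rad_le_half by linarith
    then have qb: "range (\<lambda>s. q s (u s)) \<subseteq> ball 0 1" by auto
    have "continuous_on UNIV (\<lambda>s. D\<^sub>1 (fst (q s (u s))) (snd (q s (u s))))"
      "continuous_on UNIV (\<lambda>s. D\<^sub>2 (fst (q s (u s))) (snd (q s (u s))))"
      using D_continuous_on[THEN continuous_on_compose2, OF cont_q[OF u] qb] by simp_all
    moreover have "continuous_on UNIV (\<lambda>s. side (q s (u s)))"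
      unfolding side_def by (intro continuous_intros cont_q u)
    ultimately have [measurable]: "(\<lambda>s. D\<^sub>1 (fst (q s (u s))) (snd (q s (u s)))) \<in> borel_measurable borel"
      "(\<lambda>s. D\<^sub>2 (fst (q s (u s))) (snd (q s (u s)))) \<in> borel_measurable borel"
      "(\<lambda>s. side (q s (u s))) \<in> borel_measurable borel"
      by (auto intro: borel_measurable_continuous_onI)
    show ?thesis unfolding D_def damping_def by measurable
  qed
  have [measurable]: "cs \<in> borel_measurable borel" "sn \<in> borel_measurable borel"
    using cont_trig by (auto intro: borel_measurable_continuous_onI)
  have G_int: "(\<lambda>s. G s (u s)) integrable_on {0..t}" if u: "continuous_on UNIV u" for u t
  proof (rule integrable_on_bounded_borel)
    note [measurable] = D_borel[OF u]
    show "(\<lambda>s. G s (u s)) \<in> borel_measurable borel" unfolding G_def den_def by measurable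
  qed (rule G_bound)
  obtain u where cont_u: "continuous_on UNIV u"
    and u: "\<And>t. t \<ge> 0 \<Longrightarrow> u t = ln (norm p) + integral {0..t} (\<lambda>s. G s (u s))"
    using volterra_solution[of G 1 "4 * L" "ln (norm p)"] G_bound G_lip G_int by metis
  have u0: "u 0 = ln (norm p)" using u[of 0] by simp
  define i where "i = (\<lambda>s. 1 / den s (u s))"
  have i: "1 / 2 \<le> i s" "i s \<le> 2" for s
    using den[of s "u s"] by (simp_all add: i_def field_simps)
  have i_abs: "\<bar>i s\<bar> \<le> 2" for s using i(1)[of s] i(2)[of s] by linarith
  have i_int: "i integrable_on {0..t}" for t
  proof (rule integrable_on_bounded_borel)
    note [measurable] = D_borel[OF cont_u]
    show "i \<in> borel_measurable borel" unfolding i_def den_def by measurable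
  qed (rule i_abs)
  define T where "T = (\<lambda>t. integral {0..t} i)"
  have T_lip: "2-lipschitz_on {0..} T"
    unfolding T_def using i_int i_abs by (rule lipschitz_on_indefinite_integral)
  have T_0: "T 0 = 0" by (simp add: T_def)
  have T_growth: "(b - a) / 2 \<le> T b - T a" if "0 \<le> a" "a \<le> b" for a b
  proof -
    have ab: "i integrable_on {a..b}" using i_int[of b] by (rule integrable_on_subinterval) (use that in auto)
    have "T b - T a = integral {a..b} i"
      unfolding T_def using that i_int[of b] Henstock_Kurzweil_Integration.integral_combine[of 0 a b i] by simp
    moreover have "integral {a..b} (\<lambda>_. 1 / 2) \<le> integral {a..b} i"
      using ab i(1) by (intro integral_le) auto
    ultimately show ?thesis using that by simp
  qed
  have "\<exists>s\<ge>0. T s = t" if t: "t \<ge> 0" for t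
  proof -
    have "\<exists>s\<ge>0. s \<le> 2 * t \<and> T s = t"
    proof (rule IVT')
      show "T 0 \<le> t" "t \<le> T (2 * t)" "0 \<le> 2 * t" using t T_0 T_growth[of 0 "2 * t"] by simp_all
      show "continuous_on {0..2 * t} T"
        using lipschitz_on_continuous_on[OF T_lip] by (rule continuous_on_subset) auto
    qed
    then show ?thesis by blast
  qed
  \<comment> \<open>By \<open>T_growth\<close> the time \<open>T\<close> increases with slope at
    least \<open>1 / 2\<close>, so the chosen preimages form the inverse function, which expresses
    the angle by time.\<close>
  then obtain \<Theta> where \<Theta>: "\<And>t. t \<ge> 0 \<Longrightarrow> \<Theta> t \<ge> 0" "\<And>t. t \<ge> 0 \<Longrightarrow> T (\<Theta> t) = t" by metis
  have \<Theta>_lip: "2-lipschitz_on {0..} \<Theta>"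
  proof (rule lipschitz_onI)
    fix s t :: real assume st: "s \<in> {0..}" "t \<in> {0..}"
    then show "dist (\<Theta> s) (\<Theta> t) \<le> 2 * dist s t"
      using T_growth[of "\<Theta> s" "\<Theta> t"] T_growth[of "\<Theta> t" "\<Theta> s"] \<Theta>[of s] \<Theta>[of t]
      by (cases "\<Theta> s \<le> \<Theta> t") (auto simp: dist_real_def)
  qed simp
  have \<Theta>_0: "\<Theta> 0 = 0" using T_growth[of 0 "\<Theta> 0"] \<Theta>[of 0] T_0 by simp
  define w where "w = (\<lambda>t. (exp (u (\<Theta> t)) * cs (\<Theta> t), exp (u (\<Theta> t)) * sn (\<Theta> t)))"
  \<comment> \<open>The times at which the ray of the current angle lies in the switching line,
    together with the initial time, at which only a one-sided derivative could be computed.\<close>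
  define S where "S = insert 0 (T ` {s. sn s - K * cs s = 0})"
  show thesis
  proof (rule that)
    show "w 0 = p"
      using np by (subst p) (simp add: w_def \<Theta>_0 u0 cs_def sn_def)
    have trig_deriv: "(cs has_real_derivative - sn s) (at s within X)" "(sn has_real_derivative cs s) (at s within X)" for s X
      unfolding cs_def sn_def by (auto intro!: derivative_eq_intros)
    show "countable S"
    proof -
      have "{s. sn s - K * cs s = 0} \<subseteq> {s\<in>UNIV. sn s - K * cs s = 0 \<and>
          (\<exists>v. v \<noteq> 0 \<and> ((\<lambda>s. sn s - K * cs s) has_vector_derivative v) (at s within UNIV))}"
      proof clarsimp
        fix s assume s: "sn s = K * cs s"
        have "cs s \<noteq> 0" using s cs_sn(3)[of s] by auto
        moreover have "cs s + K * sn s = cs s * (1 + K\<^sup>2)" using s by (simp add: power2_eq_square algebra_simps)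
        ultimately have "cs s + K * sn s \<noteq> 0" by (simp add: add_nonneg_eq_0_iff)
        moreover have "((\<lambda>s. sn s - K * cs s) has_vector_derivative (cs s + K * sn s)) (at s)"
          unfolding has_real_derivative_iff_has_vector_derivative[symmetric]
          by (auto intro!: derivative_eq_intros trig_deriv)
        ultimately show "\<exists>v. v \<noteq> 0 \<and> ((\<lambda>s. sn s - K * cs s) has_vector_derivative v) (at s)" by blast
      qed
      then have "countable {s. sn s - K * cs s = 0}"
        using countable_transversal_zeros by (rule countable_subset)
      then show ?thesis unfolding S_def by (intro countable_insert countable_image)
    qed
    show "\<exists>M. M-lipschitz_on {0..t} w" for t
    proof -
      define b where "b = \<bar>ln (norm p)\<bar> + 2 * t"
      have "1-lipschitz_on {0..} (\<lambda>t. integral {0..t} (\<lambda>s. G s (u s)))"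
        using G_int[OF cont_u] G_bound by (rule lipschitz_on_indefinite_integral)
      then have u_lip: "1-lipschitz_on {0..} u"
        by (auto simp: lipschitz_on_def u dist_real_def)
      have u_le: "u s \<le> b" if "s \<in> {0..2 * t}" for s
        using lipschitz_onD[OF u_lip, of s 0] that u0 by (auto simp: b_def dist_real_def)
      have exp_lip: "(exp b)-lipschitz_on {..b} (exp :: real \<Rightarrow> real)"
        by (rule lipschitz_on_real_derivative) (auto intro!: derivative_eq_intros)
      have eu_lip: "(exp b * 1)-lipschitz_on {0..2 * t} (\<lambda>s. exp (u s))"
        by (rule lipschitz_on_compose2[OF lipschitz_on_subset[OF u_lip] lipschitz_on_subset[OF exp_lip]])
           (use u_le in auto)
      have trig_lip: "1-lipschitz_on {0..2 * t} cs" "1-lipschitz_on {0..2 * t} sn"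
        using cs_sn by (auto intro!: lipschitz_on_real_derivative trig_deriv simp: abs_le_iff)
      have eu_le: "\<bar>exp (u s)\<bar> \<le> exp b" if "s \<in> {0..2 * t}" for s using u_le[OF that] by simp
      have "(exp b * 1 * 1 + exp b * 1)-lipschitz_on {0..2 * t} (\<lambda>s. exp (u s) * cs s)"
        by (rule lipschitz_on_mult_bounded[OF eu_lip eu_le trig_lip(1)]) (use cs_sn in auto)
      moreover have "(exp b * 1 * 1 + exp b * 1)-lipschitz_on {0..2 * t} (\<lambda>s. exp (u s) * sn s)"
        by (rule lipschitz_on_mult_bounded[OF eu_lip eu_le trig_lip(2)]) (use cs_sn in auto)
      ultimately obtain M where M: "M-lipschitz_on {0..2 * t} (\<lambda>s. (exp (u s) * cs s, exp (u s) * sn s))"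
        by (metis lipschitz_on_Pair)
      have sub: "\<Theta> ` {0..t} \<subseteq> {0..2 * t}"
        using lipschitz_onD[OF \<Theta>_lip, of _ 0] \<Theta>(1) \<Theta>_0 by (fastforce simp: dist_real_def)
      have "(M * 2)-lipschitz_on {0..t} w"
        unfolding w_def
        by (rule lipschitz_on_compose2[OF lipschitz_on_subset[OF \<Theta>_lip] lipschitz_on_subset[OF M sub]]) auto
      then show ?thesis by blast
    qed
    fix t assume t: "t \<ge> 0" "t \<notin> S" "norm (w t) < rad"
    define s where "s = \<Theta> t"
    have t0: "t > 0" using t by (cases "t = 0") (auto simp: S_def)
    have s0: "s > 0" using \<Theta>[OF t(1)] t0 T_0 by (cases "s = 0") (auto simp: s_def)
    have Ts: "T s = t" using \<Theta>(2)[OF t(1)] by (simp add: s_def)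
    have e: "sn s - K * cs s \<noteq> 0" using t(2) Ts by (auto simp: S_def)
    have "norm (w t) = exp (u s)"
      using cs_sn(3)[of s] by (simp add: w_def s_def[symmetric] norm_Pair power_mult_distrib flip: distrib_left)
    then have "exp (u s) < rad" using t(3) by simp
    then have "u s < ln rad" using rad_pos by (metis exp_less_cancel_iff exp_ln)
    \<comment> \<open>Below \<open>rad\<close> the truncation is inactive, so the auxiliary equation
      is the true one.\<close>
    then have qw: "q s (u s) = w t" by (simp add: q_def R_def w_def s_def[symmetric])
    have side_w: "side (w t) \<noteq> 0" using e R(1)[of "u s"] by (simp add: side_q flip: qw)
    define d where "d = damping (w t)"
    have Dd: "D s (u s) = d" by (simp add: D_def d_def qw)
    have isCont_D: "isCont (\<lambda>s. D s (u s)) s"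
    proof -
      have "isCont damping (w t)"
        unfolding isCont_def using t(3) rad_le_half side_w by (intro damping_tendsto) auto
      moreover have "isCont (\<lambda>s. q s (u s)) s"
        using cont_q[OF cont_u] by (simp add: continuous_on_eq_continuous_at)
      ultimately show ?thesis
        using isCont_o2[of s "\<lambda>s. q s (u s)" damping] by (simp add: qw D_def)
    qed
    have isCont_trig: "isCont cs s" "isCont sn s"
      using cont_trig by (simp_all add: continuous_on_eq_continuous_at)
    have den_nz: "den s' (u s') \<noteq> 0" for s' using den(1)[of s' "u s'"] by linarith
    have integral_deriv: "((\<lambda>t. integral {0..t} f) has_real_derivative f s) (at s)"
      if f: "\<And>t. f integrable_on {0..t}" "isCont f s" for f :: "real \<Rightarrow> real"
    proof -
      have "((\<lambda>t. integral {0..t} f) has_vector_derivative f s) (at s within ({0..s + 1} - {}))"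
        by (rule integral_has_vector_derivative_continuous_at)
           (use f s0 in \<open>auto intro: continuous_at_imp_continuous_at_within\<close>)
      then have "((\<lambda>t. integral {0..t} f) has_vector_derivative f s) (at s within {0<..<s + 1})"
        by (rule has_vector_derivative_within_subset) auto
      moreover have "at s within {0<..<s + 1} = at s" using s0 by (intro at_within_open) auto
      ultimately show ?thesis by (simp add: has_real_derivative_iff_has_vector_derivative)
    qed
    have u_deriv: "(u has_real_derivative G s (u s)) (at s)"
    proof -
      have "isCont (\<lambda>s. G s (u s)) s"
        unfolding G_def den_def using den_nz by (intro continuous_intros isCont_D isCont_trig) (simp add: den_def)
      from integral_deriv[OF G_int[OF cont_u] this]
      have "((\<lambda>t. ln (norm p) + integral {0..t} (\<lambda>s. G s (u s))) has_real_derivative G s (u s)) (at s)"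
        by (auto intro!: derivative_eq_intros)
      moreover have "\<forall>\<^sub>F t in nhds s. ln (norm p) + integral {0..t} (\<lambda>s. G s (u s)) = u t"
      proof (rule eventually_mono)
        show "\<forall>\<^sub>F t in nhds s. t \<in> {0<..}" using s0 by (intro eventually_nhds_in_open) auto
      qed (simp add: u)
      ultimately show ?thesis
        using DERIV_cong_ev[OF refl _ refl, of "\<lambda>t. ln (norm p) + integral {0..t} (\<lambda>s. G s (u s))" u s] by simp
    qed
    have T_deriv: "(T has_real_derivative i s) (at s)"
      unfolding T_def
    proof (rule integral_deriv[OF i_int])
      show "isCont i s"
        unfolding i_def den_def using den_nz by (intro continuous_intros isCont_D isCont_trig) (simp add: den_def)
    qed
    have \<Theta>_deriv: "(\<Theta> has_real_derivative den s (u s)) (at t)"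
    proof -
      have "continuous_on {0<..} \<Theta>"
        using lipschitz_on_continuous_on[OF \<Theta>_lip] by (rule continuous_on_subset) auto
      then have "isCont \<Theta> t" using t0 by (simp add: continuous_on_eq_continuous_at)
      then have "(\<Theta> has_real_derivative inverse (i s)) (at t)"
        by (intro DERIV_inverse_function[where f = T and a = 0 and b = "t + 1"])
           (use T_deriv t0 i(1)[of s] \<Theta>(2) in \<open>auto simp: s_def\<close>)
      then show ?thesis by (simp add: i_def den_def Dd)
    qed
    show "side (w t) \<noteq> 0 \<and> (w has_vector_derivative field (w t)) (at t)"
    proof
      have G_den: "G s (u s) * den s (u s) = (sn s)\<^sup>2 * d"
        using den_nz[of s] by (simp add: G_def den_def Dd)
      have u\<Theta>: "((\<lambda>t. u (\<Theta> t)) has_real_derivative G s (u s) * den s (u s)) (at t)"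
        using DERIV_chain2[OF u_deriv[unfolded s_def] \<Theta>_deriv] by (simp add: s_def)
      have trig\<Theta>: "((\<lambda>t. cs (\<Theta> t)) has_real_derivative - sn s * den s (u s)) (at t)"
        "((\<lambda>t. sn (\<Theta> t)) has_real_derivative cs s * den s (u s)) (at t)"
        using DERIV_chain2[OF trig_deriv(1) \<Theta>_deriv] DERIV_chain2[OF trig_deriv(2) \<Theta>_deriv] by (simp_all add: s_def)
      have "((\<lambda>t. exp (u (\<Theta> t)) * cs (\<Theta> t)) has_real_derivative
          exp (u s) * (((sn s)\<^sup>2 * d) * cs s - sn s * den s (u s))) (at t)"
        by (auto intro!: derivative_eq_intros u\<Theta> trig\<Theta> simp: G_den s_def[symmetric] algebra_simps)
      also have "((sn s)\<^sup>2 * d) * cs s - sn s * den s (u s) = - sn s"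
        by (simp add: den_def Dd power2_eq_square algebra_simps)
      finally have x: "((\<lambda>t. exp (u (\<Theta> t)) * cs (\<Theta> t)) has_real_derivative - snd (w t)) (at t)"
        by (simp add: w_def s_def)
      have "((\<lambda>t. exp (u (\<Theta> t)) * sn (\<Theta> t)) has_real_derivative
          exp (u s) * (((sn s)\<^sup>2 * d) * sn s + cs s * den s (u s))) (at t)"
        by (auto intro!: derivative_eq_intros u\<Theta> trig\<Theta> simp: G_den s_def[symmetric] algebra_simps)
      also have "((sn s)\<^sup>2 * d) * sn s + cs s * den s (u s) = cs s + sn s * d * ((cs s)\<^sup>2 + (sn s)\<^sup>2)"
        by (simp add: den_def Dd power2_eq_square algebra_simps)
      finally have y: "((\<lambda>t. exp (u (\<Theta> t)) * sn (\<Theta> t)) has_real_derivative fst (w t) + d * snd (w t)) (at t)"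
        by (simp add: cs_sn(3) w_def s_def algebra_simps)
      show "(w has_vector_derivative field (w t)) (at t)"
        unfolding field_off_line[OF side_w] d_def[symmetric]
        using has_vector_derivative_Pair[OF x[unfolded has_real_derivative_iff_has_vector_derivative]
            y[unfolded has_real_derivative_iff_has_vector_derivative]]
        by (simp add: w_def)
    qed (rule side_w)
  qed
qed
end

subsection \<open>Stability and instability from a Lyapunov function\<close>

text \<open>The infimum of the superlevel set is the first passage time. Stopping there keeps a
  solution inside the region where the local estimates hold.\<close>

lemma continuous_first_level:
  fixes g :: "real \<Rightarrow> real"
  assumes g: "continuous_on {a..b} g" and "a \<le> b" "g a \<le> m" "m \<le> g b"
  obtains s where "s \<in> {a..b}" "g s = m" "\<And>u. u \<in> {a..s} \<Longrightarrow> g u \<le> m"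
proof -
  define S where "S = {u \<in> {a..b}. m \<le> g u}"
  have "closed S" unfolding S_def
    using g by (intro continuous_closed_preimage_constant continuous_on_closed_Collect_le) (auto intro: continuous_intros)
  have ne: "S \<noteq> {}" using assms by (auto simp: S_def)
  have bb: "bdd_below S" by (rule bdd_belowI[of _ a]) (auto simp: S_def)
  define s where "s = Inf S"
  have s: "s \<in> S" unfolding s_def using ne bb \<open>closed S\<close> by (rule closed_contains_Inf)
  have below: "g u < m" if "u \<in> {a..b}" "u < s" for u
    using cInf_lower[OF _ bb, of u] that by (force simp: S_def s_def)
  have "\<exists>x\<ge>a. x \<le> s \<and> g x = m"
    using s assms(3) by (intro IVT') (auto simp: S_def intro: continuous_on_subset[OF g])
  then obtain x where x: "a \<le> x" "x \<le> s" "g x = m" by blast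
  then have "x = s" using below[of x] s by (force simp: S_def)
  show thesis
  proof (rule that[of s])
    show "s \<in> {a..b}" "g s = m" using s x \<open>x = s\<close> by (auto simp: S_def)
    show "g u \<le> m" if "u \<in> {a..s}" for u
      using below[of u] that s x \<open>x = s\<close> by (cases "u = s") (auto simp: S_def)
  qed
qed

context switched_oscillator
begin

text \<open>The curve solves the truncated problem for all time, but the switched system only while
  its radius is below \<open>rad\<close>. An a priori bound on \<open>J\<close> therefore turns it
  into a genuine Filippov solution there.\<close>

lemma polar_curve_solution:
  assumes S: "countable S" and lip: "\<And>T. \<exists>M. M-lipschitz_on {0..T} w"
    and w: "\<And>t. t \<ge> 0 \<Longrightarrow> t \<notin> S \<Longrightarrow> norm (w t) < rad \<Longrightarrow>
       side (w t) \<noteq> 0 \<and> (w has_vector_derivative field (w t)) (at t)"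
    and J: "is_interval J" "0 \<in> J" "J \<subseteq> {0..}" "\<And>t. t \<in> J \<Longrightarrow> norm (w t) < rad"
  shows "inclusion_solution (filippov_map field) J w"
proof (rule inclusion_solution_lipschitzI[OF J(1-3)])
  show "\<exists>M. M-lipschitz_on {a..b} w" if "{a..b} \<subseteq> J" for a b
  proof -
    have "{a..b} \<subseteq> {0..b}" using that J(3) by (cases "a \<le> b") auto
    then show ?thesis using lip[of b] by (blast intro: lipschitz_on_subset)
  qed
  have "S \<in> null_sets lebesgue"
    using countable_imp_null_set_lborel[OF S] by (rule null_sets_completionI)
  then have "AE t in lebesgue. t \<notin> S" by (rule AE_not_in)
  then show "AE t in lebesgue. t \<in> J \<longrightarrow>
      (\<exists>v. (w has_vector_derivative v) (at t within J) \<and> v \<in> filippov_map field (w t))"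
  proof eventually_elim
    case (elim t)
    show ?case
    proof
      assume t: "t \<in> J"
      then have wt: "side (w t) \<noteq> 0" "(w has_vector_derivative field (w t)) (at t)" "norm (w t) < 1"
        using w[of t] elim J(3,4) rad_le_half by force+
      show "\<exists>v. (w has_vector_derivative v) (at t within J) \<and> v \<in> filippov_map field (w t)"
        using filippov_off_line[OF wt(3,1)] has_vector_derivative_at_within[OF wt(2)] by blast
    qed
  qed
qed

end

text \<open>The sign \<open>\<sigma>\<close> covers stability and instability at once: \<open>V\<close> decreases strictly along orbits
  for \<open>\<sigma> = -1\<close> and increases strictly for \<open>\<sigma> = 1\<close>.\<close>

locale switched_oscillator_lyapunov = switched_oscillator +
  fixes r c \<sigma> M :: real and V :: "real \<times> real \<Rightarrow> real"
  assumes r: "0 < r" "r \<le> rad" and c: "c > 0"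
    and V_lipschitz: "M-lipschitz_on (ball 0 r) V"
    and V_bounds: "\<And>p. norm p < r \<Longrightarrow> (norm p)\<^sup>2 / 4 \<le> V p" "\<And>p. norm p < r \<Longrightarrow> V p \<le> (norm p)\<^sup>2"
    and V_rate: "\<And>p. norm p < r \<Longrightarrow> side p \<noteq> 0 \<Longrightarrow>
        \<exists>V'. (V has_derivative V') (at p) \<and> c * norm p ^ 4 \<le> \<sigma> * V' (field p)"
begin

lemma r_less_1: "r < 1"
  using r(2) rad_le_half by simp

lemma V_zero: "V 0 = 0"
  using V_bounds[of 0] r by simp

text \<open>The rate condition covers only points off the switching line and so says nothing at the
  origin. The quadratic bounds supply differentiability there, so that solutions which reach the
  origin, rest there or leave it are covered by the same growth estimate.\<close>

lemma V_derivative_zero: "(V has_derivative (\<lambda>_. 0)) (at 0)"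
  unfolding has_derivative_at
proof (intro conjI bounded_linear_zero)
  have "((\<lambda>h. norm h) \<longlongrightarrow> 0) (at (0 :: real \<times> real))" by (rule tendsto_eq_intros refl | simp)+
  moreover have "\<forall>\<^sub>F h in at 0. norm (norm (V (0 + h) - V 0 - 0) / norm h) \<le> norm h"
  proof (rule eventually_mono[OF eventually_at_ball[OF r(1)]])
    fix h :: "real \<times> real" assume "h \<in> ball 0 r \<and> h \<in> UNIV"
    then have "\<bar>V h\<bar> \<le> norm h * norm h"
      using V_bounds[of h] zero_le_power2[of "norm h"] by (simp add: power2_eq_square abs_le_iff)
    then show "norm (norm (V (0 + h) - V 0 - 0) / norm h) \<le> norm h"
      by (cases "h = 0") (simp_all add: V_zero field_simps)
  qed
  ultimately show "(\<lambda>h. norm (V (0 + h) - V 0 - 0) / norm h) \<midarrow>0\<rightarrow> 0"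
    by (rule Lim_null_comparison[rotated])
qed

text \<open>The exceptional times are the transversal zeros of \<open>side\<close>. Away from the
  origin every time on the line that has a Filippov velocity is of this kind, by
  \<open>filippov_transversal\<close>. At the origin \<open>\<eta>\<close> must be zero, and the
  vanishing derivative of \<open>V\<close> suffices. Taking \<open>\<eta> = 0\<close> gives plain
  monotonicity, a positive \<open>\<eta>\<close> a definite rate.\<close>

lemma V_growth:
  assumes z: "inclusion_solution (filippov_map field) J z" and ab: "a \<le> b" "{a..b} \<subseteq> J"
    and zr: "\<And>t. t \<in> {a..b} \<Longrightarrow> norm (z t) < r"
    and \<eta>: "\<eta> \<ge> 0" "\<And>t. t \<in> {a..b} \<Longrightarrow> \<eta> \<le> norm (z t)"
  shows "c * \<eta> ^ 4 * (b - a) \<le> \<sigma> * V (z b) - \<sigma> * V (z a)"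
proof (rule inclusion_solution_growth[OF z ab])
  have "M-lipschitz_on (z ` {a..b}) V"
    using zr by (intro lipschitz_on_subset[OF V_lipschitz]) auto
  then show "(\<bar>\<sigma>\<bar> * M)-lipschitz_on (z ` {a..b}) (\<lambda>p. \<sigma> * V p)"
    by (rule lipschitz_on_cmult_real)
  let ?E = "{t\<in>{a..b}. side (z t) = 0 \<and> (\<exists>v. v \<noteq> 0 \<and> ((\<lambda>t. side (z t)) has_vector_derivative v) (at t within {a..b}))}"
  show "countable ?E" by (rule countable_transversal_zeros)
  fix t v assume t: "t \<in> {a..b}" "t \<notin> ?E"
    and v: "(z has_vector_derivative v) (at t within {a..b})" "v \<in> filippov_map field (z t)"
  have n1: "norm (z t) < 1" using zr[OF t(1)] r_less_1 by simp
  consider "z t = 0" | "z t \<noteq> 0" "side (z t) = 0" | "side (z t) \<noteq> 0" by blast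
  then show "\<exists>g'. ((\<lambda>p. \<sigma> * V p) has_derivative g') (at (z t)) \<and> c * \<eta> ^ 4 \<le> g' v"
  proof cases
    case 1
    then have "\<eta> = 0" using \<eta>(1) \<eta>(2)[OF t(1)] by simp
    moreover have "((\<lambda>p. \<sigma> * V p) has_derivative (\<lambda>_. 0)) (at 0)"
      using has_derivative_mult_right[OF V_derivative_zero, of \<sigma>] by simp
    ultimately show ?thesis using 1 by auto
  next
    case 2
    have "side v \<noteq> 0" using filippov_transversal[OF _ 2(2,1) v(2)] zr[OF t(1)] r(2) by simp
    moreover have "bounded_linear side"
      unfolding side_def by (intro bounded_linear_sub bounded_linear_const_mult bounded_linear_fst bounded_linear_snd)
    then have "((\<lambda>t. side (z t)) has_vector_derivative side v) (at t within {a..b})"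
      using v(1) by (rule bounded_linear.has_vector_derivative)
    ultimately show ?thesis using t 2(2) by blast
  next
    case 3
    obtain V' where V': "(V has_derivative V') (at (z t))" "c * norm (z t) ^ 4 \<le> \<sigma> * V' (field (z t))"
      using V_rate[OF zr[OF t(1)] 3] by blast
    have "v = field (z t)" using v(2) filippov_off_line[OF n1 3] by simp
    moreover have "c * \<eta> ^ 4 \<le> c * norm (z t) ^ 4"
      using c \<eta> t(1) by (intro mult_left_mono power_mono) auto
    ultimately have "c * \<eta> ^ 4 \<le> \<sigma> * V' v" using V'(2) by simp
    then show ?thesis using has_derivative_mult_right[OF V'(1), of \<sigma>] by blast
  qed
qed

end

section \<open>Asymptotic stability when \<open>V\<close> decreases\<close>

locale switched_oscillator_decay = switched_oscillator_lyapunov K D\<^sub>1 D\<^sub>2 L r c "-1" M V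
  for K D\<^sub>1 D\<^sub>2 L r c M V
begin

text \<open>While a solution stays in the ball of radius \<open>r\<close>, monotonicity of
  \<open>V\<close> between the bounds \<open>norm\<^sup>2 / 4\<close> and
  \<open>norm\<^sup>2\<close> lets the norm at most double. Starting below \<open>r / 4\<close> it
  stays below \<open>r / 2\<close>, so it can never get as far as \<open>r / 2\<close>, and the
  provisional assumption holds for all time.\<close>

lemma trapped:
  assumes z: "inclusion_solution (filippov_map field) J z" and z0: "norm (z 0) < r / 4" and t: "t \<in> J"
  shows "norm (z t) \<le> 2 * norm (z 0)"
proof -
  have J0: "0 \<in> J" "J \<subseteq> {0..}" using z by (auto simp: inclusion_solution_def)
  have t0: "0 \<le> t" using J0 t by auto
  have sub: "{0..t} \<subseteq> J" using inclusion_solution_interval[OF z J0(1) t] .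
  have est: "norm (z s) \<le> 2 * norm (z 0)" if s: "s \<in> {0..t}" and zr: "\<And>u. u \<in> {0..s} \<Longrightarrow> norm (z u) < r" for s
  proof -
    have "c * 0 ^ 4 * (s - 0) \<le> (- 1) * V (z s) - (- 1) * V (z 0)"
      by (rule V_growth[OF z]) (use s sub zr in auto)
    then have "V (z s) \<le> V (z 0)" by simp
    then have "(norm (z s))\<^sup>2 / 4 \<le> (norm (z 0))\<^sup>2"
      using V_bounds(1)[of "z s"] V_bounds(2)[of "z 0"] zr[of s] zr[of 0] s by auto
    then have "(norm (z s))\<^sup>2 \<le> (2 * norm (z 0))\<^sup>2" by (simp add: power_mult_distrib)
    then show ?thesis by (rule power2_le_imp_le) simp
  qed
  have cont: "continuous_on {0..t} (\<lambda>s. norm (z s))"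
    using inclusion_solution_continuous_on[OF z sub] by (rule continuous_on_norm)
  show ?thesis
  proof (cases "r / 2 \<le> norm (z t)")
    case True
    obtain s where s: "s \<in> {0..t}" "norm (z s) = r / 2" "\<And>u. u \<in> {0..s} \<Longrightarrow> norm (z u) \<le> r / 2"
      by (rule continuous_first_level[OF cont t0 _ True]) (use z0 r in auto)
    have "norm (z u) < r" if "u \<in> {0..s}" for u using s(3)[OF that] r(1) by linarith
    then have "norm (z s) \<le> 2 * norm (z 0)" by (rule est[OF s(1)])
    then show ?thesis using s(2) z0 by simp
  next
    case small: False
    have "norm (z u) < r" if u: "u \<in> {0..t}" for u
    proof (rule ccontr)
      assume "\<not> norm (z u) < r"
      then have ur: "r / 2 \<le> norm (z u)" using r by simp
      have cu: "continuous_on {0..u} (\<lambda>s. norm (z s))" using cont by (rule continuous_on_subset) (use u in auto)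
      have u0: "0 \<le> u" using u by simp
      obtain s where s: "s \<in> {0..u}" "norm (z s) = r / 2" "\<And>v. v \<in> {0..s} \<Longrightarrow> norm (z v) \<le> r / 2"
        by (rule continuous_first_level[OF cu u0 _ ur]) (use z0 r in auto)
      have "norm (z v) < r" if "v \<in> {0..s}" for v using s(3)[OF that] r(1) by linarith
      then have "norm (z s) \<le> 2 * norm (z 0)" using s(1) u by (intro est) auto
      then show False using s(2) z0 by simp
    qed
    then show ?thesis using t0 by (intro est) auto
  qed
qed

text \<open>The exit argument again, now for the polar curve: up to a first time at radius
  \<open>r / 2\<close> it would be a Filippov solution, hence trapped below that radius.\<close>

lemma global_solution_exists:
  assumes p: "norm p < r / 4"
  obtains w where "inclusion_solution (filippov_map field) {0..} w" "w 0 = p"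
proof (cases "p = 0")
  case True
  have "inclusion_solution (filippov_map field) {0..} (\<lambda>_. 0)"
  proof (rule inclusion_solution_lipschitzI)
    show "\<exists>L. L-lipschitz_on {a..b} (\<lambda>_::real. 0 :: real \<times> real)" for a b
      using lipschitz_on_constant by blast
    show "AE t in lebesgue. t \<in> {0..} \<longrightarrow>
        (\<exists>v. ((\<lambda>_. 0) has_vector_derivative v) (at t within {0..}) \<and> v \<in> filippov_map field 0)"
      unfolding filippov_zero using has_vector_derivative_const by blast
  qed (auto simp: is_interval_1)
  then show ?thesis using that True by blast
next
  case False
  have "norm p < rad" using p r by simp
  then obtain w S where w: "w 0 = p" "countable S" "\<And>T. \<exists>M. M-lipschitz_on {0..T} w"
    "\<And>t. t \<ge> 0 \<Longrightarrow> t \<notin> S \<Longrightarrow> norm (w t) < rad \<Longrightarrow>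
       side (w t) \<noteq> 0 \<and> (w has_vector_derivative field (w t)) (at t)"
    using polar_curve[OF False] by metis
  have small: "norm (w t) < r" if t: "t \<ge> 0" for t
  proof (rule ccontr)
    assume "\<not> norm (w t) < r"
    then have tr: "r / 2 \<le> norm (w t)" using r by simp
    obtain C where "C-lipschitz_on {0..t} w" using w(3) by blast
    then have cont: "continuous_on {0..t} (\<lambda>s. norm (w s))"
      by (intro continuous_on_norm lipschitz_on_continuous_on)
    obtain s where s: "s \<in> {0..t}" "norm (w s) = r / 2" "\<And>v. v \<in> {0..s} \<Longrightarrow> norm (w v) \<le> r / 2"
      by (rule continuous_first_level[OF cont t _ tr]) (use w(1) p r in auto)
    have "norm (w v) < rad" if "v \<in> {0..s}" for v using s(3)[OF that] r by linarith
    then have "inclusion_solution (filippov_map field) {0..s} w"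
      using s(1) by (intro polar_curve_solution[OF w(2-4)]) (auto simp: is_interval_cc)
    then have "norm (w s) \<le> 2 * norm (w 0)" by (rule trapped) (use w(1) p s in auto)
    then show False using s(2) w(1) p by simp
  qed
  have "norm (w t) < rad" if "t \<in> {0..}" for t using small[of t] that r by simp
  then have "inclusion_solution (filippov_map field) {0..} w"
    by (intro polar_curve_solution[OF w(2-4)]) (auto simp: is_interval_1)
  then show ?thesis using that w(1) by blast
qed

lemma lipschitz_solution:
  assumes z: "inclusion_solution (filippov_map field) J z" and z0: "norm (z 0) < r / 4"
  shows "(2 + L)-lipschitz_on J z"
proof (rule inclusion_solution_lipschitz[OF z])
  fix t assume "t \<in> J"
  then have "norm (z t) < 1" using trapped[OF z z0] z0 r_less_1 by force
  then show "filippov_map field (z t) \<subseteq> cball 0 (2 + L)" by (rule filippov_bound)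
qed (use L_nonneg in simp)

text \<open>A solution is Lipschitz, so it has a limit at the right end of a bounded
  \<open>J\<close>, even if \<open>J\<close> is open there, and a global solution can be started at
  this limit. The radius \<open>r / 16\<close> leaves room for the norm to double before that and
  still be below the \<open>r / 4\<close> required for the restart.\<close>

lemma solution_extension:
  assumes z: "inclusion_solution (filippov_map field) J z" and z0: "norm (z 0) < r / 16"
  shows "\<exists>w. inclusion_solution (filippov_map field) {0..} w \<and> (\<forall>t\<in>J. w t = z t)"
proof (cases "bdd_above J")
  case False
  have J: "0 \<in> J" "J \<subseteq> {0..}" "is_interval J" using z by (auto simp: inclusion_solution_def)
  have "J = {0..}"
  proof
    show "{0..} \<subseteq> J"
    proof
      fix t :: real assume t: "t \<in> {0..}"
      obtain s where "s \<in> J" "t \<le> s" using False by (meson bdd_aboveI linear)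
      then show "t \<in> J" using J t unfolding is_interval_1 by (meson atLeast_iff)
    qed
  qed (rule J)
  then show ?thesis using z by blast
next
  case True
  have J: "0 \<in> J" "J \<subseteq> {0..}" "is_interval J" using z by (auto simp: inclusion_solution_def)
  define T where "T = Sup J"
  have up: "t \<le> T" if "t \<in> J" for t unfolding T_def using that True by (rule cSup_upper)
  have T0: "0 \<le> T" using up[OF J(1)] .
  have TJ: "T \<in> closure J" unfolding T_def using J(1) True by (intro closure_contains_Sup) auto
  have clJ: "closure J = {0..T}"
  proof
    show "closure J \<subseteq> {0..T}" using up J(2) by (intro closure_minimal) auto
    have "convex (closure J)" using J(3) by (intro convex_closure) (simp add: is_interval_convex_1)
    then have "is_interval (closure J)" by (simp add: is_interval_convex_1)
    then show "{0..T} \<subseteq> closure J"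
      using TJ closure_subset[of J] J(1) unfolding is_interval_1 by (meson atLeastAtMost_iff subsetD subsetI)
  qed
  have zL: "(2 + L)-lipschitz_on J z" using lipschitz_solution[OF z] z0 r by simp
  obtain g where g: "(2 + L)-lipschitz_on {0..T} g" "\<And>t. t \<in> J \<Longrightarrow> g t = z t"
    using lipschitz_extend_closure[OF zL] unfolding clJ by blast
  have "norm (g T) \<le> 2 * norm (z 0)"
  proof -
    have "continuous_on (closure J) (\<lambda>t. norm (g t))"
      unfolding clJ using g(1) by (intro continuous_on_norm lipschitz_on_continuous_on)
    then show ?thesis
      by (rule continuous_le_on_closure[OF _ TJ]) (use g(2) trapped[OF z] z0 r in auto)
  qed
  then have gT: "norm (g T) < r / 4" using z0 r by simp
  obtain y where y: "inclusion_solution (filippov_map field) {0..} y" "y 0 = g T"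
    using global_solution_exists[OF gT] by blast
  have yL: "(2 + L)-lipschitz_on {0..} y" using lipschitz_solution[OF y(1)] y(2) gT by simp
  have "inclusion_solution (filippov_map field) {0..} (\<lambda>t. if t \<le> T then g t else y (t - T))"
    using inclusion_solution_append[OF z y(1) zL yL T0 clJ y(2)[symmetric] g] .
  then show ?thesis using up g(2) by (intro exI[of _ "\<lambda>t. if t \<le> T then g t else y (t - T)"]) auto
qed

text \<open>A solution that kept a distance \<open>e\<close> from the origin would lose
  \<open>V\<close> at the rate \<open>c * e ^ 4\<close> and make it negative. So it comes
  arbitrarily close to the origin, and monotonicity of \<open>V\<close> keeps it close from then
  on.\<close>

lemma solution_tendsto_zero:
  assumes z: "inclusion_solution (filippov_map field) {0..} z" and z0: "norm (z 0) < r / 4"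
  shows "(z \<longlongrightarrow> 0) at_top"
proof -
  have zr: "norm (z t) < r" if "t \<ge> 0" for t
    using trapped[OF z z0, of t] that z0 r by simp
  have V0: "V (z t) \<ge> 0" if "t \<ge> 0" for t
    using V_bounds(1)[OF zr[OF that]] by (meson order_trans zero_le_power2 divide_nonneg_pos zero_less_numeral)
  have mono: "V (z t) \<le> V (z s)" if "0 \<le> s" "s \<le> t" for s t
    using V_growth[OF z, of s t 0] that zr by auto
  have "\<exists>T\<ge>0. norm (z T) < e" if e: "e > 0" for e
  proof (rule ccontr)
    assume "\<not> (\<exists>T\<ge>0. norm (z T) < e)"
    then have far: "e \<le> norm (z t)" if "t \<ge> 0" for t using that by force
    \<comment> \<open>By this time \<open>V\<close> would have dropped by one more than its initial
      value.\<close>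
    define T where "T = (V (z 0) + 1) / (c * e ^ 4)"
    have T: "0 \<le> T" "c * e ^ 4 * T = V (z 0) + 1" using c e V0[of 0] by (simp_all add: T_def)
    have "c * e ^ 4 * (T - 0) \<le> (- 1) * V (z T) - (- 1) * V (z 0)"
      by (rule V_growth[OF z]) (use T zr far e in auto)
    then show False using T V0[OF T(1)] by simp
  qed
  note near = this
  have "\<forall>\<^sub>F t in at_top. dist (z t) 0 < e" if e: "e > 0" for e
  proof -
    obtain T where T: "T \<ge> 0" "norm (z T) < e / 2" using near[of "e / 2"] e by auto
    have "norm (z t) < e" if t: "t \<ge> T" for t
    proof -
      have "(norm (z t))\<^sup>2 / 4 \<le> (norm (z T))\<^sup>2"
        using V_bounds(1)[OF zr[of t]] V_bounds(2)[OF zr[OF T(1)]] mono[OF T(1) t] t T(1) by linarith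
      then have "(norm (z t))\<^sup>2 \<le> (2 * norm (z T))\<^sup>2" by (simp add: power_mult_distrib)
      then have "norm (z t) \<le> 2 * norm (z T)" by (rule power2_le_imp_le) simp
      then show ?thesis using T(2) by simp
    qed
    then show ?thesis by (auto simp: eventually_at_top_linorder)
  qed
  then show ?thesis by (rule tendstoI)
qed

theorem asymptotically_stable: "filippov_asymptotically_stable field 0"
  unfolding filippov_asymptotically_stable_def
proof (intro conjI)
  show "0 \<in> filippov_map field 0" by (simp add: filippov_zero)
  show "inclusion_stable (filippov_map field) 0"
    unfolding inclusion_stable_def
  proof (intro allI impI)
    fix e :: real assume e: "e > 0"
    have "(\<forall>t\<in>J. dist (z t) 0 < e) \<and> (\<exists>w. inclusion_solution (filippov_map field) {0..} w \<and> (\<forall>t\<in>J. w t = z t))"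
      if z: "inclusion_solution (filippov_map field) J z" and z0: "dist (z 0) 0 < min (e / 2) (r / 16)" for J z
    proof
      have "norm (z 0) < r / 4" using z0 r by simp
      from trapped[OF z this] z0 show "\<forall>t\<in>J. dist (z t) 0 < e" by force
      show "\<exists>w. inclusion_solution (filippov_map field) {0..} w \<and> (\<forall>t\<in>J. w t = z t)"
        using z0 by (intro solution_extension[OF z]) simp
    qed
    then show "\<exists>d>0. \<forall>J z. inclusion_solution (filippov_map field) J z \<and> dist (z 0) 0 < d \<longrightarrow>
        (\<forall>t\<in>J. dist (z t) 0 < e) \<and> (\<exists>w. inclusion_solution (filippov_map field) {0..} w \<and> (\<forall>t\<in>J. w t = z t))"
      using e r by (intro exI[of _ "min (e / 2) (r / 16)"]) auto
  qed
  show "inclusion_attractive (filippov_map field) 0"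
    unfolding inclusion_attractive_def
    using solution_tendsto_zero r by (intro exI[of _ "r / 4"]) auto
qed

end

section \<open>Instability when \<open>V\<close> increases\<close>

locale switched_oscillator_growth = switched_oscillator_lyapunov K D\<^sub>1 D\<^sub>2 L r c 1 M V
  for K D\<^sub>1 D\<^sub>2 L r c M V
begin

text \<open>The assumed stability supplies a global solution from a point \<open>p\<close> close to
  the origin and confines it to the ball where \<open>V\<close> increases. Along it \<open>V\<close>
  stays at or above \<open>V p > 0\<close>, which contradicts the convergence to the origin demanded
  by attractivity.\<close>

theorem not_asymptotically_stable: "\<not> filippov_asymptotically_stable field 0"
proof
  assume "filippov_asymptotically_stable field 0"
  then have st: "inclusion_stable (filippov_map field) 0" and at: "inclusion_attractive (filippov_map field) 0"
    by (auto simp: filippov_asymptotically_stable_def)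
  obtain d where d: "d > 0" and dd: "\<And>J z. inclusion_solution (filippov_map field) J z \<Longrightarrow> dist (z 0) 0 < d \<Longrightarrow>
        (\<forall>t\<in>J. dist (z t) 0 < r) \<and> (\<exists>w. inclusion_solution (filippov_map field) {0..} w \<and> (\<forall>t\<in>J. w t = z t))"
    using st[unfolded inclusion_stable_def, rule_format, OF r(1)] by metis
  obtain d' where d': "d' > 0" and conv: "\<And>z. inclusion_solution (filippov_map field) {0..} z \<Longrightarrow>
      dist (z 0) 0 < d' \<Longrightarrow> (z \<longlongrightarrow> 0) at_top"
    using at unfolding inclusion_attractive_def by blast
  define p :: "real \<times> real" where "p = (min d d' / 2, 0)"
  have p: "p \<noteq> 0" "norm p < d" "norm p < d'" using d d' by (auto simp: p_def norm_Pair zero_prod_def)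
  \<comment> \<open>On the null set \<open>{0}\<close> the differential inclusion is vacuous, so any
    initial point is a solution, which stability then continues to all times.\<close>
  have "inclusion_solution (filippov_map field) {0} (\<lambda>_. p)"
  proof (rule inclusion_solution_lipschitzI)
    show "\<exists>L. L-lipschitz_on {a..b} (\<lambda>_::real. p)" for a b
      using lipschitz_on_constant by blast
    have "{0 :: real} \<in> null_sets lebesgue" by (simp add: negligible_iff_null_sets[symmetric])
    then have "AE t in lebesgue. t \<notin> {0 :: real}" by (rule AE_not_in)
    then show "AE t in lebesgue. t \<in> {0} \<longrightarrow>
        (\<exists>v. ((\<lambda>_. p) has_vector_derivative v) (at t within {0}) \<and> v \<in> filippov_map field p)"
      by eventually_elim blast
  qed (auto simp: is_interval_1)
  then obtain w where w: "inclusion_solution (filippov_map field) {0..} w" "w 0 = p"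
    using dd[of "{0}" "\<lambda>_. p"] p by auto
  have wr: "norm (w t) < r" if "t \<ge> 0" for t
    using dd[OF w(1)] w(2) p that by auto
  have lower: "V p \<le> V (w t)" if "t \<ge> 0" for t
    using V_growth[OF w(1), of 0 t 0] that wr w(2) by auto
  have "V p > 0" using V_bounds(1)[of p] wr[of 0] w(2) p(1)
    by (smt (verit) zero_less_norm_iff zero_less_power divide_pos_pos)
  have "(w \<longlongrightarrow> 0) at_top" using conv[OF w(1)] w(2) p by simp
  moreover have "isCont V 0" using has_derivative_continuous[OF V_derivative_zero] .
  ultimately have "((\<lambda>t. V (w t)) \<longlongrightarrow> V 0) at_top" by (rule isCont_tendsto_compose[rotated])
  then have "((\<lambda>t. V (w t)) \<longlongrightarrow> 0) at_top" by (simp add: V_zero)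
  moreover have "\<forall>\<^sub>F t in at_top. V p \<le> V (w t)"
    using lower by (auto simp: eventually_at_top_linorder)
  ultimately have "V p \<le> 0" by (rule tendsto_lowerbound) simp
  then show False using \<open>V p > 0\<close> by simp
qed

end

subsection \<open>Gluing a Lyapunov function from two half planes\<close>

text \<open>This is \<open>f = O(r ^ n)\<close> with a bound on the whole unit ball. As
  \<open>r < 1\<close> there, the exponent may be lowered without shrinking the domain.\<close>

definition small_order :: "nat \<Rightarrow> ('a::real_normed_vector \<Rightarrow> real) \<Rightarrow> bool" where
  "small_order n f \<longleftrightarrow> (\<exists>C. \<forall>p\<in>ball 0 1. \<bar>f p\<bar> \<le> C * norm p ^ n)"

lemma small_order_mono:
  assumes "small_order m f" and "n \<le> m"
  shows "small_order n f"
proof -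
  obtain C where C: "\<And>p. p \<in> ball 0 1 \<Longrightarrow> \<bar>f p\<bar> \<le> C * norm p ^ m"
    using assms(1) unfolding small_order_def by blast
  have "\<bar>f p\<bar> \<le> \<bar>C\<bar> * norm p ^ n" if p: "p \<in> ball 0 1" for p
  proof -
    have "C * norm p ^ m \<le> \<bar>C\<bar> * norm p ^ n"
      using p assms(2) by (intro mult_mono power_decreasing) auto
    then show ?thesis using C[OF p] by linarith
  qed
  then show ?thesis unfolding small_order_def by blast
qed

lemma small_order_add:
  assumes "small_order n f" "small_order n g"
  shows "small_order n (\<lambda>p. f p + g p)"
proof -
  obtain C C' where "\<And>p. p \<in> ball 0 1 \<Longrightarrow> \<bar>f p\<bar> \<le> C * norm p ^ n" "\<And>p. p \<in> ball 0 1 \<Longrightarrow> \<bar>g p\<bar> \<le> C' * norm p ^ n"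
    using assms unfolding small_order_def by blast
  then have "\<bar>f p + g p\<bar> \<le> (C + C') * norm p ^ n" if "p \<in> ball 0 1" for p
    using that by (fastforce simp: distrib_right intro: order_trans[OF abs_triangle_ineq] add_mono)
  then show ?thesis unfolding small_order_def by blast
qed

lemma small_order_mult:
  assumes "small_order m f" "small_order n g"
  shows "small_order (m + n) (\<lambda>p. f p * g p)"
proof -
  obtain C C' where C: "\<And>p. p \<in> ball 0 1 \<Longrightarrow> \<bar>f p\<bar> \<le> C * norm p ^ m" "\<And>p. p \<in> ball 0 1 \<Longrightarrow> \<bar>g p\<bar> \<le> C' * norm p ^ n"
    using assms unfolding small_order_def by blast
  have "\<bar>f p * g p\<bar> \<le> (C * C') * norm p ^ (m + n)" if p: "p \<in> ball 0 1" for p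
  proof -
    have "\<bar>f p\<bar> * \<bar>g p\<bar> \<le> (C * norm p ^ m) * (C' * norm p ^ n)"
      using C[OF p] by (intro mult_mono) (auto intro: order_trans[OF abs_ge_zero])
    then show ?thesis by (simp add: abs_mult power_add mult_ac)
  qed
  then show ?thesis unfolding small_order_def by blast
qed

lemma small_order_const: "small_order 0 (\<lambda>_. c)"
  unfolding small_order_def by (intro exI[of _ "\<bar>c\<bar>"]) simp

lemma small_order_minus: "small_order n f \<Longrightarrow> small_order n (\<lambda>p. - f p)"
  unfolding small_order_def by simp

lemma small_order_diff: "small_order n f \<Longrightarrow> small_order n g \<Longrightarrow> small_order n (\<lambda>p. f p - g p)"
  using small_order_add[OF _ small_order_minus] by fastforce

lemma small_order_fst: "small_order (Suc 0) (fst :: real \<times> real \<Rightarrow> real)"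
  and small_order_snd: "small_order (Suc 0) (snd :: real \<times> real \<Rightarrow> real)"
  unfolding small_order_def using abs_fst_le_norm abs_snd_le_norm by (simp_all add: exI[of _ 1])

lemma small_order_norm: "small_order (Suc 0) (norm :: 'a::real_normed_vector \<Rightarrow> real)"
  unfolding small_order_def by (auto intro!: exI[of _ 1])

text \<open>At the origin the quotient is \<open>0\<close> by the convention for division by zero,
  so the bound holds there too.\<close>

lemma small_order_fst_div_norm: "small_order 0 (\<lambda>p :: real \<times> real. fst p / norm p)"
  and small_order_snd_div_norm: "small_order 0 (\<lambda>p :: real \<times> real. snd p / norm p)"
  unfolding small_order_def using abs_fst_le_norm abs_snd_le_norm
  by (auto intro!: exI[of _ 1] simp del: split_paired_All simp: divide_le_eq_1)

lemmas small_order_factor = small_order_mult small_order_const small_order_fst small_order_snd small_order_norm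
  small_order_fst_div_norm small_order_snd_div_norm

text \<open>Lipschitz functions alone are not closed under products; with boundedness added they
  are, so polynomials in the coordinates and the norm can be treated by structural rules.\<close>

definition bounded_lipschitz :: "'a::metric_space set \<Rightarrow> ('a \<Rightarrow> real) \<Rightarrow> bool" where
  "bounded_lipschitz S f \<longleftrightarrow> (\<exists>C. C-lipschitz_on S f) \<and> (\<exists>B. \<forall>x\<in>S. \<bar>f x\<bar> \<le> B)"

lemma bounded_lipschitz_const: "bounded_lipschitz S (\<lambda>_. c)"
  unfolding bounded_lipschitz_def using lipschitz_on_constant by auto

lemma bounded_lipschitz_add:
  assumes "bounded_lipschitz S f" "bounded_lipschitz S g"
  shows "bounded_lipschitz S (\<lambda>x. f x + g x)"
proof -
  obtain C D A B where f: "C-lipschitz_on S f" "\<And>x. x \<in> S \<Longrightarrow> \<bar>f x\<bar> \<le> A"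
    and g: "D-lipschitz_on S g" "\<And>x. x \<in> S \<Longrightarrow> \<bar>g x\<bar> \<le> B"
    using assms unfolding bounded_lipschitz_def by metis
  have "\<bar>f x + g x\<bar> \<le> A + B" if "x \<in> S" for x
    using f(2)[OF that] g(2)[OF that] by linarith
  then show ?thesis
    unfolding bounded_lipschitz_def using lipschitz_on_add[OF f(1) g(1)] by blast
qed

lemma bounded_lipschitz_mult:
  assumes "bounded_lipschitz S f" "bounded_lipschitz S g"
  shows "bounded_lipschitz S (\<lambda>x. f x * g x)"
proof -
  obtain C D A B where f: "C-lipschitz_on S f" "\<And>x. x \<in> S \<Longrightarrow> \<bar>f x\<bar> \<le> A"
    and g: "D-lipschitz_on S g" "\<And>x. x \<in> S \<Longrightarrow> \<bar>g x\<bar> \<le> B"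
    using assms unfolding bounded_lipschitz_def by metis
  have f': "\<bar>f x\<bar> \<le> max A 0" and g': "\<bar>g x\<bar> \<le> max B 0" if "x \<in> S" for x
    using f(2)[OF that] g(2)[OF that] by auto
  have "\<bar>f x * g x\<bar> \<le> max A 0 * max B 0" if "x \<in> S" for x
    unfolding abs_mult using f'[OF that] g'[OF that] by (intro mult_mono) auto
  moreover have "(C * max B 0 + max A 0 * D)-lipschitz_on S (\<lambda>x. f x * g x)"
    using f(1) f' g(1) g' by (rule lipschitz_on_mult_bounded) auto
  ultimately show ?thesis unfolding bounded_lipschitz_def by blast
qed

lemma bounded_lipschitz_minus: "bounded_lipschitz S f \<Longrightarrow> bounded_lipschitz S (\<lambda>x. - f x)"
  using bounded_lipschitz_mult[OF bounded_lipschitz_const, of S f "-1"] by simp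

lemma bounded_lipschitz_diff:
  "bounded_lipschitz S f \<Longrightarrow> bounded_lipschitz S g \<Longrightarrow> bounded_lipschitz S (\<lambda>x. f x - g x)"
  using bounded_lipschitz_add[OF _ bounded_lipschitz_minus] by fastforce

lemma bounded_lipschitz_power: "bounded_lipschitz S f \<Longrightarrow> bounded_lipschitz S (\<lambda>x. f x ^ n)"
  by (induction n) (auto intro: bounded_lipschitz_const bounded_lipschitz_mult)

lemma bounded_lipschitz_divide: "bounded_lipschitz S f \<Longrightarrow> bounded_lipschitz S (\<lambda>x. f x / c)"
  using bounded_lipschitz_mult[OF _ bounded_lipschitz_const, of S f "inverse c"] by (simp add: divide_inverse)

lemma bounded_lipschitz_fst: "bounded_lipschitz (cball (0 :: real \<times> real) 1) fst"
  and bounded_lipschitz_snd: "bounded_lipschitz (cball (0 :: real \<times> real) 1) snd"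
  and bounded_lipschitz_norm: "bounded_lipschitz (cball (0 :: real \<times> real) 1) norm"
proof -
  have "1-lipschitz_on (cball 0 1) (fst :: real \<times> real \<Rightarrow> real)"
    by (rule lipschitz_onI) (simp_all only: dist_fst_le mult_1 zero_le_one)
  moreover have "1-lipschitz_on (cball 0 1) (snd :: real \<times> real \<Rightarrow> real)"
    by (rule lipschitz_onI) (simp_all only: dist_snd_le mult_1 zero_le_one)
  moreover have "1-lipschitz_on (cball 0 1) (norm :: real \<times> real \<Rightarrow> real)"
    by (rule lipschitz_onI) (simp_all only: dist_norm real_norm_def norm_triangle_ineq3 mult_1 zero_le_one)
  moreover have "\<bar>fst p\<bar> \<le> 1" "\<bar>snd p\<bar> \<le> 1" if "p \<in> cball 0 1" for p :: "real \<times> real"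
    using that abs_fst_le_norm[of p] abs_snd_le_norm[of p] by auto
  ultimately show "bounded_lipschitz (cball (0 :: real \<times> real) 1) fst"
    "bounded_lipschitz (cball (0 :: real \<times> real) 1) snd"
    "bounded_lipschitz (cball (0 :: real \<times> real) 1) norm"
    unfolding bounded_lipschitz_def by (metis, metis, metis abs_norm_cancel mem_cball_0)
qed

lemmas bounded_lipschitz_intros = bounded_lipschitz_const bounded_lipschitz_add bounded_lipschitz_diff
  bounded_lipschitz_minus bounded_lipschitz_mult bounded_lipschitz_power bounded_lipschitz_divide
  bounded_lipschitz_fst bounded_lipschitz_snd bounded_lipschitz_norm

text \<open>The segment between two points on opposite sides meets the hyperplane, where the two
  functions agree, and the distances to the meeting point add up to the length of the
  segment.\<close>

lemma lipschitz_on_glue_halfplanes: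
  fixes f g :: "'a::real_normed_vector \<Rightarrow> real"
  assumes S: "convex S" and f: "C-lipschitz_on S f" and g: "C-lipschitz_on S g"
    and h: "linear h" and eq: "\<And>x. x \<in> S \<Longrightarrow> h x = (0 :: real) \<Longrightarrow> f x = g x"
  shows "C-lipschitz_on S (\<lambda>x. if h x > 0 then f x else g x)"
proof (rule lipschitz_onI)
  show "0 \<le> C" using f by (rule lipschitz_on_nonneg)
  let ?F = "\<lambda>x. if h x > 0 then f x else g x"
  have cross: "dist (f x) (g y) \<le> C * dist x y" if xy: "x \<in> S" "y \<in> S" "h x > 0" "\<not> h y > 0" for x y
  proof -
    \<comment> \<open>The parameter at which the affine function \<open>h\<close> vanishes along the
      segment.\<close>
    define l where "l = h x / (h x - h y)"
    have l: "0 \<le> l" "l \<le> 1" using xy by (auto simp: l_def divide_simps)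
    define m where "m = (1 - l) *\<^sub>R x + l *\<^sub>R y"
    have m: "m \<in> S" unfolding m_def using S xy(1,2) l by (auto simp: convex_alt)
    have "h m = (1 - l) * h x + l * h y" by (simp add: m_def linear_add[OF h] linear_cmul[OF h])
    also have "\<dots> = 0" using xy by (simp add: l_def field_simps)
    finally have fg: "f m = g m" using eq m by blast
    have "x - m = l *\<^sub>R (x - y)" "m - y = (1 - l) *\<^sub>R (x - y)"
      by (simp_all add: m_def algebra_simps)
    then have d: "dist x m = l * dist x y" "dist m y = (1 - l) * dist x y"
      using l by (simp_all add: dist_norm)
    have "dist (f x) (g y) \<le> dist (f x) (f m) + dist (g m) (g y)"
      using dist_triangle[of "f x" "g y" "f m"] fg by simp
    also have "\<dots> \<le> C * dist x m + C * dist m y"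
      using lipschitz_onD[OF f xy(1) m] lipschitz_onD[OF g m xy(2)] by (rule add_mono)
    also have "\<dots> = C * dist x y" unfolding d by (simp add: algebra_simps)
    finally show ?thesis .
  qed
  fix x y assume xy: "x \<in> S" "y \<in> S"
  show "dist (?F x) (?F y) \<le> C * dist x y"
    using cross[of x y] cross[of y x] lipschitz_onD[OF f xy] lipschitz_onD[OF g xy] xy
    by (auto simp: dist_commute)
qed

context switched_oscillator
begin

text \<open>A rate of exact order \<open>n\<close> survives a remainder of order
  \<open>n + 1\<close> on a small ball, at the cost of half the constant. The exponent is 3 if the
  cubic terms decide and 4 otherwise; inside the unit ball both dominate the fourth power asked for
  in the locale. Derivatives are required off the origin only, because a piece may contain the
  norm.\<close>

lemma lyapunov_from_pieces:
  fixes V\<^sub>1 V\<^sub>2 :: "real \<times> real \<Rightarrow> real"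
  assumes lip: "bounded_lipschitz (cball 0 1) V\<^sub>1" "bounded_lipschitz (cball 0 1) V\<^sub>2"
    and agree: "\<And>p. side p = 0 \<Longrightarrow> V\<^sub>1 p = V\<^sub>2 p"
    and near: "small_order 3 (\<lambda>p. V\<^sub>1 p - (norm p)\<^sup>2 / 2)" "small_order 3 (\<lambda>p. V\<^sub>2 p - (norm p)\<^sup>2 / 2)"
    and deriv: "\<And>p. p \<noteq> 0 \<Longrightarrow> (V\<^sub>1 has_derivative V\<^sub>1' p) (at p)" "\<And>p. p \<noteq> 0 \<Longrightarrow> (V\<^sub>2 has_derivative V\<^sub>2' p) (at p)"
    and n: "n \<le> 4" and \<kappa>: "\<kappa> > 0"
    and rest: "small_order (Suc n) e\<^sub>1" "small_order (Suc n) e\<^sub>2"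
    and rate: "\<And>p. side p > 0 \<Longrightarrow> \<kappa> * norm p ^ n + e\<^sub>1 p \<le> \<sigma> * V\<^sub>1' p (field p)"
      "\<And>p. side p < 0 \<Longrightarrow> \<kappa> * norm p ^ n + e\<^sub>2 p \<le> \<sigma> * V\<^sub>2' p (field p)"
  obtains r c M V where "switched_oscillator_lyapunov K D\<^sub>1 D\<^sub>2 L r c \<sigma> M V"
proof -
  define V where "V = (\<lambda>p. if side p > 0 then V\<^sub>1 p else V\<^sub>2 p)"
  obtain M\<^sub>1 M\<^sub>2 where "M\<^sub>1-lipschitz_on (cball 0 1) V\<^sub>1" "M\<^sub>2-lipschitz_on (cball 0 1) V\<^sub>2"
    using lip unfolding bounded_lipschitz_def by blast
  then have "(max M\<^sub>1 M\<^sub>2)-lipschitz_on (cball 0 1) V\<^sub>1" "(max M\<^sub>1 M\<^sub>2)-lipschitz_on (cball 0 1) V\<^sub>2"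
    by (auto intro: lipschitz_on_mono)
  moreover have "linear side" by (rule linearI) (simp_all add: side_def algebra_simps)
  ultimately have V_lip: "(max M\<^sub>1 M\<^sub>2)-lipschitz_on (cball 0 1) V"
    unfolding V_def using agree by (intro lipschitz_on_glue_halfplanes) auto
  obtain A\<^sub>1 where A1: "\<And>p. p \<in> ball 0 1 \<Longrightarrow> \<bar>V\<^sub>1 p - (norm p)\<^sup>2 / 2\<bar> \<le> A\<^sub>1 * norm p ^ 3"
    using near(1) unfolding small_order_def by blast
  obtain A\<^sub>2 where A2: "\<And>p. p \<in> ball 0 1 \<Longrightarrow> \<bar>V\<^sub>2 p - (norm p)\<^sup>2 / 2\<bar> \<le> A\<^sub>2 * norm p ^ 3"
    using near(2) unfolding small_order_def by blast
  obtain B\<^sub>1 where B1: "\<And>p. p \<in> ball 0 1 \<Longrightarrow> \<bar>e\<^sub>1 p\<bar> \<le> B\<^sub>1 * norm p ^ Suc n"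
    using rest(1) unfolding small_order_def by blast
  obtain B\<^sub>2 where B2: "\<And>p. p \<in> ball 0 1 \<Longrightarrow> \<bar>e\<^sub>2 p\<bar> \<le> B\<^sub>2 * norm p ^ Suc n"
    using rest(2) unfolding small_order_def by blast
  define A where "A = \<bar>A\<^sub>1\<bar> + \<bar>A\<^sub>2\<bar> + 1"
  define B where "B = \<bar>B\<^sub>1\<bar> + \<bar>B\<^sub>2\<bar> + 1"
  have AB: "A > 0" "B > 0" by (simp_all add: A_def B_def add_nonneg_pos)
  \<comment> \<open>The bound \<open>1 / (4 * A)\<close> keeps \<open>V\<close> within
    \<open>norm\<^sup>2 / 4\<close> of \<open>norm\<^sup>2 / 2\<close>, which leaves the required
    quadratic bounds; the bound \<open>\<kappa> / (2 * B)\<close> lets the remainder use up at most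
    half of \<open>\<kappa>\<close>.\<close>
  define r where "r = min rad (min (1 / (4 * A)) (\<kappa> / (2 * B)))"
  have r: "0 < r" "r \<le> rad" "r < 1" using rad_pos rad_le_half AB \<kappa> by (auto simp: r_def)
  have Ar: "A * norm p \<le> 1 / 4" and Br: "B * norm p \<le> \<kappa> / 2" if "norm p < r" for p :: "real \<times> real"
  proof -
    have "norm p \<le> 1 / (4 * A)" "norm p \<le> \<kappa> / (2 * B)" using that by (auto simp: r_def)
    then show "A * norm p \<le> 1 / 4" "B * norm p \<le> \<kappa> / 2" using AB by (auto simp: field_simps)
  qed
  have V_near: "\<bar>V p - (norm p)\<^sup>2 / 2\<bar> \<le> (norm p)\<^sup>2 / 4" if p: "norm p < r" for p
  proof -
    have "p \<in> ball 0 1" using p r by simp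
    then have "\<bar>V p - (norm p)\<^sup>2 / 2\<bar> \<le> max A\<^sub>1 A\<^sub>2 * norm p ^ 3"
      using A1[of p] A2[of p] mult_right_mono[of A\<^sub>1 "max A\<^sub>1 A\<^sub>2" "norm p ^ 3"]
        mult_right_mono[of A\<^sub>2 "max A\<^sub>1 A\<^sub>2" "norm p ^ 3"]
      unfolding V_def by auto
    also have "\<dots> \<le> A * norm p ^ 3" by (intro mult_right_mono) (auto simp: A_def)
    also have "\<dots> = (A * norm p) * (norm p)\<^sup>2" by (simp add: power2_eq_square power3_eq_cube)
    also have "\<dots> \<le> 1 / 4 * (norm p)\<^sup>2" using Ar[OF p] by (intro mult_right_mono) auto
    finally show ?thesis by simp
  qed
  have V_rate: "\<kappa> / 2 * norm p ^ 4 \<le> v" if p: "norm p < r" and v: "\<kappa> * norm p ^ n + e p \<le> v"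
    and e: "\<bar>e p\<bar> \<le> C * norm p ^ Suc n" "C \<le> B" for p :: "real \<times> real" and e C v
  proof -
    have "\<bar>e p\<bar> \<le> B * norm p ^ Suc n" using e(1) mult_right_mono[OF e(2), of "norm p ^ Suc n"] by simp
    also have "\<dots> = (B * norm p) * norm p ^ n" by simp
    also have "\<dots> \<le> \<kappa> / 2 * norm p ^ n" using Br[OF p] by (intro mult_right_mono) auto
    finally have "\<kappa> / 2 * norm p ^ n \<le> v" using v by (simp add: field_simps)
    moreover have "norm p ^ 4 \<le> norm p ^ n" using n p r by (intro power_decreasing) auto
    then have "\<kappa> / 2 * norm p ^ 4 \<le> \<kappa> / 2 * norm p ^ n" using \<kappa> by (intro mult_left_mono) auto
    ultimately show ?thesis by linarith
  qed
  have "switched_oscillator_lyapunov K D\<^sub>1 D\<^sub>2 L r (\<kappa> / 2) \<sigma> (max M\<^sub>1 M\<^sub>2) V"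
  proof unfold_locales
    show "0 < r" "r \<le> rad" "0 < \<kappa> / 2" using r \<kappa> by auto
    show "(max M\<^sub>1 M\<^sub>2)-lipschitz_on (ball 0 r) V"
      using V_lip by (rule lipschitz_on_subset) (use r in auto)
    show "(norm p)\<^sup>2 / 4 \<le> V p" "V p \<le> (norm p)\<^sup>2" if "norm p < r" for p
      using V_near[OF that] unfolding abs_le_iff by (auto simp: field_simps)
    show "\<exists>V'. (V has_derivative V') (at p) \<and> \<kappa> / 2 * norm p ^ 4 \<le> \<sigma> * V' (field p)"
      if p: "norm p < r" "side p \<noteq> 0" for p
    proof -
      have p0: "p \<noteq> 0" using p(2) by (auto simp: side_def)
      have p1: "p \<in> ball 0 1" using p r by simp
      show ?thesis
      proof (cases "side p > 0")
        case True
        have ev: "\<forall>\<^sub>F q in at p. V\<^sub>1 q = V q"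
          using order_tendstoD(1)[OF side_tendsto True] by eventually_elim (simp add: V_def)
        have "(V has_derivative V\<^sub>1' p) (at p)"
          using has_derivative_transform_eventually[OF deriv(1)[OF p0] ev] True by (simp add: V_def)
        moreover have "\<kappa> / 2 * norm p ^ 4 \<le> \<sigma> * V\<^sub>1' p (field p)"
          by (rule V_rate[where e = e\<^sub>1, OF p(1) rate(1)[OF True] B1[OF p1]]) (simp add: B_def)
        ultimately show ?thesis by blast
      next
        case False
        then have neg: "side p < 0" using p(2) by simp
        have ev: "\<forall>\<^sub>F q in at p. V\<^sub>2 q = V q"
          using order_tendstoD(2)[OF side_tendsto neg] by eventually_elim (simp add: V_def)
        have "(V has_derivative V\<^sub>2' p) (at p)"
          using has_derivative_transform_eventually[OF deriv(2)[OF p0] ev] neg by (simp add: V_def)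
        moreover have "\<kappa> / 2 * norm p ^ 4 \<le> \<sigma> * V\<^sub>2' p (field p)"
          by (rule V_rate[where e = e\<^sub>2, OF p(1) rate(2)[OF neg] B2[OF p1]]) (simp add: B_def)
        ultimately show ?thesis by blast
      qed
    qed
  qed
  then show ?thesis by (rule that)
qed

end

subsection \<open>Quadratic damping\<close>

lemma norm_squared_prod: "(norm p)\<^sup>2 = fst p * fst p + snd p * snd p" for p :: "real \<times> real"
  by (cases p) (simp add: norm_Pair power2_eq_square)

lemma has_derivative_norm_prod:
  fixes p :: "real \<times> real"
  assumes "p \<noteq> 0"
  shows "(norm has_derivative (\<lambda>h. (fst p * fst h + snd p * snd h) / norm p)) (at p)"
  using has_derivative_norm[OF assms]
  by (rule has_derivative_eq_rhs)
    (auto simp: sgn_div_norm inner_prod_def fun_eq_iff divide_inverse algebra_simps)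

text \<open>The cubic part solves \<open>x * Q\<^sub>y - y * Q\<^sub>x = - y\<^sup>2 * (c\<^sub>1 * x + c\<^sub>2 * y)\<close>, which cancels the cubic terms of the
  energy balance.\<close>

definition cubic_base :: "real \<Rightarrow> real \<Rightarrow> real \<times> real \<Rightarrow> real" where
  "cubic_base c\<^sub>1 c\<^sub>2 p = (fst p * fst p + snd p * snd p) / 2 + (c\<^sub>2 * (fst p * (snd p * snd p))
     + 2 / 3 * c\<^sub>2 * (fst p * (fst p * fst p)) - 1 / 3 * c\<^sub>1 * (snd p * (snd p * snd p)))"

lemma cubic_base_derivative:
  "(cubic_base c\<^sub>1 c\<^sub>2 has_derivative (\<lambda>h. (fst p + c\<^sub>2 * ((snd p)\<^sup>2 + 2 * (fst p)\<^sup>2)) * fst h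
     + (snd p - c\<^sub>1 * (snd p)\<^sup>2 + 2 * c\<^sub>2 * fst p * snd p) * snd h)) (at p)"
  unfolding cubic_base_def
  by (auto intro!: derivative_eq_intros simp: fun_eq_iff power2_eq_square field_simps)

lemma cubic_base_bounded_lipschitz: "bounded_lipschitz (cball 0 1) (cubic_base c\<^sub>1 c\<^sub>2)"
  unfolding cubic_base_def by (intro bounded_lipschitz_intros)

lemma cubic_base_near: "small_order 3 (\<lambda>p. cubic_base c\<^sub>1 c\<^sub>2 p - (norm p)\<^sup>2 / 2)"
  unfolding cubic_base_def norm_squared_prod add_diff_cancel_left'
  by (intro small_order_add small_order_diff) (rule small_order_mono, (rule small_order_factor)+, simp)+

text \<open>The energy balance for the base function plus a correction with partial derivatives
  \<open>W\<^sub>x\<close> and \<open>W\<^sub>y\<close>. Quadratic and cubic terms have cancelled;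
  what remains is the derivative of the correction along the rotation, the quartic terms from the
  quadratic part of the damping, and products with the damping.\<close>

lemma cubic_base_rate:
  "(x + c\<^sub>2 * (y\<^sup>2 + 2 * x\<^sup>2) + W\<^sub>x) * - y
      + (y - c\<^sub>1 * y\<^sup>2 + 2 * c\<^sub>2 * x * y + W\<^sub>y) * (x + quad_damping c\<^sub>1 c\<^sub>2 c\<^sub>3 c\<^sub>4 c\<^sub>5 x y * y)
    = (x * W\<^sub>y - y * W\<^sub>x) + y * y * (c\<^sub>3 * x\<^sup>2 + c\<^sub>4 * x * y + c\<^sub>5 * y\<^sup>2)
      + quad_damping c\<^sub>1 c\<^sub>2 c\<^sub>3 c\<^sub>4 c\<^sub>5 x y * y * ((2 * c\<^sub>2 * x * y - c\<^sub>1 * y\<^sup>2) + W\<^sub>y)"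
  unfolding quad_damping_def by (simp add: power2_eq_square algebra_simps)

lemma small_order_quad_damping: "small_order 1 (\<lambda>p. quad_damping c\<^sub>1 c\<^sub>2 c\<^sub>3 c\<^sub>4 c\<^sub>5 (fst p) (snd p))"
  unfolding quad_damping_def power2_eq_square
  by (intro small_order_add) (rule small_order_mono, (rule small_order_factor)+, simp)+

lemma bounded_lipschitz_quad_damping:
  "bounded_lipschitz (cball 0 1) (\<lambda>(x, y). quad_damping c\<^sub>1 c\<^sub>2 c\<^sub>3 c\<^sub>4 c\<^sub>5 x y)"
  unfolding quad_damping_def case_prod_beta by (intro bounded_lipschitz_intros)

text \<open>The contributions of the two half planes to the first return map differ by a cubic term. The
  twist absorbs it: on the switching line it equals \<open>- \<epsilon> * s * (1 + K\<^sup>2)\<^sup>2 * x\<^sup>3\<close>, and its derivative along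
  the rotation has the sign of \<open>s\<close> on the half plane \<open>\<epsilon> * (y - K * x) \<ge> 0\<close>.\<close>

definition twist :: "real \<Rightarrow> real \<Rightarrow> real \<Rightarrow> real \<times> real \<Rightarrow> real" where
  "twist K s \<epsilon> p = s * (1 / (2 * (1 + K\<^sup>2)) * (norm p * ((fst p + K * snd p) * (snd p - K * fst p)))
     - \<epsilon> * ((fst p * fst p + snd p * snd p) * (fst p + K * snd p)))"

definition twist_dx :: "real \<Rightarrow> real \<Rightarrow> real \<Rightarrow> real \<times> real \<Rightarrow> real" where
  "twist_dx K s \<epsilon> p = (let x = fst p; y = snd p; X = x + K * y; Y = y - K * x in
     s * (1 / (2 * (1 + K\<^sup>2)) * (x / norm p * (X * Y) + norm p * (Y - K * X)) - \<epsilon> * (x * x + y * y + 2 * x * X)))"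

definition twist_dy :: "real \<Rightarrow> real \<Rightarrow> real \<Rightarrow> real \<times> real \<Rightarrow> real" where
  "twist_dy K s \<epsilon> p = (let x = fst p; y = snd p; X = x + K * y; Y = y - K * x in
     s * (1 / (2 * (1 + K\<^sup>2)) * (y / norm p * (X * Y) + norm p * (K * Y + X)) - \<epsilon> * (K * (x * x + y * y) + 2 * y * X)))"

lemma twist_derivative:
  assumes "p \<noteq> 0"
  shows "(twist K s \<epsilon> has_derivative (\<lambda>h. twist_dx K s \<epsilon> p * fst h + twist_dy K s \<epsilon> p * snd h)) (at p)"
proof -
  define k where "k = 1 / (2 * (1 + K\<^sup>2))"
  show ?thesis
    unfolding twist_def twist_dx_def twist_dy_def Let_def k_def[symmetric]
    by (auto intro!: derivative_eq_intros has_derivative_norm_prod[OF assms]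
        simp: fun_eq_iff add_divide_distrib algebra_simps)
qed

text \<open>Put \<open>X = x + K * y\<close> and \<open>Y = y - K * x\<close>. The rotation acts on
  them by \<open>X' = - Y\<close> and \<open>Y' = X\<close> and preserves the norm, so
  \<open>X * Y\<close> has the derivative \<open>X\<^sup>2 - Y\<^sup>2\<close> and
  \<open>- \<epsilon> * X\<close> has the derivative \<open>\<epsilon> * Y\<close>.\<close>

lemma twist_rotation:
  "fst p * twist_dy K s \<epsilon> p - snd p * twist_dx K s \<epsilon> p =
     s * (\<epsilon> * (snd p - K * fst p) * (norm p)\<^sup>2
       + norm p * ((fst p + K * snd p)\<^sup>2 - (snd p - K * fst p)\<^sup>2) / (2 * (1 + K\<^sup>2)))"
proof -
  define k where "k = 1 / (2 * (1 + K\<^sup>2))"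
  have *: "a / (2 * (1 + K\<^sup>2)) = k * a" for a by (simp add: k_def)
  show ?thesis
    unfolding norm_squared_prod twist_dx_def twist_dy_def Let_def k_def[symmetric] *
    by (simp add: power2_eq_square algebra_simps)
qed

text \<open>The first term alone vanishes on the switching line; the second is positive there. Since
  \<open>X\<^sup>2 + Y\<^sup>2 = (1 + K\<^sup>2) * r\<^sup>2\<close>, the second term is
  \<open>r ^ 3 / 2\<close> minus \<open>Y\<^sup>2 * r / (1 + K\<^sup>2)\<close>, and the first
  covers this loss because \<open>\<bar>Y\<bar> \<le> (1 + K\<^sup>2) * r\<close>.\<close>

lemma twist_estimate:
  fixes p :: "real \<times> real" and K :: real
  defines "X \<equiv> fst p + K * snd p" and "Y \<equiv> snd p - K * fst p"
  shows "norm p ^ 3 / 2 \<le> \<bar>Y\<bar> * (norm p)\<^sup>2 + norm p * (X\<^sup>2 - Y\<^sup>2) / (2 * (1 + K\<^sup>2))"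
proof -
  define N where "N = 1 + K\<^sup>2"
  define r where "r = norm p"
  have N: "N \<ge> 1" by (simp add: N_def)
  have r: "r \<ge> 0" by (simp add: r_def)
  have XY: "X\<^sup>2 = N * r\<^sup>2 - Y\<^sup>2"
    unfolding X_def Y_def N_def r_def norm_squared_prod by (simp add: power2_eq_square algebra_simps)
  have "Y\<^sup>2 \<le> N * r\<^sup>2" using XY zero_le_power2[of X] by linarith
  also have "\<dots> \<le> (N * N) * r\<^sup>2" using mult_left_mono[of 1 N N] N by (intro mult_right_mono) auto
  finally have "Y\<^sup>2 \<le> (N * r)\<^sup>2" by (simp add: power_mult_distrib power2_eq_square[of N])
  then have "\<bar>Y\<bar> \<le> \<bar>N * r\<bar>" by (simp only: abs_le_square_iff)
  then have "\<bar>Y\<bar> \<le> N * r" using N r by simp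
  then have "\<bar>Y\<bar> * (\<bar>Y\<bar> * r) \<le> N * r * (\<bar>Y\<bar> * r)" using r by (intro mult_right_mono) auto
  moreover have "\<bar>Y\<bar> * (\<bar>Y\<bar> * r) = Y\<^sup>2 * r" by (simp add: power2_eq_square mult.assoc[symmetric])
  moreover have "N * r * (\<bar>Y\<bar> * r) = \<bar>Y\<bar> * r\<^sup>2 * N" by (simp add: power2_eq_square mult_ac)
  ultimately have "Y\<^sup>2 * r / N \<le> \<bar>Y\<bar> * r\<^sup>2" using N by (simp only: pos_divide_le_eq)
  moreover have "r * (X\<^sup>2 - Y\<^sup>2) / (2 * N) = r ^ 3 / 2 - Y\<^sup>2 * r / N"
    using N unfolding XY by (simp add: field_simps power2_eq_square power3_eq_cube)
  ultimately show ?thesis unfolding N_def[symmetric] r_def[symmetric] by linarith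
qed

lemma twist_bounded_lipschitz: "bounded_lipschitz (cball 0 1) (twist K s \<epsilon>)"
  unfolding twist_def by (intro bounded_lipschitz_intros)

lemma small_order_twist: "small_order 3 (twist K s \<epsilon>)"
  unfolding twist_def left_diff_distrib right_diff_distrib distrib_left distrib_right
  by (intro small_order_add small_order_diff) (rule small_order_mono, (rule small_order_factor)+, simp)+

lemma small_order_twist_dy: "small_order 2 (twist_dy K s \<epsilon>)"
  unfolding twist_dy_def Let_def left_diff_distrib right_diff_distrib distrib_left distrib_right
  by (intro small_order_add small_order_diff) (rule small_order_mono, (rule small_order_factor)+, simp)+

lemma twist_line:
  assumes "snd p = K * fst p"
  shows "twist K s \<epsilon> p = - \<epsilon> * s * (1 + K\<^sup>2)\<^sup>2 * fst p ^ 3"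
  using assms by (simp add: twist_def power2_eq_square power3_eq_cube algebra_simps)

text \<open>A solution of \<open>x * W\<^sub>y - y * W\<^sub>x = \<eta> / 8 * r\<^sup>4 - (A * x\<^sup>2 * y\<^sup>2 + B * y\<^sup>4 + C * x * y\<^sup>3)\<close> for \<open>\<eta> = A + 3 * B\<close>; the
  kernel element \<open>m * r\<^sup>4\<close> makes it vanish on the switching line.\<close>

definition quartic :: "real \<Rightarrow> real \<Rightarrow> real \<Rightarrow> real \<Rightarrow> real \<times> real \<Rightarrow> real" where
  "quartic \<eta> B C m p = \<eta> / 8 * (fst p * (fst p * (fst p * snd p))) + (B - \<eta> / 8) * (fst p * (snd p * (snd p * snd p)))
     - C / 4 * (snd p * (snd p * (snd p * snd p))) - m * (norm p * norm p * (norm p * norm p))"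

definition quartic_dx :: "real \<Rightarrow> real \<Rightarrow> real \<Rightarrow> real \<Rightarrow> real \<times> real \<Rightarrow> real" where
  "quartic_dx \<eta> B C m p = 3 * \<eta> / 8 * (fst p * (fst p * snd p)) + (B - \<eta> / 8) * (snd p * (snd p * snd p))
     - 4 * m * (fst p * (norm p * norm p))"

definition quartic_dy :: "real \<Rightarrow> real \<Rightarrow> real \<Rightarrow> real \<Rightarrow> real \<times> real \<Rightarrow> real" where
  "quartic_dy \<eta> B C m p = \<eta> / 8 * (fst p * (fst p * fst p)) + 3 * (B - \<eta> / 8) * (fst p * (snd p * snd p))
     - C * (snd p * (snd p * snd p)) - 4 * m * (snd p * (norm p * norm p))"

lemma norm_mult_norm_prod: "norm p * norm p = fst p * fst p + snd p * snd p" for p :: "real \<times> real"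
  using norm_squared_prod[of p] by (simp add: power2_eq_square)

lemma quartic_derivative:
  "(quartic \<eta> B C m has_derivative (\<lambda>h. quartic_dx \<eta> B C m p * fst h + quartic_dy \<eta> B C m p * snd h)) (at p)"
  unfolding quartic_def quartic_dx_def quartic_dy_def norm_mult_norm_prod
  by (auto intro!: derivative_eq_intros simp: fun_eq_iff field_simps)

lemma quartic_rotation:
  "fst p * quartic_dy (A + 3 * B) B C m p - snd p * quartic_dx (A + 3 * B) B C m p =
     (A + 3 * B) / 8 * norm p ^ 4 - (A * (fst p)\<^sup>2 * (snd p)\<^sup>2 + B * snd p ^ 4 + C * fst p * snd p ^ 3)"
proof -
  have "norm p ^ 4 = (fst p * fst p + snd p * snd p) * (fst p * fst p + snd p * snd p)"
    unfolding norm_mult_norm_prod[symmetric] by (simp add: power4_eq_xxxx)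
  then show ?thesis
    unfolding quartic_dx_def quartic_dy_def norm_mult_norm_prod
    by (simp add: field_simps power2_eq_square power3_eq_cube power4_eq_xxxx)
qed

lemma quartic_bounded_lipschitz: "bounded_lipschitz (cball 0 1) (quartic \<eta> B C m)"
  unfolding quartic_def by (intro bounded_lipschitz_intros)

lemma small_order_quartic: "small_order 3 (quartic \<eta> B C m)"
  unfolding quartic_def
  by (intro small_order_add small_order_diff) (rule small_order_mono, (rule small_order_factor)+, simp)+

lemma small_order_quartic_dy: "small_order 3 (quartic_dy \<eta> B C m)"
  unfolding quartic_dy_def
  by (intro small_order_add small_order_diff) (rule small_order_mono, (rule small_order_factor)+, simp)+

text \<open>On the line a quartic form is a multiple of \<open>x ^ 4\<close>, and
  \<open>norm p ^ 4\<close> becomes \<open>(1 + K\<^sup>2)\<^sup>2 * x ^ 4\<close>; the coefficient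
  \<open>m\<close> is the resulting quotient.\<close>

lemma quartic_line:
  assumes "snd p = K * fst p"
  shows "quartic \<eta> B C ((\<eta> / 8 * K + (B - \<eta> / 8) * K ^ 3 - C / 4 * K ^ 4) / (1 + K\<^sup>2)\<^sup>2) p = 0"
proof -
  have "1 + K\<^sup>2 \<noteq> 0" by (simp add: add_nonneg_eq_0_iff)
  moreover have "norm p * norm p = (1 + K\<^sup>2) * (fst p)\<^sup>2"
    unfolding norm_mult_norm_prod assms by (simp add: power2_eq_square algebra_simps)
  ultimately show ?thesis
    unfolding quartic_def assms
    by (simp add: power2_eq_square) (simp add: field_simps power2_eq_square power3_eq_cube power4_eq_xxxx)
qed

lemma cubic_base_line:
  assumes "snd p = K * fst p"
  shows "cubic_base a\<^sub>1 a\<^sub>2 p - cubic_base b\<^sub>1 b\<^sub>2 p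
    = ((b\<^sub>1 - a\<^sub>1) * K ^ 3 + (3 * a\<^sub>2 - 3 * b\<^sub>2) * K\<^sup>2 + 2 * a\<^sub>2 - 2 * b\<^sub>2) / 3 * fst p ^ 3"
  unfolding cubic_base_def assms by (simp add: power2_eq_square power3_eq_cube field_simps)

section \<open>Lyapunov functions for a nonzero and for a vanishing cubic defect\<close>

context switched_oscillator
begin

lemma field_pos: "field p = (- snd p, fst p + D\<^sub>1 (fst p) (snd p) * snd p)" if "side p > 0"
  using that field_off_line[of p] by (simp add: damping_def)

lemma field_neg: "field p = (- snd p, fst p + D\<^sub>2 (fst p) (snd p) * snd p)" if "side p < 0"
  using that field_off_line[of p] by (simp add: damping_def)

text \<open>Third order decides: the twist yields a rate of size
  \<open>\<bar>s\<bar> / 2 * r ^ 3\<close> with the sign of \<open>S\<close>, while the damping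
  coefficients of second degree enter only the remainder of order four.\<close>

lemma lyapunov_of_cubic_defect:
  assumes D1: "D\<^sub>1 = quad_damping a\<^sub>1 a\<^sub>2 a\<^sub>3 a\<^sub>4 a\<^sub>5" and D2: "D\<^sub>2 = quad_damping b\<^sub>1 b\<^sub>2 b\<^sub>3 b\<^sub>4 b\<^sub>5"
    and S: "S = (b\<^sub>1 - a\<^sub>1) * K ^ 3 + (3 * a\<^sub>2 - 3 * b\<^sub>2) * K\<^sup>2 + 2 * a\<^sub>2 - 2 * b\<^sub>2" "S \<noteq> 0"
  obtains r c M V where "switched_oscillator_lyapunov K D\<^sub>1 D\<^sub>2 L r c (sgn S) M V"
proof -
  \<comment> \<open>The jump \<open>S / 3 * x ^ 3\<close> is shared equally between the two half
    planes: on the line the twists for \<open>\<epsilon> = 1\<close> and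
    \<open>\<epsilon> = - 1\<close> equal \<open>- S / 6 * x ^ 3\<close> and
    \<open>S / 6 * x ^ 3\<close>.\<close>
  define s where "s = S / (6 * (1 + K\<^sup>2)\<^sup>2)"
  have N: "(1 + K\<^sup>2)\<^sup>2 > 0" by (smt (verit) zero_less_power2 zero_le_power2)
  have sS: "sgn S * s = \<bar>s\<bar>" "s \<noteq> 0" using N S(2) by (auto simp: s_def sgn_if abs_if divide_less_0_iff)
  define e where "e = (\<lambda>c\<^sub>1 c\<^sub>2 c\<^sub>3 c\<^sub>4 c\<^sub>5 \<epsilon> p. sgn S * (
      snd p * snd p * (c\<^sub>3 * (fst p)\<^sup>2 + c\<^sub>4 * fst p * snd p + c\<^sub>5 * (snd p)\<^sup>2)
      + quad_damping c\<^sub>1 c\<^sub>2 c\<^sub>3 c\<^sub>4 c\<^sub>5 (fst p) (snd p) * snd p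
        * ((2 * c\<^sub>2 * fst p * snd p - c\<^sub>1 * (snd p)\<^sup>2) + twist_dy K s \<epsilon> p)))"
  have e: "small_order (Suc 3) (e c\<^sub>1 c\<^sub>2 c\<^sub>3 c\<^sub>4 c\<^sub>5 \<epsilon>)" for c\<^sub>1 c\<^sub>2 c\<^sub>3 c\<^sub>4 c\<^sub>5 \<epsilon>
  proof -
    have Q: "small_order 2 (\<lambda>p. c\<^sub>3 * (fst p)\<^sup>2 + c\<^sub>4 * fst p * snd p + c\<^sub>5 * (snd p)\<^sup>2)"
      "small_order 2 (\<lambda>p. (2 * c\<^sub>2 * fst p * snd p - c\<^sub>1 * (snd p)\<^sup>2))"
      unfolding power2_eq_square
      by (intro small_order_add small_order_diff; rule small_order_mono, (rule small_order_factor)+, simp)+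
    have "small_order 4 (\<lambda>p. snd p * snd p * (c\<^sub>3 * (fst p)\<^sup>2 + c\<^sub>4 * fst p * snd p + c\<^sub>5 * (snd p)\<^sup>2))"
      by (rule small_order_mono, (rule small_order_mult small_order_snd Q)+) simp
    moreover have "small_order 4 (\<lambda>p. quad_damping c\<^sub>1 c\<^sub>2 c\<^sub>3 c\<^sub>4 c\<^sub>5 (fst p) (snd p) * snd p *
        ((2 * c\<^sub>2 * fst p * snd p - c\<^sub>1 * (snd p)\<^sup>2) + twist_dy K s \<epsilon> p))"
      using small_order_mult[OF small_order_mult[OF small_order_quad_damping small_order_snd]
          small_order_add[OF Q(2) small_order_twist_dy]] by (rule small_order_mono) simp
    ultimately have "small_order (0 + 4) (e c\<^sub>1 c\<^sub>2 c\<^sub>3 c\<^sub>4 c\<^sub>5 \<epsilon>)"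
      unfolding e_def by (intro small_order_mult small_order_const small_order_add)
    then show ?thesis by simp
  qed
  \<comment> \<open>Choosing \<open>\<epsilon>\<close> as the sign of the half plane turns the term
    \<open>\<epsilon> * side p\<close> of the rotation derivative into an absolute value, so both
    pieces change in the same direction.\<close>
  have rate: "\<bar>s\<bar> / 2 * norm p ^ 3 + e c\<^sub>1 c\<^sub>2 c\<^sub>3 c\<^sub>4 c\<^sub>5 \<epsilon> p \<le> sgn S *
      ((fst p + c\<^sub>2 * ((snd p)\<^sup>2 + 2 * (fst p)\<^sup>2) + twist_dx K s \<epsilon> p) * - snd p
        + (snd p - c\<^sub>1 * (snd p)\<^sup>2 + 2 * c\<^sub>2 * fst p * snd p + twist_dy K s \<epsilon> p)
          * (fst p + quad_damping c\<^sub>1 c\<^sub>2 c\<^sub>3 c\<^sub>4 c\<^sub>5 (fst p) (snd p) * snd p))"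
    if \<epsilon>: "\<epsilon> * side p = \<bar>side p\<bar>" for c\<^sub>1 c\<^sub>2 c\<^sub>3 c\<^sub>4 c\<^sub>5 \<epsilon> p
  proof -
    have "\<bar>s\<bar> / 2 * norm p ^ 3 \<le> sgn S * (fst p * twist_dy K s \<epsilon> p - snd p * twist_dx K s \<epsilon> p)"
      using mult_left_mono[OF twist_estimate[of p K], of "\<bar>s\<bar>"] \<epsilon>
      unfolding twist_rotation mult.assoc[symmetric] sS(1) by (simp add: side_def mult_ac)
    then show ?thesis
      unfolding cubic_base_rate by (simp add: e_def algebra_simps)
  qed
  show ?thesis
  proof (rule lyapunov_from_pieces[of "\<lambda>p. cubic_base a\<^sub>1 a\<^sub>2 p + twist K s 1 p"
        "\<lambda>p. cubic_base b\<^sub>1 b\<^sub>2 p + twist K s (- 1) p"])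
    show "bounded_lipschitz (cball 0 1) (\<lambda>p. cubic_base a\<^sub>1 a\<^sub>2 p + twist K s 1 p)"
      "bounded_lipschitz (cball 0 1) (\<lambda>p. cubic_base b\<^sub>1 b\<^sub>2 p + twist K s (- 1) p)"
      by (intro bounded_lipschitz_add cubic_base_bounded_lipschitz twist_bounded_lipschitz)+
    show "cubic_base a\<^sub>1 a\<^sub>2 p + twist K s 1 p = cubic_base b\<^sub>1 b\<^sub>2 p + twist K s (- 1) p" if "side p = 0" for p
    proof -
      have l: "snd p = K * fst p" using that by (simp add: side_def)
      have "s * (1 + K\<^sup>2)\<^sup>2 = S / 6" using N by (simp add: s_def)
      then have tw: "twist K s \<epsilon> p = - \<epsilon> * (S / 6) * fst p ^ 3" for \<epsilon>
        using twist_line[OF l, of s \<epsilon>] by (simp only: mult.assoc[of "- \<epsilon>" s])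
      show ?thesis
        using cubic_base_line[OF l, of a\<^sub>1 a\<^sub>2 b\<^sub>1 b\<^sub>2]
        unfolding S(1)[symmetric] tw by (simp add: field_simps)
    qed
    show "small_order 3 (\<lambda>p. cubic_base a\<^sub>1 a\<^sub>2 p + twist K s 1 p - (norm p)\<^sup>2 / 2)"
      "small_order 3 (\<lambda>p. cubic_base b\<^sub>1 b\<^sub>2 p + twist K s (- 1) p - (norm p)\<^sup>2 / 2)"
      using small_order_add[OF cubic_base_near[of a\<^sub>1 a\<^sub>2] small_order_twist[of K s 1]]
        small_order_add[OF cubic_base_near[of b\<^sub>1 b\<^sub>2] small_order_twist[of K s "- 1"]]
      by (simp_all add: algebra_simps)
    show "((\<lambda>p. cubic_base a\<^sub>1 a\<^sub>2 p + twist K s 1 p) has_derivative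
        (\<lambda>h. (fst p + a\<^sub>2 * ((snd p)\<^sup>2 + 2 * (fst p)\<^sup>2) + twist_dx K s 1 p) * fst h
          + (snd p - a\<^sub>1 * (snd p)\<^sup>2 + 2 * a\<^sub>2 * fst p * snd p + twist_dy K s 1 p) * snd h)) (at p)"
      "((\<lambda>p. cubic_base b\<^sub>1 b\<^sub>2 p + twist K s (- 1) p) has_derivative
        (\<lambda>h. (fst p + b\<^sub>2 * ((snd p)\<^sup>2 + 2 * (fst p)\<^sup>2) + twist_dx K s (- 1) p) * fst h
          + (snd p - b\<^sub>1 * (snd p)\<^sup>2 + 2 * b\<^sub>2 * fst p * snd p + twist_dy K s (- 1) p) * snd h)) (at p)"
      if "p \<noteq> 0" for p
      by (rule has_derivative_eq_rhs[OF has_derivative_add[OF cubic_base_derivative twist_derivative[OF that]]],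
          simp add: fun_eq_iff algebra_simps)+
    show "(3 :: nat) \<le> 4" "0 < \<bar>s\<bar> / 2" using sS by simp_all
    show "small_order (Suc 3) (e a\<^sub>1 a\<^sub>2 a\<^sub>3 a\<^sub>4 a\<^sub>5 1)" "small_order (Suc 3) (e b\<^sub>1 b\<^sub>2 b\<^sub>3 b\<^sub>4 b\<^sub>5 (- 1))" by (rule e)+
    fix p
    show "\<bar>s\<bar> / 2 * norm p ^ 3 + e a\<^sub>1 a\<^sub>2 a\<^sub>3 a\<^sub>4 a\<^sub>5 1 p \<le> sgn S *
        ((fst p + a\<^sub>2 * ((snd p)\<^sup>2 + 2 * (fst p)\<^sup>2) + twist_dx K s 1 p) * fst (field p)
          + (snd p - a\<^sub>1 * (snd p)\<^sup>2 + 2 * a\<^sub>2 * fst p * snd p + twist_dy K s 1 p) * snd (field p))"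
      if "side p > 0"
      using rate[of 1 p] that unfolding field_pos[OF that] by (simp add: D1)
    show "\<bar>s\<bar> / 2 * norm p ^ 3 + e b\<^sub>1 b\<^sub>2 b\<^sub>3 b\<^sub>4 b\<^sub>5 (- 1) p \<le> sgn S *
        ((fst p + b\<^sub>2 * ((snd p)\<^sup>2 + 2 * (fst p)\<^sup>2) + twist_dx K s (- 1) p) * fst (field p)
          + (snd p - b\<^sub>1 * (snd p)\<^sup>2 + 2 * b\<^sub>2 * fst p * snd p + twist_dy K s (- 1) p) * snd (field p))"
      if "side p < 0"
      using rate[of "- 1" p] that unfolding field_neg[OF that] by (simp add: D2)
  qed (rule that)
qed

text \<open>Without a defect the two base functions agree on the line, and fourth order decides.
  Both averages are positive by assumption, so the orbit gains energy in either half plane.\<close>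

lemma lyapunov_of_no_cubic_defect:
  assumes D1: "D\<^sub>1 = quad_damping a\<^sub>1 a\<^sub>2 a\<^sub>3 a\<^sub>4 a\<^sub>5" and D2: "D\<^sub>2 = quad_damping b\<^sub>1 b\<^sub>2 b\<^sub>3 b\<^sub>4 b\<^sub>5"
    and S: "(b\<^sub>1 - a\<^sub>1) * K ^ 3 + (3 * a\<^sub>2 - 3 * b\<^sub>2) * K\<^sup>2 + 2 * a\<^sub>2 - 2 * b\<^sub>2 = 0"
    and pos: "3 * a\<^sub>5 + a\<^sub>3 - a\<^sub>1 * a\<^sub>2 > 0" "3 * b\<^sub>5 + b\<^sub>3 - b\<^sub>1 * b\<^sub>2 > 0"
  obtains r c M V where "switched_oscillator_lyapunov K D\<^sub>1 D\<^sub>2 L r c 1 M V"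
proof -
  define \<eta> where "\<eta> = (\<lambda>c\<^sub>1 c\<^sub>2 c\<^sub>3 c\<^sub>5. (c\<^sub>3 + 2 * c\<^sub>1 * c\<^sub>2) + 3 * (c\<^sub>5 - c\<^sub>1 * c\<^sub>2) :: real)"
  define m where "m = (\<lambda>\<eta> B C. (\<eta> / 8 * K + (B - \<eta> / 8) * K ^ 3 - C / 4 * K ^ 4) / (1 + K\<^sup>2)\<^sup>2)"
  \<comment> \<open>Besides \<open>y\<^sup>2 * (c\<^sub>3 * x\<^sup>2 + c\<^sub>4 * x * y +
    c\<^sub>5 * y\<^sup>2)\<close> the fourth order contains \<open>y\<^sup>2 * (c\<^sub>1 * x +
    c\<^sub>2 * y) * (2 * c\<^sub>2 * x - c\<^sub>1 * y)\<close>, the effect of the linear damping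
    on the gradient of the cubic form. Expanding the sum gives the coefficients
    \<open>c\<^sub>3 + 2 * c\<^sub>1 * c\<^sub>2\<close> of \<open>x\<^sup>2 * y\<^sup>2\<close>,
    \<open>B\<close> of \<open>y ^ 4\<close> and \<open>C\<close> of
    \<open>x * y ^ 3\<close>.\<close>
  define q where "q = (\<lambda>(f :: real \<Rightarrow> real \<Rightarrow> real \<Rightarrow> real \<Rightarrow> real \<times> real \<Rightarrow> real) c\<^sub>1 c\<^sub>2 c\<^sub>3 c\<^sub>4 c\<^sub>5.
    let h = \<eta> c\<^sub>1 c\<^sub>2 c\<^sub>3 c\<^sub>5; B = c\<^sub>5 - c\<^sub>1 * c\<^sub>2; C = c\<^sub>4 - c\<^sub>1\<^sup>2 + 2 * c\<^sub>2\<^sup>2 in f h B C (m h B C))"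
  \<comment> \<open>Only the quadratic part of the damping meets the gradient of the cubic form
    here: the linear part has gone into the quartic correction. All that is left has order
    five.\<close>
  define e where "e = (\<lambda>c\<^sub>1 c\<^sub>2 c\<^sub>3 c\<^sub>4 c\<^sub>5 p. snd p * (c\<^sub>3 * (fst p)\<^sup>2 + c\<^sub>4 * fst p * snd p + c\<^sub>5 * (snd p)\<^sup>2)
        * (2 * c\<^sub>2 * fst p * snd p - c\<^sub>1 * (snd p)\<^sup>2)
      + quad_damping c\<^sub>1 c\<^sub>2 c\<^sub>3 c\<^sub>4 c\<^sub>5 (fst p) (snd p) * snd p * q quartic_dy c\<^sub>1 c\<^sub>2 c\<^sub>3 c\<^sub>4 c\<^sub>5 p)"
  define \<kappa> where "\<kappa> = min (\<eta> a\<^sub>1 a\<^sub>2 a\<^sub>3 a\<^sub>5) (\<eta> b\<^sub>1 b\<^sub>2 b\<^sub>3 b\<^sub>5) / 8"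
  have e: "small_order (Suc 4) (e c\<^sub>1 c\<^sub>2 c\<^sub>3 c\<^sub>4 c\<^sub>5)" for c\<^sub>1 c\<^sub>2 c\<^sub>3 c\<^sub>4 c\<^sub>5
  proof -
    have Q: "small_order 2 (\<lambda>p. c\<^sub>3 * (fst p)\<^sup>2 + c\<^sub>4 * fst p * snd p + c\<^sub>5 * (snd p)\<^sup>2)"
      "small_order 2 (\<lambda>p. (2 * c\<^sub>2 * fst p * snd p - c\<^sub>1 * (snd p)\<^sup>2))"
      unfolding power2_eq_square
      by (intro small_order_add small_order_diff; rule small_order_mono, (rule small_order_factor)+, simp)+
    have "small_order 5 (\<lambda>p. snd p * (c\<^sub>3 * (fst p)\<^sup>2 + c\<^sub>4 * fst p * snd p + c\<^sub>5 * (snd p)\<^sup>2)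
        * (2 * c\<^sub>2 * fst p * snd p - c\<^sub>1 * (snd p)\<^sup>2))"
      using small_order_mult[OF small_order_mult[OF small_order_snd Q(1)] Q(2)] by (rule small_order_mono) simp
    moreover have "small_order 5 (\<lambda>p. quad_damping c\<^sub>1 c\<^sub>2 c\<^sub>3 c\<^sub>4 c\<^sub>5 (fst p) (snd p) * snd p
        * q quartic_dy c\<^sub>1 c\<^sub>2 c\<^sub>3 c\<^sub>4 c\<^sub>5 p)"
      using small_order_mult[OF small_order_mult[OF small_order_quad_damping small_order_snd] small_order_quartic_dy]
      unfolding q_def Let_def by (rule small_order_mono) simp
    ultimately have "small_order 5 (e c\<^sub>1 c\<^sub>2 c\<^sub>3 c\<^sub>4 c\<^sub>5)" unfolding e_def by (rule small_order_add)
    then show ?thesis by simp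
  qed
  have rate: "\<kappa> * norm p ^ 4 + e c\<^sub>1 c\<^sub>2 c\<^sub>3 c\<^sub>4 c\<^sub>5 p \<le> 1 *
      ((fst p + c\<^sub>2 * ((snd p)\<^sup>2 + 2 * (fst p)\<^sup>2) + q quartic_dx c\<^sub>1 c\<^sub>2 c\<^sub>3 c\<^sub>4 c\<^sub>5 p) * - snd p
        + (snd p - c\<^sub>1 * (snd p)\<^sup>2 + 2 * c\<^sub>2 * fst p * snd p + q quartic_dy c\<^sub>1 c\<^sub>2 c\<^sub>3 c\<^sub>4 c\<^sub>5 p)
          * (fst p + quad_damping c\<^sub>1 c\<^sub>2 c\<^sub>3 c\<^sub>4 c\<^sub>5 (fst p) (snd p) * snd p))"
    if "\<kappa> \<le> \<eta> c\<^sub>1 c\<^sub>2 c\<^sub>3 c\<^sub>5 / 8" for c\<^sub>1 c\<^sub>2 c\<^sub>3 c\<^sub>4 c\<^sub>5 p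
  proof -
    have "\<kappa> * norm p ^ 4 \<le> \<eta> c\<^sub>1 c\<^sub>2 c\<^sub>3 c\<^sub>5 / 8 * norm p ^ 4" using that by (rule mult_right_mono) simp
    moreover have "fst p * q quartic_dy c\<^sub>1 c\<^sub>2 c\<^sub>3 c\<^sub>4 c\<^sub>5 p - snd p * q quartic_dx c\<^sub>1 c\<^sub>2 c\<^sub>3 c\<^sub>4 c\<^sub>5 p
      = \<eta> c\<^sub>1 c\<^sub>2 c\<^sub>3 c\<^sub>5 / 8 * norm p ^ 4 - ((c\<^sub>3 + 2 * c\<^sub>1 * c\<^sub>2) * (fst p)\<^sup>2 * (snd p)\<^sup>2
          + (c\<^sub>5 - c\<^sub>1 * c\<^sub>2) * snd p ^ 4 + (c\<^sub>4 - c\<^sub>1\<^sup>2 + 2 * c\<^sub>2\<^sup>2) * fst p * snd p ^ 3)"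
      unfolding q_def Let_def \<eta>_def by (rule quartic_rotation)
    ultimately show ?thesis
      unfolding cubic_base_rate
      by (simp add: e_def quad_damping_def power2_eq_square power3_eq_cube power4_eq_xxxx algebra_simps)
  qed
  have q_line: "q quartic c\<^sub>1 c\<^sub>2 c\<^sub>3 c\<^sub>4 c\<^sub>5 p = 0" if "side p = 0" for c\<^sub>1 c\<^sub>2 c\<^sub>3 c\<^sub>4 c\<^sub>5 p
    unfolding q_def Let_def m_def using that by (intro quartic_line) (simp add: side_def)
  have q_deriv: "((\<lambda>p. cubic_base c\<^sub>1 c\<^sub>2 p + q quartic c\<^sub>1 c\<^sub>2 c\<^sub>3 c\<^sub>4 c\<^sub>5 p) has_derivative
        (\<lambda>h. (fst p + c\<^sub>2 * ((snd p)\<^sup>2 + 2 * (fst p)\<^sup>2) + q quartic_dx c\<^sub>1 c\<^sub>2 c\<^sub>3 c\<^sub>4 c\<^sub>5 p) * fst h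
          + (snd p - c\<^sub>1 * (snd p)\<^sup>2 + 2 * c\<^sub>2 * fst p * snd p + q quartic_dy c\<^sub>1 c\<^sub>2 c\<^sub>3 c\<^sub>4 c\<^sub>5 p) * snd h)) (at p)"
    for c\<^sub>1 c\<^sub>2 c\<^sub>3 c\<^sub>4 c\<^sub>5 p
    unfolding q_def Let_def
    by (rule has_derivative_eq_rhs[OF has_derivative_add[OF cubic_base_derivative quartic_derivative]])
       (simp add: fun_eq_iff algebra_simps)
  have q_lip: "bounded_lipschitz (cball 0 1) (\<lambda>p. cubic_base c\<^sub>1 c\<^sub>2 p + q quartic c\<^sub>1 c\<^sub>2 c\<^sub>3 c\<^sub>4 c\<^sub>5 p)"
    for c\<^sub>1 c\<^sub>2 c\<^sub>3 c\<^sub>4 c\<^sub>5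
    unfolding q_def Let_def by (intro bounded_lipschitz_add cubic_base_bounded_lipschitz quartic_bounded_lipschitz)
  have q_near: "small_order 3 (\<lambda>p. cubic_base c\<^sub>1 c\<^sub>2 p + q quartic c\<^sub>1 c\<^sub>2 c\<^sub>3 c\<^sub>4 c\<^sub>5 p - (norm p)\<^sup>2 / 2)"
    for c\<^sub>1 c\<^sub>2 c\<^sub>3 c\<^sub>4 c\<^sub>5
    using small_order_add[OF cubic_base_near small_order_quartic] unfolding q_def Let_def by (simp add: algebra_simps)
  show ?thesis
  proof (rule lyapunov_from_pieces[of "\<lambda>p. cubic_base a\<^sub>1 a\<^sub>2 p + q quartic a\<^sub>1 a\<^sub>2 a\<^sub>3 a\<^sub>4 a\<^sub>5 p"
        "\<lambda>p. cubic_base b\<^sub>1 b\<^sub>2 p + q quartic b\<^sub>1 b\<^sub>2 b\<^sub>3 b\<^sub>4 b\<^sub>5 p", OF q_lip q_lip _ q_near q_near q_deriv q_deriv _ _ e e])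
    show "cubic_base a\<^sub>1 a\<^sub>2 p + q quartic a\<^sub>1 a\<^sub>2 a\<^sub>3 a\<^sub>4 a\<^sub>5 p = cubic_base b\<^sub>1 b\<^sub>2 p + q quartic b\<^sub>1 b\<^sub>2 b\<^sub>3 b\<^sub>4 b\<^sub>5 p"
      if "side p = 0" for p
      using cubic_base_line[of p K a\<^sub>1 a\<^sub>2 b\<^sub>1 b\<^sub>2] that S q_line[OF that] by (simp add: side_def)
    show "(4 :: nat) \<le> 4" "0 < \<kappa>" using pos by (simp_all add: \<kappa>_def \<eta>_def algebra_simps)
    fix p
    show "\<kappa> * norm p ^ 4 + e a\<^sub>1 a\<^sub>2 a\<^sub>3 a\<^sub>4 a\<^sub>5 p \<le> 1 *
        ((fst p + a\<^sub>2 * ((snd p)\<^sup>2 + 2 * (fst p)\<^sup>2) + q quartic_dx a\<^sub>1 a\<^sub>2 a\<^sub>3 a\<^sub>4 a\<^sub>5 p) * fst (field p)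
          + (snd p - a\<^sub>1 * (snd p)\<^sup>2 + 2 * a\<^sub>2 * fst p * snd p + q quartic_dy a\<^sub>1 a\<^sub>2 a\<^sub>3 a\<^sub>4 a\<^sub>5 p) * snd (field p))"
      if "side p > 0"
      using rate[of a\<^sub>1 a\<^sub>2 a\<^sub>3 a\<^sub>5 p a\<^sub>4] unfolding field_pos[OF that] by (simp add: \<kappa>_def D1)
    show "\<kappa> * norm p ^ 4 + e b\<^sub>1 b\<^sub>2 b\<^sub>3 b\<^sub>4 b\<^sub>5 p \<le> 1 *
        ((fst p + b\<^sub>2 * ((snd p)\<^sup>2 + 2 * (fst p)\<^sup>2) + q quartic_dx b\<^sub>1 b\<^sub>2 b\<^sub>3 b\<^sub>4 b\<^sub>5 p) * fst (field p)
          + (snd p - b\<^sub>1 * (snd p)\<^sup>2 + 2 * b\<^sub>2 * fst p * snd p + q quartic_dy b\<^sub>1 b\<^sub>2 b\<^sub>3 b\<^sub>4 b\<^sub>5 p) * snd (field p))"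
      if "side p < 0"
      using rate[of b\<^sub>1 b\<^sub>2 b\<^sub>3 b\<^sub>5 p b\<^sub>4] unfolding field_neg[OF that] by (simp add: \<kappa>_def D2)
  qed (rule that)
qed

end

theorem theorem5p1:
  fixes a1 a2 a3 a4 a5 b1 b2 b3 b4 b5 K :: real
  assumes "3 * a5 + a3 - a1 * a2 > 0"
    and "3 * b5 + b3 - b1 * b2 > 0"
  shows "filippov_asymptotically_stable
           (switched_field K
              (damped_field (quad_damping a1 a2 a3 a4 a5))
              (damped_field (quad_damping b1 b2 b3 b4 b5)))
           (0, 0)
         \<longleftrightarrow> (b1 - a1) * K ^ 3 + (3 * a2 - 3 * b2) * K ^ 2 + 2 * a2 - 2 * b2 < 0"
proof -
  let ?D1 = "quad_damping a1 a2 a3 a4 a5" and ?D2 = "quad_damping b1 b2 b3 b4 b5"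
  define S where "S = (b1 - a1) * K ^ 3 + (3 * a2 - 3 * b2) * K\<^sup>2 + 2 * a2 - 2 * b2"
  obtain L1 L2 where "L1-lipschitz_on (cball 0 1) (\<lambda>(x, y). ?D1 x y)" "L2-lipschitz_on (cball 0 1) (\<lambda>(x, y). ?D2 x y)"
    using bounded_lipschitz_quad_damping unfolding bounded_lipschitz_def by metis
  then have "switched_oscillator ?D1 ?D2 (max L1 L2)"
    by unfold_locales (auto simp: quad_damping_def elim: lipschitz_on_mono)
  then interpret switched_oscillator K ?D1 ?D2 "max L1 L2" .
  show ?thesis
  proof (cases "S < 0")
    case True
    obtain r c M V where "switched_oscillator_lyapunov K ?D1 ?D2 (max L1 L2) r c (sgn S) M V"
      by (rule lyapunov_of_cubic_defect[OF refl refl S_def]) (use True in simp, rule that)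
    then interpret switched_oscillator_decay K ?D1 ?D2 "max L1 L2" r c M V
      using True by (simp add: switched_oscillator_decay_def)
    show ?thesis using asymptotically_stable True by (simp add: S_def zero_prod_def)
  next
    case False
    \<comment> \<open>A positive \<open>S\<close> gives growth at third order, a vanishing
      \<open>S\<close> growth at fourth order; the instability argument is the same for
      both.\<close>
    obtain r c M V where "switched_oscillator_lyapunov K ?D1 ?D2 (max L1 L2) r c 1 M V"
    proof (cases "S = 0")
      case True
      then have "(b1 - a1) * K ^ 3 + (3 * a2 - 3 * b2) * K\<^sup>2 + 2 * a2 - 2 * b2 = 0" by (simp add: S_def)
      then show ?thesis by (rule lyapunov_of_no_cubic_defect[OF refl refl _ assms]) (rule that)
    next
      case S: False
      then have "sgn S = 1" using False by simp
      with lyapunov_of_cubic_defect[OF refl refl S_def S] that show ?thesis by metis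
    qed
    then interpret switched_oscillator_growth K ?D1 ?D2 "max L1 L2" r c M V
      by (simp add: switched_oscillator_growth_def)
    show ?thesis using not_asymptotically_stable False by (simp add: S_def zero_prod_def)
  qed
qed

end
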